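(* For an arbitrary LJB-algebra $A$ there exists an LC*-algebra $LC_u^*(A)$, unique up to a topological $*$-isomorphism (the universal enveloping locally C*-algebra for the LJB-algebra $A$), and a Jordan homomorphism $\psi_A : A \to LC_u^*(A)_{sa}$ from $A$ to the self-adjoint part of $LC_u^*(A)$, such that: (1) $\psi_A(A)$ generates $LC_u^*(A)$ as an LC*-algebra; (2) for any pair composed of an LC*-algebra $\mathfrak{A}$ and a Jordan homomorphism $\varphi : A \to \mathfrak{A}_{sa}$ from $A$ into the self-adjoint part of $\mathfrak{A}$, there exists a $*$-homomorphism $\widehat{\varphi} : LC_u^*(A) \to \mathfrak{A}$ from the LC*-algebra $LC_u^*(A)$ into the LC*-algebra $\mathfrak{A}$ such that $\varphi = \widehat{\varphi} \circ \psi_A$; (3) there exists a $*$-antiautomorphism $\Phi$ of order 2 on the LC*-algebra $LC_u^*(A)$ such that $\Phi(\psi_A(a)) = \psi_A(a)$ for all $a \in A$.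
   Context: A JB-algebra is a real Jordan algebra $(B,\circ)$ that is a Banach space under a norm satisfying $\|a\circ b\|\le\|a\|\,\|b\|$, $\|a^2\|=\|a\|^2$ and $\|a^2\|\le\|a^2+b^2\|$ for all $a,b\in B$. A projective family of JB-algebras (respectively C*-algebras) over a directed set $\Lambda$ is a family $(B_\alpha)_{\alpha\in\Lambda}$ of such algebras with Jordan homomorphisms (respectively $*$-homomorphisms) $f_{\alpha\beta}:B_\beta\to B_\alpha$ for $\alpha\le\beta$, such that $f_{\alpha\alpha}=\mathrm{id}$ and $f_{\alpha\beta}\circ f_{\beta\gamma}=f_{\alpha\gamma}$ for $\alpha\le\beta\le\gamma$. Its projective limit $\varprojlim B_\alpha$ is the subalgebra of compatible families in $\prod_\alpha B_\alpha$ with the topology induced by the product topology. A locally JB-algebra (LJB-algebra) is a real topological Jordan algebra that is a projective limit of a projective family of JB-algebras (up to topological isomorphism). A locally C*-algebra (LC*-algebra) is a complex topological $*$-algebra that is topologically $*$-isomorphic to a projective limit of a projective family of C*-algebras. For an LC*-algebra $\mathfrak{A}$, the self-adjoint part is $\mathfrak{A}_{sa}=\{x\in\mathfrak{A}: x^*=x\}$, regarded as a real Jordan algebra with product $x\circ y=\tfrac12(xy+yx)$. A Jordan homomorphism is a real-linear map preserving $\circ$. A subset generates an LC*-algebra (as an LC*-algebra) if the smallest closed $*$-subalgebra containing it is the whole algebra. A $*$-antiautomorphism is a bijective complex-linear map $\Phi$ of the algebra onto itself with $\Phi(xy)=\Phi(y)\Phi(x)$ and $\Phi(x^* )=\Phi(x)^*$;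 "of order 2" means $\Phi\circ\Phi=\mathrm{id}$. A topological $*$-isomorphism is a $*$-isomorphism that is also a homeomorphism.
   Formalization: All homomorphisms and Φ are taken continuous (else uniqueness fails: C(ω₁) with compact-open or sup-norm topology). The envelope is stated per type of target; being also universal for targets on its own type, it is one algebra up to topological *-isomorphism. *)

theory Defs
  imports "HOL-Analysis.Analysis" "HOL-Algebra.Module"
begin

section \<open>Algebras over the real and complex numbers\<close>

text \<open>
  The members of a projective family are different algebras, so algebras are given by explicit
  carriers, with the module records of HOL-Algebra. The field \<open>one\<close> that these records inherit
  from rings is never constrained: algebras need not be unital, and homomorphisms ignore it.
\<close>

definition scalars :: "'k::field ring" where
  "scalars = \<lparr>carrier = UNIV, mult = (*), one = 1, zero = 0, add = (+)\<rparr>"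

locale nonassoc_algebra = Module.module scalars M
  for M :: "('k::field, 'a, 'm) module_scheme" (structure) +
  assumes mult_closed: "\<lbrakk>x \<in> carrier M; y \<in> carrier M\<rbrakk> \<Longrightarrow> x \<otimes> y \<in> carrier M"
    and mult_add_left: "\<lbrakk>x \<in> carrier M; y \<in> carrier M; z \<in> carrier M\<rbrakk>
          \<Longrightarrow> (x \<oplus> y) \<otimes> z = (x \<otimes> z) \<oplus> (y \<otimes> z)"
    and mult_add_right: "\<lbrakk>x \<in> carrier M; y \<in> carrier M; z \<in> carrier M\<rbrakk>
          \<Longrightarrow> x \<otimes> (y \<oplus> z) = (x \<otimes> y) \<oplus> (x \<otimes> z)"
    and mult_smult_left: "\<lbrakk>x \<in> carrier M; y \<in> carrier M\<rbrakk>
          \<Longrightarrow> (c \<odot> x) \<otimes> y = c \<odot> (x \<otimes> y)"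
    and mult_smult_right: "\<lbrakk>x \<in> carrier M; y \<in> carrier M\<rbrakk>
          \<Longrightarrow> x \<otimes> (c \<odot> y) = c \<odot> (x \<otimes> y)"

locale jordan_algebra = nonassoc_algebra M
  for M :: "(real, 'a, 'm) module_scheme" (structure) +
  assumes jordan_commute: "\<lbrakk>x \<in> carrier M; y \<in> carrier M\<rbrakk> \<Longrightarrow> x \<otimes> y = y \<otimes> x"
    and jordan_identity: "\<lbrakk>x \<in> carrier M; y \<in> carrier M\<rbrakk>
          \<Longrightarrow> ((x \<otimes> x) \<otimes> y) \<otimes> x = (x \<otimes> x) \<otimes> (y \<otimes> x)"

record 'a star_alg = "(complex, 'a) module" +
  star :: "'a \<Rightarrow> 'a"

locale star_algebra = nonassoc_algebra M
  for M :: "('a, 'm) star_alg_scheme" (structure) +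
  assumes mult_assoc: "\<lbrakk>x \<in> carrier M; y \<in> carrier M; z \<in> carrier M\<rbrakk>
          \<Longrightarrow> (x \<otimes> y) \<otimes> z = x \<otimes> (y \<otimes> z)"
    and star_closed: "x \<in> carrier M \<Longrightarrow> star M x \<in> carrier M"
    and star_star: "x \<in> carrier M \<Longrightarrow> star M (star M x) = x"
    and star_add: "\<lbrakk>x \<in> carrier M; y \<in> carrier M\<rbrakk>
          \<Longrightarrow> star M (x \<oplus> y) = star M x \<oplus> star M y"
    and star_smult: "x \<in> carrier M \<Longrightarrow> star M (c \<odot> x) = cnj c \<odot> star M x"
    and star_mult: "\<lbrakk>x \<in> carrier M; y \<in> carrier M\<rbrakk>
          \<Longrightarrow> star M (x \<otimes> y) = star M y \<otimes> star M x"

text \<open>For real Jordan algebras, \<open>alg_hom\<close> is the set of Jordan homomorphisms.\<close>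

definition alg_hom ::
  "('k, 'a, 'm) module_scheme \<Rightarrow> ('k, 'b, 'n) module_scheme \<Rightarrow> ('a \<Rightarrow> 'b) set" where
  "alg_hom M N = {h. h \<in> carrier M \<rightarrow> carrier N \<and>
     (\<forall>x\<in>carrier M. \<forall>y\<in>carrier M. h (x \<oplus>\<^bsub>M\<^esub> y) = h x \<oplus>\<^bsub>N\<^esub> h y) \<and>
     (\<forall>c. \<forall>x\<in>carrier M. h (c \<odot>\<^bsub>M\<^esub> x) = c \<odot>\<^bsub>N\<^esub> h x) \<and>
     (\<forall>x\<in>carrier M. \<forall>y\<in>carrier M. h (x \<otimes>\<^bsub>M\<^esub> y) = h x \<otimes>\<^bsub>N\<^esub> h y)}"

definition star_hom :: "('a, 'm) star_alg_scheme \<Rightarrow> ('b, 'n) star_alg_scheme \<Rightarrow> ('a \<Rightarrow> 'b) set" where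
  "star_hom M N = {h \<in> alg_hom M N. \<forall>x\<in>carrier M. h (star M x) = star N (h x)}"

definition sa_part :: "'a star_alg \<Rightarrow> (real, 'a) module" where
  "sa_part M = \<lparr>carrier = {x \<in> carrier M. star M x = x},
     mult = (\<lambda>x y. (1/2) \<odot>\<^bsub>M\<^esub> ((x \<otimes>\<^bsub>M\<^esub> y) \<oplus>\<^bsub>M\<^esub> (y \<otimes>\<^bsub>M\<^esub> x))),
     one = \<one>\<^bsub>M\<^esub>, zero = \<zero>\<^bsub>M\<^esub>, add = add M,
     smult = (\<lambda>r x. complex_of_real r \<odot>\<^bsub>M\<^esub> x)\<rparr>"


section \<open>JB-algebras and C*-algebras\<close>

text \<open>The value 0 outside the carrier makes the distance non-negative and symmetric everywhere, as
  the locale \<open>Metric_space\<close> demands.\<close>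

definition norm_dist :: "('k, 'a, 'm) module_scheme \<Rightarrow> ('a \<Rightarrow> real) \<Rightarrow> 'a \<Rightarrow> 'a \<Rightarrow> real" where
  "norm_dist M nrm x y =
     (if x \<in> carrier M \<and> y \<in> carrier M then nrm (x \<ominus>\<^bsub>M\<^esub> y) else 0)"

definition norm_topology :: "('k, 'a, 'm) module_scheme \<Rightarrow> ('a \<Rightarrow> real) \<Rightarrow> 'a topology" where
  "norm_topology M nrm = Metric_space.mtopology (carrier M) (norm_dist M nrm)"

locale banach_algebra = nonassoc_algebra M
  for M :: "('k::real_normed_field, 'a, 'm) module_scheme" (structure) and nrm :: "'a \<Rightarrow> real" +
  assumes norm_nonneg: "x \<in> carrier M \<Longrightarrow> 0 \<le> nrm x"
    and norm_eq_0: "x \<in> carrier M \<Longrightarrow> nrm x = 0 \<longleftrightarrow> x = \<zero>"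
    and norm_add: "\<lbrakk>x \<in> carrier M; y \<in> carrier M\<rbrakk> \<Longrightarrow> nrm (x \<oplus> y) \<le> nrm x + nrm y"
    and norm_smult: "x \<in> carrier M \<Longrightarrow> nrm (c \<odot> x) = norm c * nrm x"
    and norm_mult: "\<lbrakk>x \<in> carrier M; y \<in> carrier M\<rbrakk> \<Longrightarrow> nrm (x \<otimes> y) \<le> nrm x * nrm y"
    and complete: "Metric_space.mcomplete (carrier M) (norm_dist M nrm)"

locale jb_algebra = jordan_algebra M + banach_algebra M nrm
  for M :: "(real, 'a, 'm) module_scheme" (structure) and nrm :: "'a \<Rightarrow> real" +
  assumes norm_square: "x \<in> carrier M \<Longrightarrow> nrm (x \<otimes> x) = (nrm x)\<^sup>2"
    and norm_square_le: "\<lbrakk>x \<in> carrier M; y \<in> carrier M\<rbrakk>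
          \<Longrightarrow> nrm (x \<otimes> x) \<le> nrm ((x \<otimes> x) \<oplus> (y \<otimes> y))"

locale cstar_algebra = star_algebra M + banach_algebra M nrm
  for M :: "('a, 'm) star_alg_scheme" (structure) and nrm :: "'a \<Rightarrow> real" +
  assumes cstar_identity: "x \<in> carrier M \<Longrightarrow> nrm (star M x \<otimes> x) = (nrm x)\<^sup>2"


section \<open>Projective limits\<close>

definition directed_set :: "'i set \<Rightarrow> 'i rel \<Rightarrow> bool" where
  "directed_set \<Lambda> r \<longleftrightarrow> \<Lambda> \<noteq> {} \<and> preorder_on \<Lambda> r \<and>
     (\<forall>\<alpha>\<in>\<Lambda>. \<forall>\<beta>\<in>\<Lambda>. \<exists>\<gamma>\<in>\<Lambda>. (\<alpha>, \<gamma>) \<in> r \<and> (\<beta>, \<gamma>) \<in> r)"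

text \<open>The argument \<open>Hom\<close> selects the kind of connecting maps: \<open>alg_hom\<close> or \<open>star_hom\<close>.\<close>

definition projective_family ::
  "(('k, 'b, 'm) module_scheme \<Rightarrow> ('k, 'b, 'm) module_scheme \<Rightarrow> ('b \<Rightarrow> 'b) set) \<Rightarrow>
   'i set \<Rightarrow> 'i rel \<Rightarrow> ('i \<Rightarrow> ('k, 'b, 'm) module_scheme) \<Rightarrow> ('i \<Rightarrow> 'i \<Rightarrow> 'b \<Rightarrow> 'b) \<Rightarrow> bool" where
  "projective_family Hom \<Lambda> r B f \<longleftrightarrow> directed_set \<Lambda> r \<and>
     (\<forall>\<alpha> \<beta>. (\<alpha>, \<beta>) \<in> r \<longrightarrow> f \<alpha> \<beta> \<in> Hom (B \<beta>) (B \<alpha>)) \<and>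
     (\<forall>\<alpha>\<in>\<Lambda>. \<forall>x\<in>carrier (B \<alpha>). f \<alpha> \<alpha> x = x) \<and>
     (\<forall>\<alpha> \<beta> \<gamma>. (\<alpha>, \<beta>) \<in> r \<longrightarrow> (\<beta>, \<gamma>) \<in> r \<longrightarrow>
        (\<forall>x\<in>carrier (B \<gamma>). f \<alpha> \<beta> (f \<beta> \<gamma> x) = f \<alpha> \<gamma> x))"

definition proj_lim ::
  "'i set \<Rightarrow> 'i rel \<Rightarrow> ('i \<Rightarrow> ('k, 'b, 'm) module_scheme) \<Rightarrow> ('i \<Rightarrow> 'i \<Rightarrow> 'b \<Rightarrow> 'b) \<Rightarrow>
   ('k, 'i \<Rightarrow> 'b) module" where
  "proj_lim \<Lambda> r B f = \<lparr>carrier = {x \<in> \<Pi>\<^sub>E \<alpha>\<in>\<Lambda>. carrier (B \<alpha>). \<forall>\<alpha> \<beta>. (\<alpha>, \<beta>) \<in> r \<longrightarrow> f \<alpha> \<beta> (x \<beta>) = x \<alpha>},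
     mult = (\<lambda>x y. \<lambda>\<alpha>\<in>\<Lambda>. x \<alpha> \<otimes>\<^bsub>B \<alpha>\<^esub> y \<alpha>),
     one = (\<lambda>\<alpha>\<in>\<Lambda>. \<one>\<^bsub>B \<alpha>\<^esub>),
     zero = (\<lambda>\<alpha>\<in>\<Lambda>. \<zero>\<^bsub>B \<alpha>\<^esub>),
     add = (\<lambda>x y. \<lambda>\<alpha>\<in>\<Lambda>. x \<alpha> \<oplus>\<^bsub>B \<alpha>\<^esub> y \<alpha>),
     smult = (\<lambda>c x. \<lambda>\<alpha>\<in>\<Lambda>. c \<odot>\<^bsub>B \<alpha>\<^esub> x \<alpha>)\<rparr>"

definition star_proj_lim ::
  "'i set \<Rightarrow> 'i rel \<Rightarrow> ('i \<Rightarrow> 'b star_alg) \<Rightarrow> ('i \<Rightarrow> 'i \<Rightarrow> 'b \<Rightarrow> 'b) \<Rightarrow> ('i \<Rightarrow> 'b) star_alg" where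
  "star_proj_lim \<Lambda> r B f =
     module.extend (proj_lim \<Lambda> r B f) (star_alg.fields (\<lambda>x. \<lambda>\<alpha>\<in>\<Lambda>. star (B \<alpha>) (x \<alpha>)))"

definition proj_lim_topology ::
  "'i set \<Rightarrow> 'i rel \<Rightarrow> ('i \<Rightarrow> ('k, 'b, 'm) module_scheme) \<Rightarrow> ('i \<Rightarrow> 'b \<Rightarrow> real) \<Rightarrow>
   ('i \<Rightarrow> 'i \<Rightarrow> 'b \<Rightarrow> 'b) \<Rightarrow> ('i \<Rightarrow> 'b) topology" where
  "proj_lim_topology \<Lambda> r B nrm f =
     subtopology (product_topology (\<lambda>\<alpha>. norm_topology (B \<alpha>) (nrm \<alpha>)) \<Lambda>) (carrier (proj_lim \<Lambda> r B f))"


section \<open>LJB-algebras and LC*-algebras\<close>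

definition topological_algebra ::
  "('k::real_normed_field, 'a, 'm) module_scheme \<Rightarrow> 'a topology \<Rightarrow> bool" where
  "topological_algebra M T \<longleftrightarrow> topspace T = carrier M \<and>
     continuous_map (prod_topology T T) T (\<lambda>(x, y). x \<oplus>\<^bsub>M\<^esub> y) \<and>
     continuous_map (prod_topology euclidean T) T (\<lambda>(c, x). c \<odot>\<^bsub>M\<^esub> x) \<and>
     continuous_map (prod_topology T T) T (\<lambda>(x, y). x \<otimes>\<^bsub>M\<^esub> y)"

text \<open>
  HOL cannot quantify over types inside a formula, so the types of the indices and of the elements
  of the projective family are passed as a type argument. In a hypothesis these are to be type
  variables, so that every projective family is covered; in a conclusion they are concrete.
\<close>

definition ljb_algebra :: "('i \<times> 'b) itself \<Rightarrow> (real, 'a) module \<Rightarrow> 'a topology \<Rightarrow> bool" where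
  "ljb_algebra _ A T \<longleftrightarrow> jordan_algebra A \<and> topological_algebra A T \<and>
     (\<exists>(\<Lambda> :: 'i set) r (B :: 'i \<Rightarrow> (real, 'b) module) nrm f h.
        (\<forall>\<alpha>\<in>\<Lambda>. jb_algebra (B \<alpha>) (nrm \<alpha>)) \<and> projective_family alg_hom \<Lambda> r B f \<and>
        h \<in> alg_hom A (proj_lim \<Lambda> r B f) \<and>
        homeomorphic_map T (proj_lim_topology \<Lambda> r B nrm f) h)"

definition lc_star_algebra :: "('i \<times> 'b) itself \<Rightarrow> 'a star_alg \<Rightarrow> 'a topology \<Rightarrow> bool" where
  "lc_star_algebra _ M T \<longleftrightarrow> star_algebra M \<and> topological_algebra M T \<and>
     continuous_map T T (star M) \<and>
     (\<exists>(\<Lambda> :: 'i set) r (B :: 'i \<Rightarrow> 'b star_alg) nrm f h.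
        (\<forall>\<alpha>\<in>\<Lambda>. cstar_algebra (B \<alpha>) (nrm \<alpha>)) \<and> projective_family star_hom \<Lambda> r B f \<and>
        h \<in> star_hom M (star_proj_lim \<Lambda> r B f) \<and>
        homeomorphic_map T (proj_lim_topology \<Lambda> r B nrm f) h)"


section \<open>Universal enveloping algebras\<close>

text \<open>
  Homomorphisms between topological algebras are continuous. Without continuity an envelope would
  not be unique up to a topological isomorphism: for the continuous functions on the ordinal
  \<open>\<omega>\<^sub>1\<close>, both the topology of uniform convergence on compact sets and the sup norm topology on the
  complexification would give one.
\<close>

definition cont_jordan_hom ::
  "(real, 'a) module \<Rightarrow> 'a topology \<Rightarrow> (real, 'b) module \<Rightarrow> 'b topology \<Rightarrow> ('a \<Rightarrow> 'b) set" where
  "cont_jordan_hom A T B S = {h \<in> alg_hom A B. continuous_map T S h}"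

definition cont_star_hom ::
  "'a star_alg \<Rightarrow> 'a topology \<Rightarrow> 'b star_alg \<Rightarrow> 'b topology \<Rightarrow> ('a \<Rightarrow> 'b) set" where
  "cont_star_hom M T N S = {h \<in> star_hom M N. continuous_map T S h}"

definition topological_star_iso ::
  "'a star_alg \<Rightarrow> 'a topology \<Rightarrow> 'b star_alg \<Rightarrow> 'b topology \<Rightarrow> ('a \<Rightarrow> 'b) set" where
  "topological_star_iso M T N S =
     {h \<in> star_hom M N. bij_betw h (carrier M) (carrier N) \<and> homeomorphic_map T S h}"

definition sa_topology :: "'a star_alg \<Rightarrow> 'a topology \<Rightarrow> 'a topology" where
  "sa_topology M T = subtopology T (carrier (sa_part M))"

definition star_subalgebra :: "'a star_alg \<Rightarrow> 'a set \<Rightarrow> bool" where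
  "star_subalgebra M S \<longleftrightarrow> S \<subseteq> carrier M \<and> \<zero>\<^bsub>M\<^esub> \<in> S \<and>
     (\<forall>x\<in>S. \<forall>y\<in>S. x \<oplus>\<^bsub>M\<^esub> y \<in> S \<and> x \<otimes>\<^bsub>M\<^esub> y \<in> S) \<and>
     (\<forall>c. \<forall>x\<in>S. c \<odot>\<^bsub>M\<^esub> x \<in> S) \<and> (\<forall>x\<in>S. star M x \<in> S)"

definition generates_lc_star :: "'a star_alg \<Rightarrow> 'a topology \<Rightarrow> 'a set \<Rightarrow> bool" where
  "generates_lc_star M T X \<longleftrightarrow> (\<lambda>S. star_subalgebra M S \<and> closedin T S) hull X = carrier M"

definition star_antiautomorphism :: "'a star_alg \<Rightarrow> ('a \<Rightarrow> 'a) \<Rightarrow> bool" where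
  "star_antiautomorphism M \<Phi> \<longleftrightarrow> bij_betw \<Phi> (carrier M) (carrier M) \<and>
     (\<forall>x\<in>carrier M. \<forall>y\<in>carrier M. \<Phi> (x \<oplus>\<^bsub>M\<^esub> y) = \<Phi> x \<oplus>\<^bsub>M\<^esub> \<Phi> y) \<and>
     (\<forall>c. \<forall>x\<in>carrier M. \<Phi> (c \<odot>\<^bsub>M\<^esub> x) = c \<odot>\<^bsub>M\<^esub> \<Phi> x) \<and>
     (\<forall>x\<in>carrier M. \<forall>y\<in>carrier M. \<Phi> (x \<otimes>\<^bsub>M\<^esub> y) = \<Phi> y \<otimes>\<^bsub>M\<^esub> \<Phi> x) \<and>
     (\<forall>x\<in>carrier M. \<Phi> (star M x) = star M (\<Phi> x))"

text \<open>
  The universal property with respect to all LC*-algebras with elements in \<open>'c\<close> that are limits of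
  families with indices in \<open>'i\<close> and elements in \<open>'b\<close>.
\<close>

definition universal_property ::
  "(('i \<times> 'b) \<times> 'c) itself \<Rightarrow> (real, 'a) module \<Rightarrow> 'a topology \<Rightarrow>
   'u star_alg \<Rightarrow> 'u topology \<Rightarrow> ('a \<Rightarrow> 'u) \<Rightarrow> bool" where
  "universal_property _ A T U TU \<psi> \<longleftrightarrow>
     (\<forall>(C :: 'c star_alg) TC \<phi>.
        lc_star_algebra TYPE('i \<times> 'b) C TC \<longrightarrow>
        \<phi> \<in> cont_jordan_hom A T (sa_part C) (sa_topology C TC) \<longrightarrow>
        (\<exists>\<phi>' \<in> cont_star_hom U TU C TC. \<forall>a\<in>carrier A. \<phi> a = \<phi>' (\<psi> a)))"

definition has_order2_antiautomorphism ::
  "(real, 'a) module \<Rightarrow> 'u star_alg \<Rightarrow> 'u topology \<Rightarrow> ('a \<Rightarrow> 'u) \<Rightarrow> bool" where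
  "has_order2_antiautomorphism A U TU \<psi> \<longleftrightarrow>
     (\<exists>\<Phi>. star_antiautomorphism U \<Phi> \<and> continuous_map TU TU \<Phi> \<and>
        (\<forall>x\<in>carrier U. \<Phi> (\<Phi> x) = x) \<and> (\<forall>a\<in>carrier A. \<Phi> (\<psi> a) = \<psi> a))"

definition enveloping ::
  "(('i \<times> 'b) \<times> 'c) itself \<Rightarrow> (real, 'a) module \<Rightarrow> 'a topology \<Rightarrow>
   'u star_alg \<Rightarrow> 'u topology \<Rightarrow> ('a \<Rightarrow> 'u) \<Rightarrow> bool" where
  "enveloping targets A T U TU \<psi> \<longleftrightarrow>
     \<psi> \<in> cont_jordan_hom A T (sa_part U) (sa_topology U TU) \<and>
     generates_lc_star U TU (\<psi> ` carrier A) \<and>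
     universal_property targets A T U TU \<psi> \<and>
     has_order2_antiautomorphism A U TU \<psi>"

text \<open>
  Concrete types that are large enough for the envelope of an algebra with elements in \<open>'a\<close>.
  Every element of the *-subalgebra generated by \<open>\<psi>\<close> is the value of a formal polynomial, a list of
  monomials \<open>(c, [a\<^sub>1, \<dots>, a\<^sub>k])\<close> standing for \<open>c \<psi>(a\<^sub>1) \<cdots> \<psi>(a\<^sub>k)\<close>. Hence a C*-algebra generated by \<open>\<psi>\<close>
  has no more elements than there are sequences of formal polynomials, it is determined by its
  seminorm on the formal polynomials, and the envelope is the limit over such seminorms.

  An envelope \<open>U\<close> on the type \<open>'a env\<close> whose existence is claimed for each type variable \<open>'c\<close> of target
  elements could depend on \<open>'c\<close>. It does not, up to a topological *-isomorphism, once \<open>U\<close> is also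
  required to be universal for the targets on the type \<open>'a env\<close> itself.
\<close>

type_synonym 'a formal = "(complex \<times> 'a list) list"
type_synonym 'a env_index = "'a formal \<Rightarrow> real"
type_synonym 'a env_factor = "nat \<Rightarrow> 'a formal"
type_synonym 'a env = "'a env_index \<Rightarrow> 'a env_factor"

end

theory Submission
  imports Defs
begin

text \<open>
  A C*-algebra generated by the image of a Jordan homomorphism is determined by the seminorm that its
  norm induces on the formal polynomials in the elements of \<open>A\<close>, and its elements are limits of
  sequences of formal polynomials. The seminorms that arise from continuous Jordan homomorphisms form
  a set directed by the pointwise order, because the maximum of two of them belongs to the
  diagonally generated subalgebra of the product. The envelope is the limit of the corresponding
  C*-algebras.

  A Jordan homomorphism into an LC*-algebra is a compatible family of Jordan homomorphisms into
  C*-algebras, each of which extends from the formal polynomials by isometry; compatibility survives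
  the extension because *-homomorphisms of C*-algebras are contractive. The antiautomorphism is
  the homomorphism from the envelope to its opposite algebra given by the universal property.
\<close>

text \<open>Size is the first obstacle: the C*-algebras that \<open>A\<close> maps into live on
  arbitrary types and form no set. A seminorm on formal polynomials is a function on a fixed type,
  and \<open>in_env_seminormsI\<close> exchanges any algebra for the subalgebra that the image
  generates, rebuilt on \<open>'a env_factor\<close>. From there on the type of the target has no
  influence, so one envelope serves all targets.

  Directedness is what lets the image generate the limit: a basic neighbourhood restricts finitely
  many coordinates, and one larger seminorm controls all of them.

  Contractivity has to be proved without a unit. Resolvents are replaced by quasi-inverses (1 -
  a)^-1 - 1, found as fixed points and preserved by homomorphisms. If a self-adjoint element had an
  image of larger norm, a rescaled image would have norm 1 and quasi-inverses for every scalar in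
  the closed unit disc; \<open>selfadjoint_resolvent\<close> rules this out.

  Uniqueness rests on generation alone: two continuous homomorphisms into a Hausdorff algebra agree
  on a closed *-subalgebra.\<close>

section \<open>Arithmetic in algebras with explicit carriers\<close>

lemma carrier_scalars [simp]: "carrier scalars = UNIV"
  and mult_scalars [simp]: "a \<otimes>\<^bsub>scalars\<^esub> b = a * b"
  and one_scalars [simp]: "\<one>\<^bsub>scalars\<^esub> = 1"
  and zero_scalars [simp]: "\<zero>\<^bsub>scalars\<^esub> = 0"
  and add_scalars [simp]: "a \<oplus>\<^bsub>scalars\<^esub> b = a + b"
  by (simp_all add: scalars_def)

lemma cring_scalars: "cring (scalars :: 'k::field ring)"
proof (rule cringI)
  show "abelian_group (scalars :: 'k ring)"
  proof (rule abelian_groupI)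
    show "\<exists>y\<in>carrier scalars. y \<oplus>\<^bsub>scalars\<^esub> x = \<zero>\<^bsub>scalars\<^esub>" for x :: 'k
      by (rule bexI[of _ "- x"]) simp_all
  qed (simp_all add: algebra_simps)
  show "comm_monoid (scalars :: 'k ring)"
    by (rule comm_monoidI) (auto simp: algebra_simps)
qed (auto simp: algebra_simps)

context nonassoc_algebra
begin

lemma smult_in [simp, intro]: "x \<in> carrier M \<Longrightarrow> c \<odot> x \<in> carrier M"
  by simp

lemma mult_in [simp, intro]: "\<lbrakk>x \<in> carrier M; y \<in> carrier M\<rbrakk> \<Longrightarrow> x \<otimes> y \<in> carrier M"
  by (rule mult_closed)

lemma smult_plus: "x \<in> carrier M \<Longrightarrow> (a + b) \<odot> x = a \<odot> x \<oplus> b \<odot> x"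
  using smult_l_distr[of a b x] by simp

lemma smult_add: "\<lbrakk>x \<in> carrier M; y \<in> carrier M\<rbrakk> \<Longrightarrow> a \<odot> (x \<oplus> y) = a \<odot> x \<oplus> a \<odot> y"
  using smult_r_distr[of a x y] by simp

lemma smult_smult: "x \<in> carrier M \<Longrightarrow> a \<odot> (b \<odot> x) = (a * b) \<odot> x"
  using smult_assoc1[of a b x] by simp

lemma smult_1 [simp]: "x \<in> carrier M \<Longrightarrow> 1 \<odot> x = x"
  using smult_one by simp

lemma smult_0 [simp]: "x \<in> carrier M \<Longrightarrow> 0 \<odot> x = \<zero>"
  using smult_l_null by simp

lemma smult_zero [simp]: "a \<odot> \<zero> = \<zero>"
  using smult_r_null by simp

lemma minus_smult: "x \<in> carrier M \<Longrightarrow> \<ominus> x = (- 1) \<odot> x"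
proof -
  assume x: "x \<in> carrier M"
  have "(- 1) \<odot> x \<oplus> x = ((- 1) + 1) \<odot> x"
    using x by (simp only: smult_plus smult_1)
  also have "\<dots> = \<zero>"
    using x by simp
  finally show ?thesis
    using x by (intro M.minus_equality) auto
qed

lemma mult_zero_left [simp]: "x \<in> carrier M \<Longrightarrow> \<zero> \<otimes> x = \<zero>"
  using mult_smult_left[of \<zero> x 0] by simp

lemma mult_zero_right [simp]: "x \<in> carrier M \<Longrightarrow> x \<otimes> \<zero> = \<zero>"
  using mult_smult_right[of x \<zero> 0] by simp

lemma diff_smult: "\<lbrakk>x \<in> carrier M; y \<in> carrier M\<rbrakk> \<Longrightarrow> x \<ominus> y = x \<oplus> (- 1) \<odot> y"
  by (simp add: M.minus_eq minus_smult)

lemma diff_in [simp, intro]: "\<lbrakk>x \<in> carrier M; y \<in> carrier M\<rbrakk> \<Longrightarrow> x \<ominus> y \<in> carrier M"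
  by (rule M.minus_closed)

lemma smult_diff:
  "\<lbrakk>x \<in> carrier M; y \<in> carrier M\<rbrakk> \<Longrightarrow> c \<odot> (x \<ominus> y) = c \<odot> x \<ominus> c \<odot> y"
  by (simp add: diff_smult smult_add smult_smult)

lemma mult_diff_left:
  "\<lbrakk>x \<in> carrier M; y \<in> carrier M; z \<in> carrier M\<rbrakk> \<Longrightarrow> (x \<ominus> y) \<otimes> z = x \<otimes> z \<ominus> y \<otimes> z"
  by (simp add: diff_smult mult_add_left mult_smult_left)

lemma mult_diff_right:
  "\<lbrakk>x \<in> carrier M; y \<in> carrier M; z \<in> carrier M\<rbrakk> \<Longrightarrow> z \<otimes> (x \<ominus> y) = z \<otimes> x \<ominus> z \<otimes> y"
  by (simp add: diff_smult mult_add_right mult_smult_right)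

lemma diff_self [simp]: "x \<in> carrier M \<Longrightarrow> x \<ominus> x = \<zero>"
  by (simp add: M.minus_eq M.r_neg)

lemma diff_zero [simp]: "x \<in> carrier M \<Longrightarrow> x \<ominus> \<zero> = x"
  by (simp add: diff_smult)

lemma diff_eq_zero_iff:
  "\<lbrakk>x \<in> carrier M; y \<in> carrier M\<rbrakk> \<Longrightarrow> x \<ominus> y = \<zero> \<longleftrightarrow> x = y"
  by (metis M.minus_eq M.r_neg M.add.inv_closed M.minus_equality M.minus_minus)

lemma diff_add_diff:
  "\<lbrakk>x \<in> carrier M; y \<in> carrier M; u \<in> carrier M; v \<in> carrier M\<rbrakk>
    \<Longrightarrow> (x \<oplus> y) \<ominus> (u \<oplus> v) = (x \<ominus> u) \<oplus> (y \<ominus> v)"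
  by (simp add: M.minus_eq M.minus_add M.a_ac)

lemma diff_chain:
  "\<lbrakk>x \<in> carrier M; y \<in> carrier M; z \<in> carrier M\<rbrakk> \<Longrightarrow> (x \<ominus> y) \<oplus> (y \<ominus> z) = x \<ominus> z"
  by (simp add: M.minus_eq M.a_ac M.r_neg1 M.r_neg2 M.r_neg M.l_neg)

lemma diff_add_cancel [simp]:
  "\<lbrakk>x \<in> carrier M; y \<in> carrier M\<rbrakk> \<Longrightarrow> (x \<ominus> y) \<oplus> y = x"
  by (simp add: M.minus_eq M.a_ac M.r_neg1 M.r_neg2 M.r_neg M.l_neg)

end

section \<open>Norm estimates, the norm topology and completeness\<close>

context banach_algebra
begin

lemma norm_zero [simp]: "nrm \<zero> = 0"
  using norm_eq_0 by simp

lemma norm_neg [simp]: "x \<in> carrier M \<Longrightarrow> nrm (\<ominus> x) = nrm x"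
  by (simp add: minus_smult norm_smult)

lemma norm_diff_commute:
  "\<lbrakk>x \<in> carrier M; y \<in> carrier M\<rbrakk> \<Longrightarrow> nrm (x \<ominus> y) = nrm (y \<ominus> x)"
proof -
  assume xy: "x \<in> carrier M" "y \<in> carrier M"
  have "y \<ominus> x = \<ominus> (x \<ominus> y)"
    using xy by (simp add: M.minus_eq M.minus_add M.a_ac)
  then show ?thesis
    using xy by simp
qed

lemma norm_diff_triangle:
  "\<lbrakk>x \<in> carrier M; y \<in> carrier M; z \<in> carrier M\<rbrakk> \<Longrightarrow> nrm (x \<ominus> z) \<le> nrm (x \<ominus> y) + nrm (y \<ominus> z)"
  using norm_add[of "x \<ominus> y" "y \<ominus> z"] by (simp add: diff_chain)

lemma norm_diff_le: "\<lbrakk>x \<in> carrier M; y \<in> carrier M\<rbrakk> \<Longrightarrow> nrm (x \<ominus> y) \<le> nrm x + nrm y"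
  using norm_add[of x "\<ominus> y"] by (simp add: M.minus_eq)

lemma norm_le_diff: "\<lbrakk>x \<in> carrier M; y \<in> carrier M\<rbrakk> \<Longrightarrow> nrm x \<le> nrm (x \<ominus> y) + nrm y"
  using norm_add[of "x \<ominus> y" y] by simp

lemma norm_diff_eq_0: "\<lbrakk>x \<in> carrier M; y \<in> carrier M\<rbrakk> \<Longrightarrow> nrm (x \<ominus> y) = 0 \<longleftrightarrow> x = y"
  by (simp add: norm_eq_0 diff_eq_zero_iff)

lemma norm_diff_add:
  "\<lbrakk>x \<in> carrier M; y \<in> carrier M; u \<in> carrier M; v \<in> carrier M\<rbrakk>
    \<Longrightarrow> nrm ((x \<oplus> y) \<ominus> (u \<oplus> v)) \<le> nrm (x \<ominus> u) + nrm (y \<ominus> v)"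
  by (simp add: diff_add_diff norm_add)

text \<open>Telescoping through the mixed term \<open>c \<odot> y\<close>;
  \<open>norm_diff_mult\<close> does the same through \<open>u \<otimes> y\<close>. These two bounds
  carry all the later proofs of joint continuity.\<close>

lemma norm_diff_smult:
  assumes "x \<in> carrier M" "y \<in> carrier M"
  shows "nrm (c \<odot> x \<ominus> d \<odot> y) \<le> norm c * nrm (x \<ominus> y) + norm (c - d) * nrm y"
proof -
  have "c \<odot> x \<ominus> d \<odot> y = c \<odot> (x \<ominus> y) \<oplus> (c - d) \<odot> y"
    using assms
    by (simp add: diff_smult smult_add smult_smult M.a_assoc flip: smult_plus)
  then show ?thesis
    using assms norm_add[of "c \<odot> (x \<ominus> y)" "(c - d) \<odot> y"] by (simp add: norm_smult)
qed

lemma norm_diff_mult: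
  assumes "x \<in> carrier M" "y \<in> carrier M" "u \<in> carrier M" "v \<in> carrier M"
  shows "nrm (x \<otimes> y \<ominus> u \<otimes> v) \<le> nrm (x \<ominus> u) * nrm y + nrm u * nrm (y \<ominus> v)"
proof -
  have "x \<otimes> y \<ominus> u \<otimes> v = (x \<ominus> u) \<otimes> y \<oplus> u \<otimes> (y \<ominus> v)"
    using assms by (simp add: mult_diff_left mult_diff_right diff_chain)
  then show ?thesis
    using assms norm_add[of "(x \<ominus> u) \<otimes> y" "u \<otimes> (y \<ominus> v)"] norm_mult[of "x \<ominus> u" y] norm_mult[of u "y \<ominus> v"]
    by simp
qed

sublocale Met: Metric_space "carrier M" "norm_dist M nrm"
proof
  show "0 \<le> norm_dist M nrm x y" for x y
    by (simp add: norm_dist_def norm_nonneg)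
  show "norm_dist M nrm x y = norm_dist M nrm y x" for x y
    by (auto simp: norm_dist_def intro: norm_diff_commute)
  show "norm_dist M nrm x y = 0 \<longleftrightarrow> x = y" if "x \<in> carrier M" "y \<in> carrier M" for x y
    using that by (simp add: norm_dist_def norm_diff_eq_0)
  show "norm_dist M nrm x z \<le> norm_dist M nrm x y + norm_dist M nrm y z"
    if "x \<in> carrier M" "y \<in> carrier M" "z \<in> carrier M" for x y z
    using that by (simp add: norm_dist_def norm_diff_triangle)
qed

lemma norm_topology_eq: "norm_topology M nrm = Met.mtopology"
  by (simp add: norm_topology_def)

lemma topspace_norm_topology [simp]: "topspace (norm_topology M nrm) = carrier M"
  by (simp add: norm_topology_eq)

lemma Hausdorff_norm_topology: "Hausdorff_space (norm_topology M nrm)"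
  by (simp add: norm_topology_eq Met.Hausdorff_space_mtopology)

text \<open>Only norms of differences occur here, so for a map given by generators the condition can
  be read off a seminorm on formal polynomials. The last clause of \<open>jordan_seminorm\<close>
  has this shape.\<close>

lemma continuous_map_norm_topology:
  "continuous_map X (norm_topology M nrm) f \<longleftrightarrow>
    f ` topspace X \<subseteq> carrier M \<and>
    (\<forall>x\<in>topspace X. \<forall>e>0. \<exists>V. openin X V \<and> x \<in> V \<and> (\<forall>y\<in>V. nrm (f y \<ominus> f x) < e))"
  (is "?L \<longleftrightarrow> ?R")
proof
  assume L: ?L
  then have im: "f ` topspace X \<subseteq> carrier M"
    using continuous_map_image_subset_topspace by fastforce
  have "\<exists>V. openin X V \<and> x \<in> V \<and> (\<forall>y\<in>V. nrm (f y \<ominus> f x) < e)"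
    if x: "x \<in> topspace X" and e: "e > 0" for x e
  proof -
    obtain V where V: "openin X V" "x \<in> V" "\<forall>y\<in>V. f y \<in> Met.mball (f x) e"
      using L x e unfolding norm_topology_eq Met.continuous_map_to_metric by blast
    have "nrm (f y \<ominus> f x) < e" if "y \<in> V" for y
      using V(3) that by (auto simp: Met.in_mball norm_dist_def norm_diff_commute)
    with V show ?thesis by blast
  qed
  with im show ?R by blast
next
  assume R: ?R
  have "\<exists>V. openin X V \<and> x \<in> V \<and> (\<forall>y\<in>V. f y \<in> Met.mball (f x) e)"
    if x: "x \<in> topspace X" and e: "e > 0" for x e
  proof -
    obtain V where V: "openin X V" "x \<in> V" "\<forall>y\<in>V. nrm (f y \<ominus> f x) < e"
      using R x e by blast
    have "f y \<in> Met.mball (f x) e" if "y \<in> V" for y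
    proof -
      have "f y \<in> carrier M" "f x \<in> carrier M"
        using R x openin_subset[OF V(1)] that by auto
      then show ?thesis
        using V(3) that by (auto simp: Met.in_mball norm_dist_def norm_diff_commute)
    qed
    with V show ?thesis by blast
  qed
  then show ?L
    unfolding norm_topology_eq Met.continuous_map_to_metric by blast
qed

lemma openin_norm_ball: "openin (norm_topology M nrm) {y \<in> carrier M. nrm (y \<ominus> x) < e}"
  if "x \<in> carrier M"
proof -
  have "{y \<in> carrier M. nrm (y \<ominus> x) < e} = Met.mball x e"
    using that by (auto simp: Met.mball_def norm_dist_def norm_diff_commute)
  then show ?thesis
    by (simp add: norm_topology_eq)
qed

lemma openin_norm_topologyD:
  assumes "openin (norm_topology M nrm) V" "x \<in> V"
  shows "\<exists>e>0. \<forall>y\<in>carrier M. nrm (y \<ominus> x) < e \<longrightarrow> y \<in> V"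
proof -
  obtain r where r: "r > 0" "Met.mball x r \<subseteq> V" and V: "V \<subseteq> carrier M"
    using assms by (auto simp: norm_topology_eq Met.openin_mtopology)
  have "y \<in> V" if y: "y \<in> carrier M" "nrm (y \<ominus> x) < r" for y
  proof -
    have x: "x \<in> carrier M"
      using V assms(2) by blast
    then have "y \<in> Met.mball x r"
      using y norm_diff_commute[OF x y(1)] by (simp add: norm_dist_def)
    then show ?thesis
      using r(2) by blast
  qed
  with r(1) show ?thesis by blast
qed

lemma Cauchy_converges:
  assumes s: "\<And>n. s n \<in> carrier M"
    and C: "\<And>e. e > 0 \<Longrightarrow> \<exists>k. \<forall>m\<ge>k. \<forall>n\<ge>k. nrm (s m \<ominus> s n) < e"
  shows "\<exists>x\<in>carrier M. (\<lambda>n. nrm (x \<ominus> s n)) \<longlonglongrightarrow> 0"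
proof -
  have "Met.MCauchy s"
    unfolding Met.MCauchy_def norm_dist_def
  proof (intro conjI allI impI)
    fix e :: real assume "e > 0"
    then obtain k where "\<forall>m\<ge>k. \<forall>n\<ge>k. nrm (s m \<ominus> s n) < e"
      using C by blast
    then show "\<exists>N. \<forall>n n'. N \<le> n \<longrightarrow> N \<le> n' \<longrightarrow>
        (if s n \<in> carrier M \<and> s n' \<in> carrier M then nrm (s n \<ominus> s n') else 0) < e"
      using s by (intro exI[of _ k]) simp
  qed (use s in blast)
  then obtain x where x: "limitin Met.mtopology s x sequentially"
    using complete unfolding Met.mcomplete_def by blast
  then have xc: "x \<in> carrier M"
    by (simp add: Met.limit_metric_sequentially)
  have "(\<lambda>n. nrm (x \<ominus> s n)) \<longlonglongrightarrow> 0"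
  proof (rule LIMSEQ_I)
    fix e :: real assume "e > 0"
    then obtain k where "\<forall>n\<ge>k. norm_dist M nrm (s n) x < e"
      using x unfolding Met.limit_metric_sequentially by blast
    then show "\<exists>k. \<forall>n\<ge>k. norm (nrm (x \<ominus> s n) - 0) < e"
      using s xc by (intro exI[of _ k]) (auto simp: norm_dist_def norm_nonneg norm_diff_commute)
  qed
  with xc show ?thesis by blast
qed

lemma Cauchy_dist:
  assumes "\<And>n. s n \<in> carrier M" "x \<in> carrier M" "(\<lambda>n. nrm (x \<ominus> s n)) \<longlonglongrightarrow> 0" "e > 0"
  shows "\<exists>k. \<forall>m\<ge>k. \<forall>n\<ge>k. nrm (s m \<ominus> s n) < e"
proof -
  obtain k where k: "\<forall>n\<ge>k. nrm (x \<ominus> s n) < e / 2"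
    using LIMSEQ_D[OF assms(3), of "e/2"] assms by (auto simp: norm_nonneg)
  have "nrm (s m \<ominus> s n) < e" if "m \<ge> k" "n \<ge> k" for m n
    using norm_diff_triangle[of "s m" x "s n"] norm_diff_commute[of "s m" x] assms(1,2) k that
    by (smt (verit) field_sum_of_halves)
  then show ?thesis by blast
qed

end

text \<open>States completeness with real limits of norms instead of \<open>mcomplete\<close> for
  \<open>norm_dist\<close>, which is the form in which it is checked for a constructed
  algebra.\<close>

lemma banach_algebraI:
  fixes M :: "('k::real_normed_field, 'a, 'm) module_scheme" (structure)
  assumes alg: "nonassoc_algebra M"
    and norm_nonneg: "\<And>x. x \<in> carrier M \<Longrightarrow> 0 \<le> nrm x"
    and norm_eq_0: "\<And>x. x \<in> carrier M \<Longrightarrow> nrm x = 0 \<longleftrightarrow> x = \<zero>"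
    and norm_add: "\<And>x y. \<lbrakk>x \<in> carrier M; y \<in> carrier M\<rbrakk> \<Longrightarrow> nrm (x \<oplus> y) \<le> nrm x + nrm y"
    and norm_smult: "\<And>c x. x \<in> carrier M \<Longrightarrow> nrm (c \<odot> x) = norm c * nrm x"
    and norm_mult: "\<And>x y. \<lbrakk>x \<in> carrier M; y \<in> carrier M\<rbrakk> \<Longrightarrow> nrm (x \<otimes> y) \<le> nrm x * nrm y"
    and complete: "\<And>s. \<lbrakk>\<And>n. s n \<in> carrier M; \<And>e. e > 0 \<Longrightarrow> \<exists>k. \<forall>m\<ge>k. \<forall>n\<ge>k. nrm (s m \<ominus> s n) < e\<rbrakk>
        \<Longrightarrow> \<exists>x\<in>carrier M. (\<lambda>n. nrm (x \<ominus> s n)) \<longlonglongrightarrow> 0"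
  shows "banach_algebra M nrm"
proof -
  interpret nonassoc_algebra M by (rule alg)
  have neg: "nrm (\<ominus> x) = nrm x" if "x \<in> carrier M" for x
    using that by (simp add: minus_smult norm_smult)
  have comm: "nrm (x \<ominus> y) = nrm (y \<ominus> x)" if "x \<in> carrier M" "y \<in> carrier M" for x y
  proof -
    have "y \<ominus> x = \<ominus> (x \<ominus> y)"
      using that by (simp add: M.minus_eq M.minus_add M.a_ac)
    then show ?thesis
      using that by (simp add: neg)
  qed
  interpret Met: Metric_space "carrier M" "norm_dist M nrm"
  proof
    show "0 \<le> norm_dist M nrm x y" for x y
      by (simp add: norm_dist_def norm_nonneg)
    show "norm_dist M nrm x y = norm_dist M nrm y x" for x y
      by (auto simp: norm_dist_def intro: comm)
    show "norm_dist M nrm x y = 0 \<longleftrightarrow> x = y" if "x \<in> carrier M" "y \<in> carrier M" for x y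
      using that by (simp add: norm_dist_def norm_eq_0 diff_eq_zero_iff)
    show "norm_dist M nrm x z \<le> norm_dist M nrm x y + norm_dist M nrm y z"
      if "x \<in> carrier M" "y \<in> carrier M" "z \<in> carrier M" for x y z
      using that norm_add[of "x \<ominus> y" "y \<ominus> z"] by (simp add: norm_dist_def diff_chain)
  qed
  have "Met.mcomplete"
    unfolding Met.mcomplete_def
  proof (intro allI impI)
    fix s assume "Met.MCauchy s"
    then have s: "\<And>n. s n \<in> carrier M"
      and C: "\<And>e. e > 0 \<Longrightarrow> \<exists>k. \<forall>m\<ge>k. \<forall>n\<ge>k. nrm (s m \<ominus> s n) < e"
    proof -
      show s: "s n \<in> carrier M" for n
        using \<open>Met.MCauchy s\<close> unfolding Met.MCauchy_def by blast
      fix e :: real assume "e > 0"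
      then obtain k where "\<forall>n n'. k \<le> n \<longrightarrow> k \<le> n' \<longrightarrow> norm_dist M nrm (s n) (s n') < e"
        using \<open>Met.MCauchy s\<close> unfolding Met.MCauchy_def by blast
      then show "\<exists>k. \<forall>m\<ge>k. \<forall>n\<ge>k. nrm (s m \<ominus> s n) < e"
        using s by (intro exI[of _ k]) (simp add: norm_dist_def)
    qed
    obtain x where x: "x \<in> carrier M" "(\<lambda>n. nrm (x \<ominus> s n)) \<longlonglongrightarrow> 0"
      using complete[OF s C] by blast
    have "\<exists>k. \<forall>n\<ge>k. norm_dist M nrm (s n) x < e" if e: "e > 0" for e
    proof -
      obtain k where "\<forall>n\<ge>k. nrm (x \<ominus> s n) < e"
        using LIMSEQ_D[OF x(2) e] s x(1) by (auto simp: norm_nonneg)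
      then show ?thesis
        using s x(1) by (intro exI[of _ k]) (auto simp: norm_dist_def comm)
    qed
    then have "limitin Met.mtopology s x sequentially"
      using s x(1) by (auto simp: Met.limit_metric_sequentially)
    then show "\<exists>x. limitin Met.mtopology s x sequentially" ..
  qed
  then show ?thesis
    using assms by (intro banach_algebra.intro banach_algebra_axioms.intro alg) auto
qed

text \<open>Every axiom of a *-algebra is an identity, so it can be pulled back along
  operation-preserving maps that together separate points. The generated C*-algebra and the
  projective limit both get their axioms this way. An empty \<open>I\<close> is allowed and forces
  \<open>X\<close> to have one element.\<close>

lemma star_algebra_jointly_injective:
  fixes X :: "('x, 'm) star_alg_scheme" and D :: "'i \<Rightarrow> ('d, 'n) star_alg_scheme"
  assumes D: "\<And>i. i \<in> I \<Longrightarrow> star_algebra (D i)"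
    and j: "\<And>i x. \<lbrakk>i \<in> I; x \<in> carrier X\<rbrakk> \<Longrightarrow> j i x \<in> carrier (D i)"
    and inj: "\<And>x y. \<lbrakk>x \<in> carrier X; y \<in> carrier X; \<And>i. i \<in> I \<Longrightarrow> j i x = j i y\<rbrakk> \<Longrightarrow> x = y"
    and zero: "\<zero>\<^bsub>X\<^esub> \<in> carrier X"
    and add: "\<And>x y. \<lbrakk>x \<in> carrier X; y \<in> carrier X\<rbrakk> \<Longrightarrow> x \<oplus>\<^bsub>X\<^esub> y \<in> carrier X"
    and smult: "\<And>c x. x \<in> carrier X \<Longrightarrow> c \<odot>\<^bsub>X\<^esub> x \<in> carrier X"
    and mult: "\<And>x y. \<lbrakk>x \<in> carrier X; y \<in> carrier X\<rbrakk> \<Longrightarrow> x \<otimes>\<^bsub>X\<^esub> y \<in> carrier X"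
    and star: "\<And>x. x \<in> carrier X \<Longrightarrow> star X x \<in> carrier X"
    and j_zero: "\<And>i. i \<in> I \<Longrightarrow> j i \<zero>\<^bsub>X\<^esub> = \<zero>\<^bsub>D i\<^esub>"
    and j_add: "\<And>i x y. \<lbrakk>i \<in> I; x \<in> carrier X; y \<in> carrier X\<rbrakk> \<Longrightarrow> j i (x \<oplus>\<^bsub>X\<^esub> y) = j i x \<oplus>\<^bsub>D i\<^esub> j i y"
    and j_smult: "\<And>i c x. \<lbrakk>i \<in> I; x \<in> carrier X\<rbrakk> \<Longrightarrow> j i (c \<odot>\<^bsub>X\<^esub> x) = c \<odot>\<^bsub>D i\<^esub> j i x"
    and j_mult: "\<And>i x y. \<lbrakk>i \<in> I; x \<in> carrier X; y \<in> carrier X\<rbrakk> \<Longrightarrow> j i (x \<otimes>\<^bsub>X\<^esub> y) = j i x \<otimes>\<^bsub>D i\<^esub> j i y"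
    and j_star: "\<And>i x. \<lbrakk>i \<in> I; x \<in> carrier X\<rbrakk> \<Longrightarrow> j i (star X x) = star (D i) (j i x)"
  shows "star_algebra X"
proof -
  note closed = zero add smult mult star j
  note hom = j_zero j_add j_smult j_mult j_star
  have na: "nonassoc_algebra (D i)" if "i \<in> I" for i
    using D[OF that] by (simp add: star_algebra_def)
  have md: "Module.module scalars (D i)" if "i \<in> I" for i
    using na[OF that] by (simp add: nonassoc_algebra_def)
  have ag: "abelian_group (D i)" if "i \<in> I" for i
    using md[OF that] by (simp add: module_def)
  have "abelian_group X"
  proof (rule abelian_groupI)
    fix x y z assume xyz: "x \<in> carrier X" "y \<in> carrier X" "z \<in> carrier X"
    show "x \<oplus>\<^bsub>X\<^esub> y \<oplus>\<^bsub>X\<^esub> z = x \<oplus>\<^bsub>X\<^esub> (y \<oplus>\<^bsub>X\<^esub> z)"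
      by (rule inj) (use xyz in \<open>simp_all add: closed hom abelian_monoid.a_assoc[OF abelian_group.axioms(1)[OF ag]]\<close>)
  next
    fix x y assume xy: "x \<in> carrier X" "y \<in> carrier X"
    show "x \<oplus>\<^bsub>X\<^esub> y = y \<oplus>\<^bsub>X\<^esub> x"
      by (rule inj) (use xy in \<open>simp_all add: closed hom abelian_monoid.a_comm[OF abelian_group.axioms(1)[OF ag]]\<close>)
  next
    fix x assume x: "x \<in> carrier X"
    show "\<zero>\<^bsub>X\<^esub> \<oplus>\<^bsub>X\<^esub> x = x"
      by (rule inj) (use x in \<open>simp_all add: closed hom abelian_monoid.l_zero[OF abelian_group.axioms(1)[OF ag]]\<close>)
    \<comment> \<open>The record has no negation, so the additive inverse has to be produced as a
      scalar multiple.\<close>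
    have "(-1) \<odot>\<^bsub>X\<^esub> x \<oplus>\<^bsub>X\<^esub> x = \<zero>\<^bsub>X\<^esub>"
    proof (rule inj)
      fix i assume i: "i \<in> I"
      interpret nonassoc_algebra "D i" by (rule na[OF i])
      have "j i x \<in> carrier (D i)"
        using i x by (rule j)
      then have "(-1) \<odot>\<^bsub>D i\<^esub> j i x \<oplus>\<^bsub>D i\<^esub> j i x = \<zero>\<^bsub>D i\<^esub>"
        by (simp add: M.l_neg flip: minus_smult)
      then show "j i ((-1) \<odot>\<^bsub>X\<^esub> x \<oplus>\<^bsub>X\<^esub> x) = j i \<zero>\<^bsub>X\<^esub>"
        using i x by (simp add: closed hom)
    qed (use x in \<open>simp_all add: closed\<close>)
    then show "\<exists>y\<in>carrier X. y \<oplus>\<^bsub>X\<^esub> x = \<zero>\<^bsub>X\<^esub>"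
      using smult[OF x] by blast
  qed (use closed in auto)
  then have "Module.module scalars X"
  proof (intro moduleI cring_scalars)
    fix a b :: complex and x y assume xy: "x \<in> carrier X" "y \<in> carrier X"
    show "(a \<oplus>\<^bsub>scalars\<^esub> b) \<odot>\<^bsub>X\<^esub> x = a \<odot>\<^bsub>X\<^esub> x \<oplus>\<^bsub>X\<^esub> b \<odot>\<^bsub>X\<^esub> x"
      by (rule inj) (use xy in \<open>simp_all add: closed hom nonassoc_algebra.smult_plus[OF na]\<close>)
    show "a \<odot>\<^bsub>X\<^esub> (x \<oplus>\<^bsub>X\<^esub> y) = a \<odot>\<^bsub>X\<^esub> x \<oplus>\<^bsub>X\<^esub> a \<odot>\<^bsub>X\<^esub> y"
      by (rule inj) (use xy in \<open>simp_all add: closed hom nonassoc_algebra.smult_add[OF na]\<close>)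
    show "(a \<otimes>\<^bsub>scalars\<^esub> b) \<odot>\<^bsub>X\<^esub> x = a \<odot>\<^bsub>X\<^esub> (b \<odot>\<^bsub>X\<^esub> x)"
      by (rule inj) (use xy in \<open>simp_all add: closed hom nonassoc_algebra.smult_smult[OF na]\<close>)
    show "\<one>\<^bsub>scalars\<^esub> \<odot>\<^bsub>X\<^esub> x = x"
      by (rule inj) (use xy in \<open>simp_all add: closed hom nonassoc_algebra.smult_1[OF na]\<close>)
  qed (use closed in auto)
  then have "nonassoc_algebra X"
  proof (intro nonassoc_algebra.intro nonassoc_algebra_axioms.intro)
    fix c x y z assume xyz: "x \<in> carrier X" "y \<in> carrier X" "z \<in> carrier X"
    show "(x \<oplus>\<^bsub>X\<^esub> y) \<otimes>\<^bsub>X\<^esub> z = x \<otimes>\<^bsub>X\<^esub> z \<oplus>\<^bsub>X\<^esub> y \<otimes>\<^bsub>X\<^esub> z"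
      by (rule inj) (use xyz in \<open>simp_all add: closed hom nonassoc_algebra.mult_add_left[OF na]\<close>)
    show "x \<otimes>\<^bsub>X\<^esub> (y \<oplus>\<^bsub>X\<^esub> z) = x \<otimes>\<^bsub>X\<^esub> y \<oplus>\<^bsub>X\<^esub> x \<otimes>\<^bsub>X\<^esub> z"
      by (rule inj) (use xyz in \<open>simp_all add: closed hom nonassoc_algebra.mult_add_right[OF na]\<close>)
  next
    fix c x y assume xy: "x \<in> carrier X" "y \<in> carrier X"
    show "c \<odot>\<^bsub>X\<^esub> x \<otimes>\<^bsub>X\<^esub> y = c \<odot>\<^bsub>X\<^esub> (x \<otimes>\<^bsub>X\<^esub> y)"
      by (rule inj) (use xy in \<open>simp_all add: closed hom nonassoc_algebra.mult_smult_left[OF na]\<close>)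
    show "x \<otimes>\<^bsub>X\<^esub> (c \<odot>\<^bsub>X\<^esub> y) = c \<odot>\<^bsub>X\<^esub> (x \<otimes>\<^bsub>X\<^esub> y)"
      by (rule inj) (use xy in \<open>simp_all add: closed hom nonassoc_algebra.mult_smult_right[OF na]\<close>)
  qed (use closed in auto)
  then show ?thesis
  proof (intro star_algebra.intro star_algebra_axioms.intro)
    fix x y z assume xyz: "x \<in> carrier X" "y \<in> carrier X" "z \<in> carrier X"
    show "x \<otimes>\<^bsub>X\<^esub> y \<otimes>\<^bsub>X\<^esub> z = x \<otimes>\<^bsub>X\<^esub> (y \<otimes>\<^bsub>X\<^esub> z)"
      by (rule inj) (use xyz in \<open>simp_all add: closed hom star_algebra.mult_assoc[OF D]\<close>)
  next
    fix x y assume xy: "x \<in> carrier X" "y \<in> carrier X"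
    show "star X (x \<oplus>\<^bsub>X\<^esub> y) = star X x \<oplus>\<^bsub>X\<^esub> star X y"
      by (rule inj) (use xy in \<open>simp_all add: closed hom star_algebra.star_add[OF D]\<close>)
    show "star X (x \<otimes>\<^bsub>X\<^esub> y) = star X y \<otimes>\<^bsub>X\<^esub> star X x"
      by (rule inj) (use xy in \<open>simp_all add: closed hom star_algebra.star_mult[OF D]\<close>)
  next
    fix c x assume x: "x \<in> carrier X"
    show "star X (star X x) = x"
      by (rule inj) (use x in \<open>simp_all add: closed hom star_algebra.star_star[OF D]\<close>)
    show "star X (c \<odot>\<^bsub>X\<^esub> x) = cnj c \<odot>\<^bsub>X\<^esub> star X x"
      by (rule inj) (use x in \<open>simp_all add: closed hom star_algebra.star_smult[OF D]\<close>)
  qed (use closed in auto)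
qed

section \<open>Homomorphisms and the isometry of the star\<close>

lemma alg_homD:
  assumes "h \<in> alg_hom M N"
  shows "x \<in> carrier M \<Longrightarrow> h x \<in> carrier N"
    and "\<lbrakk>x \<in> carrier M; y \<in> carrier M\<rbrakk> \<Longrightarrow> h (x \<oplus>\<^bsub>M\<^esub> y) = h x \<oplus>\<^bsub>N\<^esub> h y"
    and "x \<in> carrier M \<Longrightarrow> h (c \<odot>\<^bsub>M\<^esub> x) = c \<odot>\<^bsub>N\<^esub> h x"
    and "\<lbrakk>x \<in> carrier M; y \<in> carrier M\<rbrakk> \<Longrightarrow> h (x \<otimes>\<^bsub>M\<^esub> y) = h x \<otimes>\<^bsub>N\<^esub> h y"
  using assms by (auto simp: alg_hom_def)

lemma star_homD:
  assumes "h \<in> star_hom M N"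
  shows "x \<in> carrier M \<Longrightarrow> h x \<in> carrier N"
    and "\<lbrakk>x \<in> carrier M; y \<in> carrier M\<rbrakk> \<Longrightarrow> h (x \<oplus>\<^bsub>M\<^esub> y) = h x \<oplus>\<^bsub>N\<^esub> h y"
    and "x \<in> carrier M \<Longrightarrow> h (c \<odot>\<^bsub>M\<^esub> x) = c \<odot>\<^bsub>N\<^esub> h x"
    and "\<lbrakk>x \<in> carrier M; y \<in> carrier M\<rbrakk> \<Longrightarrow> h (x \<otimes>\<^bsub>M\<^esub> y) = h x \<otimes>\<^bsub>N\<^esub> h y"
    and "x \<in> carrier M \<Longrightarrow> h (star M x) = star N (h x)"
  using assms by (auto simp: star_hom_def alg_hom_def)

lemma star_homI:
  assumes "\<And>x. x \<in> carrier M \<Longrightarrow> h x \<in> carrier N"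
    and "\<And>x y. \<lbrakk>x \<in> carrier M; y \<in> carrier M\<rbrakk> \<Longrightarrow> h (x \<oplus>\<^bsub>M\<^esub> y) = h x \<oplus>\<^bsub>N\<^esub> h y"
    and "\<And>c x. x \<in> carrier M \<Longrightarrow> h (c \<odot>\<^bsub>M\<^esub> x) = c \<odot>\<^bsub>N\<^esub> h x"
    and "\<And>x y. \<lbrakk>x \<in> carrier M; y \<in> carrier M\<rbrakk> \<Longrightarrow> h (x \<otimes>\<^bsub>M\<^esub> y) = h x \<otimes>\<^bsub>N\<^esub> h y"
    and "\<And>x. x \<in> carrier M \<Longrightarrow> h (star M x) = star N (h x)"
  shows "h \<in> star_hom M N"
  using assms by (auto simp: star_hom_def alg_hom_def)

lemma alg_hom_zero:
  assumes "nonassoc_algebra M" "nonassoc_algebra N" "h \<in> alg_hom M N"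
  shows "h \<zero>\<^bsub>M\<^esub> = \<zero>\<^bsub>N\<^esub>"
proof -
  interpret M: nonassoc_algebra M by fact
  interpret N: nonassoc_algebra N by fact
  have "h (0 \<odot>\<^bsub>M\<^esub> \<zero>\<^bsub>M\<^esub>) = 0 \<odot>\<^bsub>N\<^esub> h \<zero>\<^bsub>M\<^esub>"
    using alg_homD(3)[OF assms(3)] by blast
  then show ?thesis
    using alg_homD(1)[OF assms(3)] by simp
qed

lemma alg_hom_diff:
  assumes "nonassoc_algebra M" "nonassoc_algebra N" "h \<in> alg_hom M N"
    and xy: "x \<in> carrier M" "y \<in> carrier M"
  shows "h (x \<ominus>\<^bsub>M\<^esub> y) = h x \<ominus>\<^bsub>N\<^esub> h y"
proof -
  interpret M: nonassoc_algebra M by fact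
  interpret N: nonassoc_algebra N by fact
  show ?thesis
    using xy alg_homD[OF assms(3)] by (simp add: M.diff_smult N.diff_smult)
qed

lemma star_hom_alg_hom: "h \<in> star_hom M N \<Longrightarrow> h \<in> alg_hom M N"
  by (simp add: star_hom_def)

lemma (in star_algebra) star_zero [simp]: "star M \<zero> = \<zero>"
  using star_smult[of \<zero> 0] star_closed by simp

text \<open>The C*-identity and submultiplicativity give
  \<open>nrm y * nrm y \<le> nrm (star M y) * nrm y\<close>; cancelling yields one inequality, and
  the same at \<open>star M x\<close> yields the other.\<close>

lemma (in cstar_algebra) norm_star:
  assumes x: "x \<in> carrier M"
  shows "nrm (star M x) = nrm x"
proof -
  have le: "nrm y \<le> nrm (star M y)" if y: "y \<in> carrier M" for y
  proof (cases "nrm y = 0")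
    case False
    have "nrm y * nrm y \<le> nrm (star M y) * nrm y"
      using cstar_identity[OF y] norm_mult[of "star M y" y] y
      by (simp add: star_closed power2_eq_square)
    with False show ?thesis
      using norm_nonneg[OF y] by simp
  qed (use y norm_nonneg star_closed in auto)
  show ?thesis
    using le[OF x] le[OF star_closed[OF x]] star_star[OF x] by simp
qed

lemma cstar_algebraI:
  assumes "star_algebra M" "banach_algebra M nrm"
    and "\<And>x. x \<in> carrier M \<Longrightarrow> nrm (star M x \<otimes>\<^bsub>M\<^esub> x) = (nrm x)\<^sup>2"
  shows "cstar_algebra M nrm"
  using assms by (simp add: cstar_algebra_def cstar_algebra_axioms_def)


section \<open>Formal polynomials\<close>

text \<open>The algebras need not be unital, so the empty word has to stand for 0.\<close>

fun word_eval :: "('k, 'c, 'm) module_scheme \<Rightarrow> ('a \<Rightarrow> 'c) \<Rightarrow> 'a list \<Rightarrow> 'c" where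
  "word_eval C \<phi> [] = \<zero>\<^bsub>C\<^esub>"
| "word_eval C \<phi> [a] = \<phi> a"
| "word_eval C \<phi> (a # b # u) = \<phi> a \<otimes>\<^bsub>C\<^esub> word_eval C \<phi> (b # u)"

primrec formal_eval :: "(complex, 'c, 'm) module_scheme \<Rightarrow> ('a \<Rightarrow> 'c) \<Rightarrow> 'a formal \<Rightarrow> 'c" where
  "formal_eval C \<phi> [] = \<zero>\<^bsub>C\<^esub>"
| "formal_eval C \<phi> (m # w) = (fst m \<odot>\<^bsub>C\<^esub> word_eval C \<phi> (snd m)) \<oplus>\<^bsub>C\<^esub> formal_eval C \<phi> w"

definition formal_scale :: "complex \<Rightarrow> 'a formal \<Rightarrow> 'a formal" where
  "formal_scale c w = map (\<lambda>(k, u). (c * k, u)) w"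

text \<open>Turns the distance of two evaluations into the seminorm of a single formal polynomial,
  so that being a Cauchy sequence depends on the seminorm only.\<close>

definition formal_diff :: "'a formal \<Rightarrow> 'a formal \<Rightarrow> 'a formal" where
  "formal_diff w v = w @ formal_scale (- 1) v"

text \<open>Plain concatenation would be wrong: the empty word stands for 0, so it has to absorb the
  other factor.\<close>

definition word_mult :: "'a list \<Rightarrow> 'a list \<Rightarrow> 'a list" where
  "word_mult u v = (if u = [] \<or> v = [] then [] else u @ v)"

definition monom_mult :: "complex \<times> 'a list \<Rightarrow> 'a formal \<Rightarrow> 'a formal" where
  "monom_mult m v = map (\<lambda>(k, u). (fst m * k, word_mult (snd m) u)) v"

definition formal_mult :: "'a formal \<Rightarrow> 'a formal \<Rightarrow> 'a formal" where
  "formal_mult w v = concat (map (\<lambda>m. monom_mult m v) w)"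

text \<open>Reversing a word is its adjoint because the generators are self-adjoint.\<close>

definition formal_star :: "'a formal \<Rightarrow> 'a formal" where
  "formal_star w = map (\<lambda>(k, u). (cnj k, rev u)) w"

text \<open>A representation of the free nonunital *-algebra on self-adjoint generators. The
  generators are indexed by the whole type, and no Jordan law is imposed yet; the laws enter later
  as conditions on the seminorm.\<close>

locale star_rep = star_algebra M
  for M :: "('c, 'm) star_alg_scheme" (structure) and \<phi> :: "'a \<Rightarrow> 'c" +
  assumes gen_in [simp]: "\<phi> a \<in> carrier M"
    and gen_star: "star M (\<phi> a) = \<phi> a"
begin

lemma word_eval_in [simp]: "word_eval M \<phi> u \<in> carrier M"
  by (induction u rule: induct_list012) auto

lemma eval_in [simp]: "formal_eval M \<phi> w \<in> carrier M"
  by (induction w) auto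

lemma eval_append: "formal_eval M \<phi> (w @ v) = formal_eval M \<phi> w \<oplus> formal_eval M \<phi> v"
  by (induction w) (auto simp: M.a_assoc)

lemma eval_scale: "formal_eval M \<phi> (formal_scale c w) = c \<odot> formal_eval M \<phi> w"
  by (induction w) (auto simp: formal_scale_def smult_add smult_smult)

lemma eval_diff: "formal_eval M \<phi> (formal_diff w v) = formal_eval M \<phi> w \<ominus> formal_eval M \<phi> v"
  by (simp add: formal_diff_def eval_append eval_scale diff_smult)

lemma word_eval_Cons: "u \<noteq> [] \<Longrightarrow> word_eval M \<phi> (a # u) = \<phi> a \<otimes> word_eval M \<phi> u"
  by (cases u) auto

lemma word_eval_append:
  "\<lbrakk>u \<noteq> []; v \<noteq> []\<rbrakk> \<Longrightarrow> word_eval M \<phi> (u @ v) = word_eval M \<phi> u \<otimes> word_eval M \<phi> v"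
proof (induction u)
  case (Cons a u)
  then show ?case
    by (cases "u = []") (auto simp: word_eval_Cons mult_assoc)
qed simp

lemma word_eval_mult: "word_eval M \<phi> (word_mult u v) = word_eval M \<phi> u \<otimes> word_eval M \<phi> v"
  by (auto simp: word_mult_def word_eval_append)

lemma word_eval_rev: "word_eval M \<phi> (rev u) = star M (word_eval M \<phi> u)"
proof (induction u)
  case (Cons a u)
  then show ?case
    by (cases "u = []") (auto simp: word_eval_Cons word_eval_append star_mult gen_star)
qed simp

lemma eval_monom_mult:
  "formal_eval M \<phi> (monom_mult m v) = (fst m \<odot> word_eval M \<phi> (snd m)) \<otimes> formal_eval M \<phi> v"
  by (induction v)
    (auto simp: monom_mult_def mult_add_right word_eval_mult mult_smult_left mult_smult_right
      smult_smult mult.commute)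

lemma eval_mult: "formal_eval M \<phi> (formal_mult w v) = formal_eval M \<phi> w \<otimes> formal_eval M \<phi> v"
  by (induction w) (auto simp: formal_mult_def eval_append eval_monom_mult mult_add_left)

lemma eval_star: "formal_eval M \<phi> (formal_star w) = star M (formal_eval M \<phi> w)"
  by (induction w) (auto simp: formal_star_def word_eval_rev star_add star_smult)

end

text \<open>Membership is proved along with the equation because \<open>h\<close> respects the
  operations only inside the carrier.\<close>

lemma hom_word_eval:
  assumes "nonassoc_algebra M" "nonassoc_algebra N" "h \<in> alg_hom M N" "\<And>a. \<phi> a \<in> carrier M"
  shows "h (word_eval M \<phi> u) = word_eval N (h \<circ> \<phi>) u \<and> word_eval M \<phi> u \<in> carrier M"
proof -
  interpret M: nonassoc_algebra M by fact
  show ?thesis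
    using assms alg_hom_zero[OF assms(1-3)]
    by (induction u rule: induct_list012) (auto simp: alg_homD)
qed

lemma hom_eval:
  assumes "nonassoc_algebra M" "nonassoc_algebra N" "h \<in> alg_hom M N" "\<And>a. \<phi> a \<in> carrier M"
  shows "h (formal_eval M \<phi> w) = formal_eval N (h \<circ> \<phi>) w"
proof -
  interpret M: nonassoc_algebra M by fact
  have u: "h (word_eval M \<phi> u) = word_eval N (h \<circ> \<phi>) u" "word_eval M \<phi> u \<in> carrier M" for u
    using hom_word_eval[of M N h \<phi> u] assms by auto
  have "h (formal_eval M \<phi> w) = formal_eval N (h \<circ> \<phi>) w \<and> formal_eval M \<phi> w \<in> carrier M"
    using u alg_hom_zero[OF assms(1-3)] by (induction w) (auto simp: alg_homD[OF assms(3)])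
  then show ?thesis ..
qed

section \<open>Limits of sequences of formal polynomials\<close>

locale cstar_rep = star_rep M \<phi> + cstar_algebra M nrm
  for M :: "('c, 'm) star_alg_scheme" (structure) and nrm :: "'c \<Rightarrow> real" and \<phi> :: "'a \<Rightarrow> 'c"

text \<open>The sequence consists of formal polynomials and not of algebra elements, so the same
  sequence can be followed in several algebras at once. Extensions of homomorphisms and diagonal
  subalgebras are built on this.\<close>

definition formal_conv ::
  "('c, 'm) star_alg_scheme \<Rightarrow> ('c \<Rightarrow> real) \<Rightarrow> ('a \<Rightarrow> 'c) \<Rightarrow> (nat \<Rightarrow> 'a formal) \<Rightarrow> 'c \<Rightarrow> bool" where
  "formal_conv M nrm \<phi> s x \<longleftrightarrow>
     x \<in> carrier M \<and> (\<lambda>n. nrm (x \<ominus>\<^bsub>M\<^esub> formal_eval M \<phi> (s n))) \<longlonglongrightarrow> 0"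

context cstar_rep
begin

abbreviation "ev \<equiv> formal_eval M \<phi>"
abbreviation "conv \<equiv> formal_conv M nrm \<phi>"

lemma conv_in: "conv s x \<Longrightarrow> x \<in> carrier M"
  by (simp add: formal_conv_def)

lemma conv_const: "conv (\<lambda>n. w) (ev w)"
  by (simp add: formal_conv_def)

lemma conv_bound:
  assumes "x \<in> carrier M" "\<And>n. nrm (x \<ominus> ev (s n)) \<le> r n" "r \<longlonglongrightarrow> 0"
  shows "conv s x"
  unfolding formal_conv_def
  using assms by (auto intro!: tendsto_sandwich[OF _ _ tendsto_const assms(3)] always_eventually norm_nonneg)

lemma conv_tendsto: "conv s x \<Longrightarrow> (\<lambda>n. nrm (x \<ominus> ev (s n))) \<longlonglongrightarrow> 0"
  by (simp add: formal_conv_def)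

lemma conv_unique:
  assumes "conv s x" "conv s y"
  shows "x = y"
proof -
  note xy = conv_in[OF assms(1)] conv_in[OF assms(2)]
  have "nrm (x \<ominus> y) \<le> nrm (x \<ominus> ev (s n)) + nrm (y \<ominus> ev (s n))" for n
    using norm_diff_triangle[of x "ev (s n)" y] norm_diff_commute[of y "ev (s n)"] xy by simp
  then have "nrm (x \<ominus> y) \<le> 0 + 0"
    by (intro tendsto_lowerbound[OF tendsto_add[OF conv_tendsto[OF assms(1)] conv_tendsto[OF assms(2)]]])
      auto
  then show ?thesis
    using xy norm_nonneg[of "x \<ominus> y"] norm_diff_eq_0[of x y] by simp
qed

lemma conv_add:
  assumes "conv s x" "conv t y"
  shows "conv (\<lambda>n. s n @ t n) (x \<oplus> y)"
proof (rule conv_bound)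
  note xy = conv_in[OF assms(1)] conv_in[OF assms(2)]
  show "x \<oplus> y \<in> carrier M" using xy by simp
  show "nrm ((x \<oplus> y) \<ominus> ev (s n @ t n)) \<le> nrm (x \<ominus> ev (s n)) + nrm (y \<ominus> ev (t n))" for n
    using xy by (simp add: eval_append norm_diff_add)
  show "(\<lambda>n. nrm (x \<ominus> ev (s n)) + nrm (y \<ominus> ev (t n))) \<longlonglongrightarrow> 0"
    using tendsto_add[OF conv_tendsto[OF assms(1)] conv_tendsto[OF assms(2)]] by simp
qed

lemma conv_scale:
  assumes "conv s x"
  shows "conv (\<lambda>n. formal_scale c (s n)) (c \<odot> x)"
proof (rule conv_bound)
  note x = conv_in[OF assms(1)]
  show "c \<odot> x \<in> carrier M" using x by simp
  show "nrm (c \<odot> x \<ominus> ev (formal_scale c (s n))) \<le> norm c * nrm (x \<ominus> ev (s n))" for n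
    using x norm_diff_smult[of x "ev (s n)" c c] by (simp add: eval_scale)
  show "(\<lambda>n. norm c * nrm (x \<ominus> ev (s n))) \<longlonglongrightarrow> 0"
    using tendsto_mult_left[OF conv_tendsto[OF assms(1)], of "norm c"] by simp
qed

lemma conv_norm:
  assumes "conv s x"
  shows "(\<lambda>n. nrm (ev (s n))) \<longlonglongrightarrow> nrm x"
proof (rule tendstoI)
  note x = conv_in[OF assms(1)]
  fix e :: real assume "e > 0"
  have "\<forall>\<^sub>F n in sequentially. nrm (x \<ominus> ev (s n)) < e"
    using order_tendstoD(2)[OF conv_tendsto[OF assms] \<open>e > 0\<close>] .
  then show "\<forall>\<^sub>F n in sequentially. dist (nrm (ev (s n))) (nrm x) < e"
  proof eventually_elim
    case (elim n)
    then show ?case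
      using norm_le_diff[of x "ev (s n)"] norm_le_diff[of "ev (s n)" x] norm_diff_commute[of x "ev (s n)"] x
      by (simp add: dist_real_def)
  qed
qed

lemma conv_mult:
  assumes "conv s x" "conv t y"
  shows "conv (\<lambda>n. formal_mult (s n) (t n)) (x \<otimes> y)"
proof (rule conv_bound)
  note xy = conv_in[OF assms(1)] conv_in[OF assms(2)]
  show "x \<otimes> y \<in> carrier M" using xy by simp
  show "nrm ((x \<otimes> y) \<ominus> ev (formal_mult (s n) (t n)))
      \<le> nrm (x \<ominus> ev (s n)) * nrm y + nrm (ev (s n)) * nrm (y \<ominus> ev (t n))" for n
    using xy by (simp add: eval_mult norm_diff_mult)
  \<comment> \<open>The factor \<open>nrm (ev (s n))\<close> varies with \<open>n\<close>, but it
    converges by \<open>conv_norm\<close>, so the second product still tends to 0.\<close>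
  have "(\<lambda>n. nrm (x \<ominus> ev (s n)) * nrm y + nrm (ev (s n)) * nrm (y \<ominus> ev (t n)))
      \<longlonglongrightarrow> 0 * nrm y + nrm x * 0"
    by (intro tendsto_intros conv_norm conv_tendsto assms)
  then show "(\<lambda>n. nrm (x \<ominus> ev (s n)) * nrm y + nrm (ev (s n)) * nrm (y \<ominus> ev (t n))) \<longlonglongrightarrow> 0"
    by simp
qed

lemma star_diff:
  assumes "x \<in> carrier M" "y \<in> carrier M"
  shows "star M (x \<ominus> y) = star M x \<ominus> star M y"
  using assms by (simp add: diff_smult star_add star_smult star_closed)

lemma conv_star:
  assumes "conv s x"
  shows "conv (\<lambda>n. formal_star (s n)) (star M x)"
proof (rule conv_bound)
  note x = conv_in[OF assms(1)]
  show "star M x \<in> carrier M" using x by (rule star_closed)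
  show "nrm (star M x \<ominus> ev (formal_star (s n))) \<le> nrm (x \<ominus> ev (s n))" for n
    using x by (simp add: eval_star norm_star flip: star_diff)
  show "(\<lambda>n. nrm (x \<ominus> ev (s n))) \<longlonglongrightarrow> 0"
    by (rule conv_tendsto[OF assms])
qed

lemma conv_Cauchy:
  assumes "conv s x" "e > 0"
  shows "\<exists>k. \<forall>m\<ge>k. \<forall>n\<ge>k. nrm (ev (formal_diff (s m) (s n))) < e"
  using Cauchy_dist[OF _ conv_in[OF assms(1)] conv_tendsto[OF assms(1)] assms(2)] by (simp add: eval_diff)

lemma Cauchy_conv:
  assumes "\<And>e. e > 0 \<Longrightarrow> \<exists>k. \<forall>m\<ge>k. \<forall>n\<ge>k. nrm (ev (formal_diff (s m) (s n))) < e"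
  shows "\<exists>x. conv s x"
  using Cauchy_converges[of "\<lambda>n. ev (s n)"] assms by (auto simp: eval_diff formal_conv_def)

end

section \<open>Contractivity of *-homomorphisms\<close>

context cstar_algebra
begin

text \<open>In the presence of a unit \<open>q\<close> would be (1 - a)^-1 - 1. Its left and right
  equations are fixed point equations of two contractions with factor \<open>nrm a\<close>, and
  associativity identifies the two solutions.\<close>

lemma quasi_inverse_exists:
  assumes a: "a \<in> carrier M" and lt: "nrm a < 1"
  shows "\<exists>q\<in>carrier M. q = a \<oplus> a \<otimes> q \<and> q = a \<oplus> q \<otimes> a"
proof -
  obtain q where q: "q \<in> carrier M" "a \<oplus> a \<otimes> q = q"
  proof (rule Met.Banach_fixedpoint_thm[OF complete _ _ lt])
    show "carrier M \<noteq> {}" using a by blast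
    show "(\<lambda>q. a \<oplus> a \<otimes> q) \<in> carrier M \<rightarrow> carrier M" using a by auto
    show "norm_dist M nrm (a \<oplus> a \<otimes> x) (a \<oplus> a \<otimes> y) \<le> nrm a * norm_dist M nrm x y"
      if "x \<in> carrier M" "y \<in> carrier M" for x y
      using that a norm_mult[of a "x \<ominus> y"]
      by (simp add: norm_dist_def diff_add_diff mult_diff_right)
  qed
  obtain p where p: "p \<in> carrier M" "a \<oplus> p \<otimes> a = p"
  proof (rule Met.Banach_fixedpoint_thm[OF complete _ _ lt])
    show "carrier M \<noteq> {}" using a by blast
    show "(\<lambda>q. a \<oplus> q \<otimes> a) \<in> carrier M \<rightarrow> carrier M" using a by auto
    show "norm_dist M nrm (a \<oplus> x \<otimes> a) (a \<oplus> y \<otimes> a) \<le> nrm a * norm_dist M nrm x y"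
      if "x \<in> carrier M" "y \<in> carrier M" for x y
      using that a norm_mult[of "x \<ominus> y" a]
      by (simp add: norm_dist_def diff_add_diff mult_diff_left mult.commute)
  qed
  \<comment> \<open>The product \<open>p \<otimes> q\<close> is expanded once by the equation of
    \<open>p\<close> and once by that of \<open>q\<close>; both expansions contain
    \<open>p \<otimes> a \<otimes> q\<close>, which cancels.\<close>
  have "p \<otimes> q = a \<otimes> q \<oplus> p \<otimes> a \<otimes> q"
    using mult_add_left[of a "p \<otimes> a" q] a p q by simp
  moreover have "p \<otimes> q = p \<otimes> a \<oplus> p \<otimes> a \<otimes> q"
    using mult_add_right[of p a "a \<otimes> q"] a p q by (simp add: mult_assoc)
  ultimately have "a \<otimes> q = p \<otimes> a"
    using a p(1) q(1) by (metis M.add.right_cancel mult_in)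
  then have "p = q"
    using p(2) q(2) by simp
  then have "q = a \<oplus> q \<otimes> a"
    using p(2) by simp
  with q show ?thesis
    by metis
qed

text \<open>The resolvent identity for 1 + p = (1 - z b)^-1 and 1 + q = (1 - w b)^-1, namely p - q =
  (z - w) (1 + p) b (1 + q), followed by the norm estimate of the right-hand side.\<close>

lemma resolvent_diff_le:
  assumes [simp]: "b \<in> carrier M" "p \<in> carrier M" "q \<in> carrier M"
    and p: "p = z \<odot> b \<oplus> z \<odot> (p \<otimes> b)" and q: "q = w \<odot> b \<oplus> w \<odot> (b \<otimes> q)"
  shows "nrm (p \<ominus> q) \<le> norm (z - w) * (nrm b * (1 + nrm p) * (1 + nrm q))"
proof -
  \<comment> \<open>\<open>P\<close>, \<open>R\<close> and \<open>S\<close> are (1 + p) b, b (1 + q)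
    and (1 + p) b (1 + q), written without a unit. Computing \<open>S\<close> from either side gives
    \<open>z \<odot> S\<close> and \<open>w \<odot> S\<close>, whose common term
    \<open>p \<otimes> q\<close> drops out of the difference.\<close>
  define P where "P = b \<oplus> p \<otimes> b"
  define R where "R = b \<oplus> b \<otimes> q"
  define S where "S = P \<oplus> P \<otimes> q"
  have [simp]: "P \<in> carrier M" "R \<in> carrier M" "S \<in> carrier M"
    by (simp_all add: P_def R_def S_def)
  have zP: "z \<odot> P = p"
    using p by (simp add: P_def smult_add)
  have wR: "w \<odot> R = q"
    using q by (simp add: R_def smult_add)
  have SR: "S = R \<oplus> p \<otimes> R"
    by (simp add: S_def P_def R_def mult_add_left mult_add_right mult_assoc M.a_ac)
  have "z \<odot> S = p \<oplus> p \<otimes> q"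
    by (simp add: S_def smult_add zP flip: mult_smult_left)
  moreover have "w \<odot> S = q \<oplus> p \<otimes> q"
    by (simp add: SR smult_add wR flip: mult_smult_right)
  ultimately have "p \<ominus> q = z \<odot> S \<ominus> w \<odot> S"
    by (simp add: diff_add_diff)
  also have "\<dots> = (z - w) \<odot> S"
    by (simp add: diff_smult smult_smult flip: smult_plus)
  finally have "nrm (p \<ominus> q) = norm (z - w) * nrm S"
    by (simp add: norm_smult)
  moreover have "nrm S \<le> nrm P + nrm P * nrm q"
    using norm_add[of P "P \<otimes> q"] norm_mult[of P q] by (simp add: S_def)
  moreover have "nrm P \<le> nrm b + nrm p * nrm b"
    using norm_add[of b "p \<otimes> b"] norm_mult[of p b] by (simp add: P_def)
  then have "nrm P * (1 + nrm q) \<le> (nrm b + nrm p * nrm b) * (1 + nrm q)"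
    by (intro mult_right_mono) (simp_all add: norm_nonneg)
  ultimately have "nrm S \<le> nrm b * (1 + nrm p) * (1 + nrm q)"
    by (simp add: algebra_simps)
  with \<open>nrm (p \<ominus> q) = _\<close> show ?thesis
    by (simp add: mult_left_mono)
qed

text \<open>With \<open>1 + q = (1 - y)\<^sup>-\<^sup>1\<close> and \<open>1 + p = (1 + y)\<^sup>-\<^sup>1\<close> this is \<open>((1 - y)\<^sup>-\<^sup>1 + (1 + y)\<^sup>-\<^sup>1) / 2 = (1 - y\<^sup>2)\<^sup>-\<^sup>1\<close>.\<close>

lemma quasi_inverse_square:
  assumes [simp]: "y \<in> carrier M" "p \<in> carrier M" "q \<in> carrier M"
    and q: "q = y \<oplus> y \<otimes> q" and p: "p = (- 1) \<odot> y \<oplus> ((- 1) \<odot> y) \<otimes> p"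
  shows "(1/2) \<odot> (q \<oplus> p) = y \<otimes> y \<oplus> (y \<otimes> y) \<otimes> ((1/2) \<odot> (q \<oplus> p))"
proof -
  define R where "R = (1/2) \<odot> (q \<oplus> p)"
  \<comment> \<open>Half the difference of the two quasi-inverses. The pair satisfies
    \<open>R = y \<otimes> D\<close> and \<open>D = y \<oplus> y \<otimes> R\<close>, and
    eliminating \<open>D\<close> gives the equation for the square.\<close>
  define D where "D = (1/2) \<odot> q \<oplus> (-1/2) \<odot> p"
  have [simp]: "R \<in> carrier M" "D \<in> carrier M"
    by (simp_all add: R_def D_def)
  have half: "(1/2) \<odot> x \<oplus> ((1/2) \<odot> x \<oplus> z) = x \<oplus> z" if "x \<in> carrier M" "z \<in> carrier M" for x z
    using that by (simp flip: M.a_assoc smult_plus)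
  have cancel: "(1/2) \<odot> x \<oplus> (u \<oplus> ((-1/2) \<odot> x \<oplus> z)) = u \<oplus> z"
    if "x \<in> carrier M" "z \<in> carrier M" "u \<in> carrier M" for x z u
  proof -
    have "(1/2) \<odot> x \<oplus> (u \<oplus> ((-1/2) \<odot> x \<oplus> z)) = ((1/2) \<odot> x \<oplus> (-1/2) \<odot> x) \<oplus> (u \<oplus> z)"
      using that by (simp add: M.a_ac)
    also have "(1/2) \<odot> x \<oplus> (-1/2) \<odot> x = \<zero>"
      using that by (simp flip: smult_plus)
    finally show ?thesis
      using that by simp
  qed
  have q': "(1/2) \<odot> q = (1/2) \<odot> y \<oplus> (1/2) \<odot> (y \<otimes> q)"
    by (subst q) (simp add: smult_add)
  have p': "c \<odot> p = (-c) \<odot> y \<oplus> (-c) \<odot> (y \<otimes> p)" for c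
    by (subst p) (simp add: smult_add smult_smult mult_smult_left)
  have "R = (1/2) \<odot> y \<oplus> ((1/2) \<odot> (y \<otimes> q) \<oplus> ((-1/2) \<odot> y \<oplus> (-1/2) \<odot> (y \<otimes> p)))"
    using q' p'[of "1/2"] by (simp add: R_def smult_add M.a_assoc)
  also have "\<dots> = y \<otimes> D"
    by (subst cancel) (simp_all add: D_def mult_add_right mult_smult_right)
  finally have R: "R = y \<otimes> D" .
  have "D = (1/2) \<odot> y \<oplus> ((1/2) \<odot> y \<oplus> ((1/2) \<odot> (y \<otimes> q) \<oplus> (1/2) \<odot> (y \<otimes> p)))"
    using q' p'[of "-1/2"] by (simp add: D_def M.a_ac)
  also have "\<dots> = y \<oplus> y \<otimes> R"
    by (subst half) (simp_all add: R_def smult_add mult_add_right mult_smult_right)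
  finally have "R = y \<otimes> (y \<oplus> y \<otimes> R)"
    using R by simp
  then show ?thesis
    unfolding R_def[symmetric] by (simp add: mult_add_right mult_assoc)
qed

primrec iter_square :: "'a \<Rightarrow> nat \<Rightarrow> 'a" where
  "iter_square b 0 = b"
| "iter_square b (Suc k) = iter_square b k \<otimes> iter_square b k"

text \<open>For a self-adjoint element the C*-identity says that the norm of the square is the
  square of the norm, so norm 1 survives every squaring.\<close>

lemma iter_square_selfadjoint:
  assumes "b \<in> carrier M" "star M b = b" "nrm b = 1"
  shows "iter_square b k \<in> carrier M \<and> star M (iter_square b k) = iter_square b k
    \<and> nrm (iter_square b k) = 1"
  using assms
proof (induction k)
  case (Suc k)
  then show ?case
    using cstar_identity[of "iter_square b k"] by (simp add: star_mult)
qed simp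

text \<open>
  Rickart's proof that a self-adjoint element of norm 1 has spectral radius at least 1. The average
  of the resolvents at \<open>z\<close> and \<open>\<eta> z\<close> is the resolvent of the square, so all the resolvents of the
  iterated squares of \<open>b\<close> share one Lipschitz constant, which keeps them small at 1.
\<close>

lemma selfadjoint_resolvent:
  assumes b [simp]: "b \<in> carrier M" and sa: "star M b = b" and nb: "nrm b = 1"
    and ex: "\<And>z. norm z \<le> 1 \<Longrightarrow>
      \<exists>q\<in>carrier M. q = z \<odot> b \<oplus> z \<odot> (b \<otimes> q) \<and> q = z \<odot> b \<oplus> z \<odot> (q \<otimes> b)"
  shows False
proof -
  obtain Q where Qin: "\<And>z. norm z \<le> 1 \<Longrightarrow> Q z \<in> carrier M"
    and Qr: "\<And>z. norm z \<le> 1 \<Longrightarrow> Q z = z \<odot> b \<oplus> z \<odot> (b \<otimes> Q z)"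
    and Ql: "\<And>z. norm z \<le> 1 \<Longrightarrow> Q z = z \<odot> b \<oplus> z \<odot> (Q z \<otimes> b)"
    using ex by metis
  have lip: "nrm (Q z \<ominus> Q w) \<le> norm (z - w) * ((1 + nrm (Q z)) * (1 + nrm (Q w)))"
    if "norm z \<le> 1" "norm w \<le> 1" for z w
    using resolvent_diff_le[OF b Qin[OF that(1)] Qin[OF that(2)] Ql[OF that(1)] Qr[OF that(2)]] nb by simp
  \<comment> \<open>No bound on \<open>nrm (Q z)\<close> is known yet. Dividing the resolvent
    estimate by both factors \<open>1 + nrm (Q z)\<close> and \<open>1 + nrm (Q w)\<close> makes
    this reciprocal Lipschitz with constant 1, hence continuous on the compact disc.\<close>
  define m where "m z = 1 / (1 + nrm (Q z))" for z
  have pos: "1 + nrm (Q z) > 0" if "norm z \<le> 1" for z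
    using norm_nonneg[OF Qin[OF that]] by simp
  have mlip: "\<bar>m z - m w\<bar> \<le> norm (z - w)" if z: "norm z \<le> 1" and w: "norm w \<le> 1" for z w
  proof -
    have "\<bar>nrm (Q w) - nrm (Q z)\<bar> \<le> nrm (Q z \<ominus> Q w)"
      using norm_le_diff[OF Qin[OF z] Qin[OF w]] norm_le_diff[OF Qin[OF w] Qin[OF z]]
        norm_diff_commute[OF Qin[OF z] Qin[OF w]] by simp
    also note lip[OF z w]
    finally have "\<bar>nrm (Q w) - nrm (Q z)\<bar> / ((1 + nrm (Q z)) * (1 + nrm (Q w))) \<le> norm (z - w)"
      using pos[OF z] pos[OF w] by (simp add: pos_divide_le_eq)
    moreover have "\<bar>m z - m w\<bar> = \<bar>nrm (Q w) - nrm (Q z)\<bar> / ((1 + nrm (Q z)) * (1 + nrm (Q w)))"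
    proof -
      have "m z - m w = (nrm (Q w) - nrm (Q z)) / ((1 + nrm (Q z)) * (1 + nrm (Q w)))"
        using pos[OF z] pos[OF w] by (simp add: m_def divide_simps)
      then show ?thesis
        using pos[OF z] pos[OF w] by (simp add: abs_divide abs_mult)
    qed
    ultimately show ?thesis by simp
  qed
  have "continuous_on (cball 0 1) m"
    unfolding continuous_on_iff
  proof (intro ballI allI impI)
    fix z :: complex and e :: real assume "z \<in> cball 0 1" "e > 0"
    then have "dist (m w) (m z) < e" if "w \<in> cball 0 1" "dist w z < e" for w
      using mlip[of w z] that by (simp add: dist_real_def dist_norm)
    with \<open>e > 0\<close> show "\<exists>d>0. \<forall>w\<in>cball 0 1. dist w z < d \<longrightarrow> dist (m w) (m z) < e"
      by blast
  qed
  then obtain z0 :: complex where z0: "norm z0 \<le> 1" "\<And>z. norm z \<le> 1 \<Longrightarrow> m z0 \<le> m z"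
    using continuous_attains_inf[of "cball (0::complex) 1" m] by (auto simp: dist_norm)
  \<comment> \<open>The minimum of \<open>m\<close> is attained at \<open>z0\<close> and equals
    \<open>1 / K\<close> with \<open>K\<close> finite, so \<open>K\<close> bounds
    \<open>1 + nrm (Q z)\<close> on the whole disc. The resolvent estimate then makes
    \<open>Q\<close> Lipschitz with constant \<open>K * K\<close>.\<close>
  define K where "K = 1 + nrm (Q z0)"
  have Kpos: "K > 0" using pos[OF z0(1)] by (simp add: K_def)
  have K: "1 + nrm (Q z) \<le> K" if "norm z \<le> 1" for z
    using z0(2)[OF that] pos[OF that] pos[OF z0(1)] by (simp add: m_def K_def divide_simps split: if_splits)
  define L where "L = K * K"
  have Lpos: "L > 0" using Kpos by (simp add: L_def)
  \<comment> \<open>\<open>F z\<close> is a quasi-inverse of (z b)^(2^k), of which only the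
    one-sided equation is retained. The point is that \<open>L\<close> does not depend on
    \<open>k\<close>.\<close>
  have "\<exists>F. (\<forall>z. norm z \<le> 1 \<longrightarrow> F z \<in> carrier M \<and>
        F z = z ^ (2 ^ k) \<odot> iter_square b k \<oplus> (z ^ (2 ^ k) \<odot> iter_square b k) \<otimes> F z) \<and>
      (\<forall>z w. norm z \<le> 1 \<longrightarrow> norm w \<le> 1 \<longrightarrow> nrm (F z \<ominus> F w) \<le> L * norm (z - w))" for k
  proof (induction k)
    case 0
    have "nrm (Q z \<ominus> Q w) \<le> L * norm (z - w)" if z: "norm z \<le> 1" and w: "norm w \<le> 1" for z w
    proof -
      have "(1 + nrm (Q z)) * (1 + nrm (Q w)) \<le> L"
        unfolding L_def using K[OF z] K[OF w] pos[OF z] pos[OF w] by (intro mult_mono) auto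
      then have "norm (z - w) * ((1 + nrm (Q z)) * (1 + nrm (Q w))) \<le> norm (z - w) * L"
        by (rule mult_left_mono) simp
      with lip[OF z w] show ?thesis by (simp add: mult.commute)
    qed
    moreover have "Q z = z ^ 2 ^ 0 \<odot> iter_square b 0 \<oplus> z ^ 2 ^ 0 \<odot> iter_square b 0 \<otimes> Q z"
      if "norm z \<le> 1" for z
      using Qr[OF that] Qin[OF that] by (simp add: mult_smult_left)
    ultimately show ?case
      using Qin by blast
  next
    case (Suc k)
    then obtain F where Fin: "\<And>z. norm z \<le> 1 \<Longrightarrow> F z \<in> carrier M"
      and F: "\<And>z. norm z \<le> 1 \<Longrightarrow>
        F z = z ^ (2 ^ k) \<odot> iter_square b k \<oplus> (z ^ (2 ^ k) \<odot> iter_square b k) \<otimes> F z"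
      and FL: "\<And>z w. \<lbrakk>norm z \<le> 1; norm w \<le> 1\<rbrakk> \<Longrightarrow> nrm (F z \<ominus> F w) \<le> L * norm (z - w)"
      by blast
    have [simp]: "iter_square b k \<in> carrier M"
      using iter_square_selfadjoint[OF b sa nb] by blast
    \<comment> \<open>A root of -1 of order \<open>2 ^ k\<close>: passing from \<open>z\<close> to
      \<open>\<eta> * z\<close> changes the sign of \<open>y\<close>, as
      \<open>quasi_inverse_square\<close> demands. Having modulus 1, it preserves the disc and all
      distances, so averaging keeps the constant \<open>L\<close>.\<close>
    define \<eta> where "\<eta> = cis (pi / 2 ^ k)"
    have "\<eta> ^ (2 ^ k) = cis (real (2 ^ k) * (pi / 2 ^ k))"
      unfolding \<eta>_def by (rule Complex.DeMoivre)
    also have "real (2 ^ k) * (pi / 2 ^ k) = pi"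
      by simp
    finally have \<eta>: "norm \<eta> = 1" "\<eta> ^ (2 ^ k) = - 1"
      by (simp_all add: \<eta>_def)
    have n\<eta>: "norm (\<eta> * z) \<le> 1" if "norm z \<le> 1" for z
      using that \<eta> by (simp add: Real_Vector_Spaces.norm_mult)
    define G where "G z = (1/2) \<odot> (F z \<oplus> F (\<eta> * z))" for z
    have Gin: "G z \<in> carrier M" if "norm z \<le> 1" for z
      using Fin[OF that] Fin[OF n\<eta>[OF that]] by (simp add: G_def)
    have "G z = z ^ (2 ^ Suc k) \<odot> iter_square b (Suc k) \<oplus> (z ^ (2 ^ Suc k) \<odot> iter_square b (Suc k)) \<otimes> G z"
      if z: "norm z \<le> 1" for z
    proof -
      define y where "y = z ^ (2 ^ k) \<odot> iter_square b k"
      have y: "y \<in> carrier M" by (simp add: y_def)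
      have my: "(\<eta> * z) ^ (2 ^ k) \<odot> iter_square b k = (- 1) \<odot> y"
        by (simp add: y_def smult_smult power_mult_distrib \<eta>)
      have yy: "y \<otimes> y = z ^ (2 ^ Suc k) \<odot> iter_square b (Suc k)"
        by (simp add: y_def mult_smult_left mult_smult_right smult_smult mult_2 power_add)
      have "F (\<eta> * z) = (- 1) \<odot> y \<oplus> (- 1) \<odot> y \<otimes> F (\<eta> * z)"
        using F[OF n\<eta>[OF z]] unfolding my .
      from quasi_inverse_square[OF y Fin[OF n\<eta>[OF z]] Fin[OF z] F[OF z, folded y_def] this]
      show ?thesis
        unfolding yy G_def .
    qed
    moreover have "nrm (G z \<ominus> G w) \<le> L * norm (z - w)" if z: "norm z \<le> 1" and w: "norm w \<le> 1" for z w
    proof -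
      note [simp] = Fin[OF z] Fin[OF w] Fin[OF n\<eta>[OF z]] Fin[OF n\<eta>[OF w]]
      have "nrm (G z \<ominus> G w) = 1/2 * nrm ((F z \<oplus> F (\<eta> * z)) \<ominus> (F w \<oplus> F (\<eta> * w)))"
        by (simp add: G_def norm_smult flip: smult_diff)
      also have "\<dots> \<le> 1/2 * (nrm (F z \<ominus> F w) + nrm (F (\<eta> * z) \<ominus> F (\<eta> * w)))"
        by (intro mult_left_mono norm_diff_add) simp_all
      also have "\<dots> \<le> 1/2 * (L * norm (z - w) + L * norm (\<eta> * z - \<eta> * w))"
        by (intro mult_left_mono add_mono FL z w n\<eta>) simp
      also have "norm (\<eta> * z - \<eta> * w) = norm (z - w)"
      proof -
        have "\<eta> * z - \<eta> * w = \<eta> * (z - w)" by (simp add: algebra_simps)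
        then show ?thesis by (simp add: \<eta> Real_Vector_Spaces.norm_mult)
      qed
      finally show ?thesis by simp
    qed
    ultimately show ?case
      using Gin by blast
  qed
  then obtain F where Fin: "\<And>k z. norm z \<le> 1 \<Longrightarrow> F k z \<in> carrier M"
    and F: "\<And>k z. norm z \<le> 1 \<Longrightarrow>
      F k z = z ^ (2 ^ k) \<odot> iter_square b k \<oplus> (z ^ (2 ^ k) \<odot> iter_square b k) \<otimes> F k z"
    and FL: "\<And>k z w. \<lbrakk>norm z \<le> 1; norm w \<le> 1\<rbrakk> \<Longrightarrow> nrm (F k z \<ominus> F k w) \<le> L * norm (z - w)"
    by metis
  have y [simp]: "iter_square b k \<in> carrier M" and ny: "nrm (iter_square b k) = 1" for k
    using iter_square_selfadjoint[OF b sa nb] by blast+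
  \<comment> \<open>At 1 the equation \<open>F = y \<oplus> y \<otimes> F\<close> with
    \<open>nrm y = 1\<close> forces 1 to be at most \<open>2 * nrm F\<close>, whatever
    \<open>k\<close> is.\<close>
  have big: "1/2 \<le> nrm (F k 1)" for k
  proof -
    have in1 [simp]: "F k 1 \<in> carrier M" by (simp add: Fin)
    have "F k 1 = iter_square b k \<oplus> iter_square b k \<otimes> F k 1"
      using F[of 1 k] by simp
    then have "F k 1 \<ominus> iter_square b k \<otimes> F k 1 = iter_square b k"
      by (metis M.add.inv_solve_right M.minus_eq in1 mult_in y)
    then have "1 \<le> nrm (F k 1) + nrm (iter_square b k \<otimes> F k 1)"
      using norm_diff_le[of "F k 1" "iter_square b k \<otimes> F k 1"] ny by simp
    also have "nrm (iter_square b k \<otimes> F k 1) \<le> nrm (F k 1)"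
      using norm_mult[of "iter_square b k" "F k 1"] ny by simp
    finally show ?thesis by simp
  qed
  \<comment> \<open>At \<open>t < 1\<close> the same equation has the factor
    \<open>t ^ (2 ^ k)\<close>, so the quasi-inverse there becomes small for large \<open>k\<close>.
    This contradicts \<open>big\<close> as soon as \<open>t\<close> is close enough to 1 for the
    common Lipschitz constant.\<close>
  have small: "nrm (F k (of_real t)) \<le> t ^ (2 ^ k) * (1 + nrm (F k (of_real t)))"
    if t: "0 \<le> t" "t \<le> 1" for k t
  proof -
    have nt: "norm (complex_of_real t) \<le> 1" using t by simp
    note [simp] = Fin[OF nt]
    define u where "u = complex_of_real t ^ (2 ^ k) \<odot> iter_square b k"
    have [simp]: "u \<in> carrier M" by (simp add: u_def)
    have nu: "nrm u = t ^ (2 ^ k)"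
      using t by (simp add: u_def norm_smult ny norm_power)
    have "F k (of_real t) = u \<oplus> u \<otimes> F k (of_real t)"
      using F[OF nt] unfolding u_def .
    then have "nrm (F k (of_real t)) \<le> nrm u + nrm (u \<otimes> F k (of_real t))"
      using norm_add[of u "u \<otimes> F k (of_real t)"] by simp
    also have "\<dots> \<le> nrm u + nrm u * nrm (F k (of_real t))"
      using norm_mult[of u "F k (of_real t)"] by simp
    finally show ?thesis
      by (simp add: nu algebra_simps)
  qed
  \<comment> \<open>Chosen so that moving from \<open>t\<close> to 1 costs at most
    \<open>L * (1 - t) \<le> 1/8\<close>. With the power of \<open>t\<close> below 1/9,
    \<open>r \<le> (1 + r) / 9\<close> gives another 1/8, and 1/8 + 1/8 is less than the 1/2 from
    \<open>big\<close>.\<close>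
  define t where "t = max 0 (1 - 1 / (8 * L))"
  have t: "0 \<le> t" "t < 1" and Lt: "L * (1 - t) \<le> 1/8"
    using Lpos by (auto simp: t_def max_def field_simps)
  obtain n where n: "t ^ n < 1/9"
    using real_arch_pow_inv[of "1/9" t] t by auto
  have tn: "t ^ (2 ^ n) \<le> t ^ n"
    using t by (intro power_decreasing) (auto intro: less_imp_le less_exp)
  have nt: "norm (complex_of_real t) \<le> 1" using t by simp
  define r where "r = nrm (F n (of_real t))"
  have "r \<ge> 0" unfolding r_def by (rule norm_nonneg[OF Fin[OF nt]])
  have "r \<le> t ^ (2 ^ n) * (1 + r)"
    using small[of t n] t by (simp add: r_def)
  also have "\<dots> \<le> 1/9 * (1 + r)"
    using tn n \<open>r \<ge> 0\<close> by (intro mult_right_mono) auto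
  finally have "r \<le> 1/8" by simp
  moreover have "nrm (F n 1) \<le> nrm (F n 1 \<ominus> F n (of_real t)) + r"
    unfolding r_def using Fin[OF nt] by (intro norm_le_diff) (auto simp: Fin)
  moreover have "nrm (F n 1 \<ominus> F n (of_real t)) \<le> L * norm (1 - complex_of_real t)"
    using FL[of 1 "of_real t" n] nt by simp
  moreover have "norm (1 - complex_of_real t) = 1 - t"
  proof -
    have "1 - complex_of_real t = complex_of_real (1 - t)" by simp
    then show ?thesis using t by (simp only: norm_of_real)
  qed
  ultimately show False
    using big[of n] Lt by simp
qed

end

text \<open>The C*-identity reduces the claim to self-adjoint elements. An increase of the norm
  could be scaled to an element of norm below 1 whose image has norm 1; the quasi-inverses of its
  multiples exist in \<open>M\<close>, and \<open>h\<close> carries them to \<open>N\<close>, where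
  \<open>selfadjoint_resolvent\<close> excludes them.\<close>

lemma star_hom_contractive:
  fixes M :: "('a, 'm) star_alg_scheme" and N :: "('b, 'n) star_alg_scheme"
  assumes "cstar_algebra M nrm" "cstar_algebra N nrm'" and h: "h \<in> star_hom M N"
    and x: "x \<in> carrier M"
  shows "nrm' (h x) \<le> nrm x"
proof -
  interpret M: cstar_algebra M nrm by fact
  interpret N: cstar_algebra N nrm' by fact
  note hD = star_homD[OF h]
  have sa: "nrm' (h a) \<le> nrm a" if a: "a \<in> carrier M" and saa: "star M a = a" for a
  proof (rule ccontr)
    assume "\<not> ?thesis"
    then have gt: "nrm a < nrm' (h a)" by simp
    then have pos: "nrm' (h a) > 0"
      using M.norm_nonneg[OF a] by simp
    \<comment> \<open>The scalar is real, so \<open>h a'\<close> stays self-adjoint while its norm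
      becomes 1.\<close>
    define c where "c = complex_of_real (1 / nrm' (h a))"
    define a' where "a' = c \<odot>\<^bsub>M\<^esub> a"
    have a': "a' \<in> carrier M" "nrm a' < 1"
      using a gt pos by (simp_all add: a'_def c_def M.norm_smult norm_divide)
    have b: "h a' \<in> carrier N" using a' hD by blast
    show False
    proof (rule N.selfadjoint_resolvent[OF b])
      show "star N (h a') = h a'"
        using a saa by (simp add: a'_def M.star_smult c_def flip: hD(5))
      show "nrm' (h a') = 1"
        using a pos by (simp add: a'_def hD c_def N.norm_smult norm_divide)
      fix z :: complex assume z: "norm z \<le> 1"
      have za: "z \<odot>\<^bsub>M\<^esub> a' \<in> carrier M" "nrm (z \<odot>\<^bsub>M\<^esub> a') < 1"
        using a' z mult_left_le_one_le[of "nrm a'" "norm z"] M.norm_nonneg[of a']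
        by (simp_all add: M.norm_smult)
      obtain q where q: "q \<in> carrier M" "q = z \<odot>\<^bsub>M\<^esub> a' \<oplus>\<^bsub>M\<^esub> z \<odot>\<^bsub>M\<^esub> a' \<otimes>\<^bsub>M\<^esub> q"
        "q = z \<odot>\<^bsub>M\<^esub> a' \<oplus>\<^bsub>M\<^esub> q \<otimes>\<^bsub>M\<^esub> (z \<odot>\<^bsub>M\<^esub> a')"
        using M.quasi_inverse_exists[OF za] by blast
      have "h (z \<odot>\<^bsub>M\<^esub> a' \<oplus>\<^bsub>M\<^esub> z \<odot>\<^bsub>M\<^esub> a' \<otimes>\<^bsub>M\<^esub> q) = z \<odot>\<^bsub>N\<^esub> h a' \<oplus>\<^bsub>N\<^esub> z \<odot>\<^bsub>N\<^esub> (h a' \<otimes>\<^bsub>N\<^esub> h q)"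
        using q(1) a' by (simp add: hD M.mult_smult_left)
      moreover have "h (z \<odot>\<^bsub>M\<^esub> a' \<oplus>\<^bsub>M\<^esub> q \<otimes>\<^bsub>M\<^esub> (z \<odot>\<^bsub>M\<^esub> a')) = z \<odot>\<^bsub>N\<^esub> h a' \<oplus>\<^bsub>N\<^esub> z \<odot>\<^bsub>N\<^esub> (h q \<otimes>\<^bsub>N\<^esub> h a')"
        using q(1) a' by (simp add: hD M.mult_smult_right)
      ultimately have "h q = z \<odot>\<^bsub>N\<^esub> h a' \<oplus>\<^bsub>N\<^esub> z \<odot>\<^bsub>N\<^esub> (h a' \<otimes>\<^bsub>N\<^esub> h q) \<and>
          h q = z \<odot>\<^bsub>N\<^esub> h a' \<oplus>\<^bsub>N\<^esub> z \<odot>\<^bsub>N\<^esub> (h q \<otimes>\<^bsub>N\<^esub> h a')"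
        using q(2,3) by metis
      then show "\<exists>q\<in>carrier N. q = z \<odot>\<^bsub>N\<^esub> h a' \<oplus>\<^bsub>N\<^esub> z \<odot>\<^bsub>N\<^esub> (h a' \<otimes>\<^bsub>N\<^esub> q) \<and>
          q = z \<odot>\<^bsub>N\<^esub> h a' \<oplus>\<^bsub>N\<^esub> z \<odot>\<^bsub>N\<^esub> (q \<otimes>\<^bsub>N\<^esub> h a')"
        using hD(1)[OF q(1)] by blast
    qed
  qed
  have xx: "star M x \<otimes>\<^bsub>M\<^esub> x \<in> carrier M"
    using x by (simp add: M.star_closed)
  have "(nrm' (h x))\<^sup>2 = nrm' (h (star M x \<otimes>\<^bsub>M\<^esub> x))"
    using x by (simp add: hD M.star_closed N.cstar_identity)
  also have "\<dots> \<le> nrm (star M x \<otimes>\<^bsub>M\<^esub> x)"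
  proof (rule sa[OF xx])
    show "star M (star M x \<otimes>\<^bsub>M\<^esub> x) = star M x \<otimes>\<^bsub>M\<^esub> x"
      using M.star_mult[OF M.star_closed[OF x] x] M.star_star[OF x] by simp
  qed
  also have "\<dots> = (nrm x)\<^sup>2"
    using x by (rule M.cstar_identity)
  finally show ?thesis
    using M.norm_nonneg[OF x] by (rule power2_le_imp_le)
qed

section \<open>C*-algebras generated by a family of self-adjoint elements\<close>

locale dense_rep = cstar_rep +
  assumes dense: "x \<in> carrier M \<Longrightarrow> \<exists>s. formal_conv M nrm \<phi> s x"

text \<open>The inequality between seminorms carries Cauchy sequences of formal polynomials from
  \<open>M\<close> to \<open>N\<close> and null sequences to null sequences. The extension respects
  the operations because both algebras evaluate the same formal operations on sequences.\<close>

lemma star_hom_extension: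
  fixes M :: "('c, 'm) star_alg_scheme" and N :: "('d, 'n) star_alg_scheme" and \<phi> :: "'a \<Rightarrow> 'c"
  assumes "dense_rep M nrm \<phi>" "cstar_rep N nrm' \<rho>"
    and le: "\<And>w. nrm' (formal_eval N \<rho> w) \<le> nrm (formal_eval M \<phi> w)"
  shows "\<exists>f \<in> star_hom M N. (\<forall>x\<in>carrier M. nrm' (f x) \<le> nrm x) \<and>
    (\<forall>w. f (formal_eval M \<phi> w) = formal_eval N \<rho> w)"
proof -
  interpret M: dense_rep M nrm \<phi> by fact
  interpret N: cstar_rep N nrm' \<rho> by fact
  have lim: "\<exists>y. N.conv s y" if s: "M.conv s x" for s x
  proof (rule N.Cauchy_conv)
    fix e :: real assume "e > 0"
    then obtain k where "\<forall>m\<ge>k. \<forall>n\<ge>k. nrm (M.ev (formal_diff (s m) (s n))) < e"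
      using M.conv_Cauchy[OF s] by blast
    then have "\<forall>m\<ge>k. \<forall>n\<ge>k. nrm' (N.ev (formal_diff (s m) (s n))) < e"
      using le order.strict_trans1 by blast
    then show "\<exists>k. \<forall>m\<ge>k. \<forall>n\<ge>k. nrm' (N.ev (formal_diff (s m) (s n))) < e" ..
  qed
  have uniq: "y = y'" if "M.conv s x" "M.conv t x" "N.conv s y" "N.conv t y'" for s t x y y'
  proof -
    \<comment> \<open>Two sequences with the same limit \<open>x\<close> are compared through their
      formal difference, which converges to \<open>x \<ominus> x\<close> in \<open>M\<close> and to
      the difference of the two candidate values in \<open>N\<close>.\<close>
    have st: "nrm' (y \<ominus>\<^bsub>N\<^esub> y') \<le> nrm (x \<ominus>\<^bsub>M\<^esub> x)"
    proof (rule LIMSEQ_le)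
      have "N.conv (\<lambda>n. s n @ formal_scale (- 1) (t n)) (y \<oplus>\<^bsub>N\<^esub> (- 1) \<odot>\<^bsub>N\<^esub> y')"
        by (intro N.conv_add N.conv_scale that)
      from N.conv_norm[OF this]
      show "(\<lambda>n. nrm' (N.ev (s n @ formal_scale (- 1) (t n)))) \<longlonglongrightarrow> nrm' (y \<ominus>\<^bsub>N\<^esub> y')"
        using that N.conv_in by (simp add: N.diff_smult)
      have "M.conv (\<lambda>n. s n @ formal_scale (- 1) (t n)) (x \<oplus>\<^bsub>M\<^esub> (- 1) \<odot>\<^bsub>M\<^esub> x)"
        by (intro M.conv_add M.conv_scale that)
      from M.conv_norm[OF this]
      show "(\<lambda>n. nrm (M.ev (s n @ formal_scale (- 1) (t n)))) \<longlonglongrightarrow> nrm (x \<ominus>\<^bsub>M\<^esub> x)"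
        using M.conv_in[OF that(1)] by (simp flip: M.diff_smult)
    qed (use le in auto)
    have yy: "y \<in> carrier N" "y' \<in> carrier N" "x \<in> carrier M"
      using that N.conv_in M.conv_in by blast+
    then show ?thesis
      using st N.norm_nonneg[of "y \<ominus>\<^bsub>N\<^esub> y'"] N.norm_diff_eq_0[of y y'] by simp
  qed
  obtain f where f: "\<And>s x. M.conv s x \<Longrightarrow> N.conv s (f x)"
  proof -
    have "\<forall>x. \<exists>y. \<forall>s. M.conv s x \<longrightarrow> N.conv s y"
    proof
      fix x
      show "\<exists>y. \<forall>s. M.conv s x \<longrightarrow> N.conv s y"
      proof (cases "\<exists>s. M.conv s x")
        case True
        then obtain s y where s: "M.conv s x" "N.conv s y"
          using lim by blast
        have "N.conv t y" if t: "M.conv t x" for t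
          using lim[OF t] uniq[OF s(1) t s(2)] by blast
        then show ?thesis by blast
      qed auto
    qed
    then show ?thesis
      using that by metis
  qed
  have f_eq: "f x = y" if "M.conv s x" "N.conv s y" for s x y
    using N.conv_unique[OF f[OF that(1)] that(2)] .
  have "f \<in> star_hom M N"
  proof (rule star_homI)
    fix x assume x: "x \<in> carrier M"
    obtain s where s: "M.conv s x" using M.dense[OF x] by blast
    show "f x \<in> carrier N"
      by (rule N.conv_in[OF f[OF s]])
    show "f (c \<odot>\<^bsub>M\<^esub> x) = c \<odot>\<^bsub>N\<^esub> f x" for c
      by (rule f_eq[OF M.conv_scale[OF s] N.conv_scale[OF f[OF s]]])
    show "f (star M x) = star N (f x)"
      by (rule f_eq[OF M.conv_star[OF s] N.conv_star[OF f[OF s]]])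
  next
    fix x y assume "x \<in> carrier M" "y \<in> carrier M"
    then obtain s t where s: "M.conv s x" and t: "M.conv t y"
      using M.dense by blast
    show "f (x \<oplus>\<^bsub>M\<^esub> y) = f x \<oplus>\<^bsub>N\<^esub> f y"
      by (rule f_eq[OF M.conv_add[OF s t] N.conv_add[OF f[OF s] f[OF t]]])
    show "f (x \<otimes>\<^bsub>M\<^esub> y) = f x \<otimes>\<^bsub>N\<^esub> f y"
      by (rule f_eq[OF M.conv_mult[OF s t] N.conv_mult[OF f[OF s] f[OF t]]])
  qed
  moreover have "nrm' (f x) \<le> nrm x" if x: "x \<in> carrier M" for x
  proof -
    obtain s where s: "M.conv s x" using M.dense[OF x] by blast
    show ?thesis
      by (rule LIMSEQ_le[OF N.conv_norm[OF f[OF s]] M.conv_norm[OF s]]) (use le in auto)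
  qed
  moreover have "f (M.ev w) = N.ev w" for w
    by (rule f_eq[OF M.conv_const N.conv_const])
  ultimately show ?thesis by blast
qed

text \<open>Agreement on generators passes to formal polynomials by algebra and to their limits by
  automatic contractivity. The laws of the connecting maps and the compatibility in
  \<open>universal\<close> all follow from this uniqueness.\<close>

lemma star_hom_eq_on_dense:
  fixes M :: "('c, 'm) star_alg_scheme" and N :: "('d, 'n) star_alg_scheme" and \<phi> :: "'a \<Rightarrow> 'c"
  assumes "dense_rep M nrm \<phi>" "cstar_algebra N nrm'"
    and f: "f \<in> star_hom M N" and g: "g \<in> star_hom M N"
    and eq: "\<And>a. f (\<phi> a) = g (\<phi> a)" and x: "x \<in> carrier M"
  shows "f x = g x"
proof -
  interpret M: dense_rep M nrm \<phi> by fact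
  interpret N: cstar_algebra N nrm' by fact
  obtain s where s: "M.conv s x" using M.dense[OF x] by blast
  have fg: "f x \<in> carrier N" "g x \<in> carrier N"
    using star_homD(1)[OF f x] star_homD(1)[OF g x] .
  note na = M.nonassoc_algebra_axioms N.nonassoc_algebra_axioms
  have "f \<circ> \<phi> = g \<circ> \<phi>" using eq by auto
  moreover have "f (M.ev w) = formal_eval N (f \<circ> \<phi>) w" "g (M.ev w) = formal_eval N (g \<circ> \<phi>) w" for w
    by (rule hom_eval[OF na star_hom_alg_hom], simp_all add: f g)+
  ultimately have ev: "f (M.ev w) = g (M.ev w)" for w
    by simp
  have "nrm' (f x \<ominus>\<^bsub>N\<^esub> g x) \<le> nrm (x \<ominus>\<^bsub>M\<^esub> M.ev (s n)) + nrm (x \<ominus>\<^bsub>M\<^esub> M.ev (s n))" for n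
  proof -
    have "nrm' (f x \<ominus>\<^bsub>N\<^esub> g x) \<le> nrm' (f x \<ominus>\<^bsub>N\<^esub> f (M.ev (s n))) + nrm' (f (M.ev (s n)) \<ominus>\<^bsub>N\<^esub> g x)"
      using fg star_homD(1)[OF f M.eval_in] by (intro N.norm_diff_triangle) auto
    also have "nrm' (f (M.ev (s n)) \<ominus>\<^bsub>N\<^esub> g x) = nrm' (g x \<ominus>\<^bsub>N\<^esub> g (M.ev (s n)))"
      unfolding ev using fg star_homD(1)[OF g M.eval_in] by (intro N.norm_diff_commute) auto
    also have "f x \<ominus>\<^bsub>N\<^esub> f (M.ev (s n)) = f (x \<ominus>\<^bsub>M\<^esub> M.ev (s n))"
      using x by (simp add: alg_hom_diff[OF na star_hom_alg_hom[OF f]])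
    also have "g x \<ominus>\<^bsub>N\<^esub> g (M.ev (s n)) = g (x \<ominus>\<^bsub>M\<^esub> M.ev (s n))"
      using x by (simp add: alg_hom_diff[OF na star_hom_alg_hom[OF g]])
    also have "nrm' (f (x \<ominus>\<^bsub>M\<^esub> M.ev (s n))) + nrm' (g (x \<ominus>\<^bsub>M\<^esub> M.ev (s n)))
        \<le> nrm (x \<ominus>\<^bsub>M\<^esub> M.ev (s n)) + nrm (x \<ominus>\<^bsub>M\<^esub> M.ev (s n))"
      using x star_hom_contractive[OF M.cstar_algebra_axioms assms(2)] f g
      by (intro add_mono) auto
    finally show ?thesis .
  qed
  then have "nrm' (f x \<ominus>\<^bsub>N\<^esub> g x) \<le> 0 + 0"
    by (intro tendsto_lowerbound[OF tendsto_add[OF M.conv_tendsto[OF s] M.conv_tendsto[OF s]]]) auto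
  then show ?thesis
    using fg N.norm_nonneg[of "f x \<ominus>\<^bsub>N\<^esub> g x"] N.norm_diff_eq_0[of "f x" "g x"] by simp
qed

text \<open>
  The carrier consists of chosen sequences of formal polynomials, one for each family of limits, so
  that the generated algebra lives on a fixed type whatever the type of the given algebras is.
\<close>

lemma generated_cstar_algebra:
  fixes D :: "'i \<Rightarrow> ('d, 'n) star_alg_scheme" and \<phi> :: "'i \<Rightarrow> 'a \<Rightarrow> 'd"
  assumes fin: "finite I" and rep: "\<And>i. i \<in> I \<Longrightarrow> cstar_rep (D i) (N i) (\<phi> i)"
  shows "\<exists>(C :: 'a env_factor star_alg) nrm \<rho>. dense_rep C nrm \<rho> \<and>
    (\<forall>w. nrm (formal_eval C \<rho> w) = Max (insert 0 ((\<lambda>i. N i (formal_eval (D i) (\<phi> i) w)) ` I)))"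
proof -
  define conv where "conv i = formal_conv (D i) (N i) (\<phi> i)" for i
  \<comment> \<open>One common sequence for all \<open>i\<close> describes the closure of the
    diagonally generated subalgebra; separate sequences would describe the product of the closures
    instead.\<close>
  define S where "S = {x \<in> extensional I. \<exists>s. \<forall>i\<in>I. conv i s (x i)}"
  define g where "g x = (SOME s. \<forall>i\<in>I. conv i s (x i))" for x
  have g: "conv i (g x) (x i)" if "x \<in> S" "i \<in> I" for x i
  proof -
    have "\<exists>s. \<forall>i\<in>I. conv i s (x i)"
      using that by (auto simp: S_def)
    then have "\<forall>i\<in>I. conv i (g x) (x i)"
      unfolding g_def by (rule someI_ex)
    then show ?thesis using that by blast
  qed
  have SI: "restrict x I \<in> S" if "\<And>i. i \<in> I \<Longrightarrow> conv i s (x i)" for x s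
    using that unfolding S_def by auto
  have uniq: "x = y" if "conv i s x" "conv i s y" "i \<in> I" for i s x y
    using cstar_rep.conv_unique[OF rep[OF that(3)]] that by (simp add: conv_def)
  have in_D: "x \<in> carrier (D i)" if "conv i s x" for i s x
    using that by (simp add: conv_def formal_conv_def)
  define j where "j i s = (THE x. conv i s x)" for i s
  have j_eq: "j i s = x" if "conv i s x" "i \<in> I" for i s x
    unfolding j_def using that uniq by blast
  have j_g: "j i (g x) = x i" if "x \<in> S" "i \<in> I" for x i
    by (rule j_eq[OF g[OF that] that(2)])
  have conv_j: "conv i s (j i s)" if "s \<in> g ` S" "i \<in> I" for i s
    using that g j_g by auto
  define C where "C = \<lparr>carrier = g ` S,
     mult = (\<lambda>s t. g (\<lambda>i\<in>I. j i s \<otimes>\<^bsub>D i\<^esub> j i t)),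
     one = undefined, zero = g (\<lambda>i\<in>I. \<zero>\<^bsub>D i\<^esub>),
     add = (\<lambda>s t. g (\<lambda>i\<in>I. j i s \<oplus>\<^bsub>D i\<^esub> j i t)),
     smult = (\<lambda>c s. g (\<lambda>i\<in>I. c \<odot>\<^bsub>D i\<^esub> j i s)),
     star = (\<lambda>s. g (\<lambda>i\<in>I. star (D i) (j i s)))\<rparr>"
  \<comment> \<open>The inserted 0 provides a norm for the empty family, which yields the seminorm 0
    in \<open>directed_env_rel\<close>. Over a nonempty family it changes nothing, since norms are
    nonnegative.\<close>
  define nrm where "nrm s = Max (insert 0 ((\<lambda>i. N i (j i s)) ` I))" for s
  define \<rho> where "\<rho> a = g (\<lambda>i\<in>I. \<phi> i a)" for a
  note rep' = rep[unfolded cstar_rep_def]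
  have cs: "cstar_algebra (D i) (N i)" and sa: "star_algebra (D i)" and na: "nonassoc_algebra (D i)"
    and ba: "banach_algebra (D i) (N i)" and sr: "star_rep (D i) (\<phi> i)" if "i \<in> I" for i
    using rep'[OF that] by (auto simp: cstar_algebra_def star_algebra_def)
  have carrier_C: "carrier C = g ` S" by (simp add: C_def)
  have c_add: "conv i (\<lambda>n. s n @ t n) (x \<oplus>\<^bsub>D i\<^esub> y)"
    and c_mult: "conv i (\<lambda>n. formal_mult (s n) (t n)) (x \<otimes>\<^bsub>D i\<^esub> y)"
    if "conv i s x" "conv i t y" "i \<in> I" for i s t x y
    using that cstar_rep.conv_add[OF rep] cstar_rep.conv_mult[OF rep] by (auto simp: conv_def)
  have c_scale: "conv i (\<lambda>n. formal_scale c (s n)) (c \<odot>\<^bsub>D i\<^esub> x)"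
    and c_star: "conv i (\<lambda>n. formal_star (s n)) (star (D i) x)"
    if "conv i s x" "i \<in> I" for i s x c
    using that cstar_rep.conv_scale[OF rep] cstar_rep.conv_star[OF rep] by (auto simp: conv_def)
  have add_S: "(\<lambda>i\<in>I. j i s \<oplus>\<^bsub>D i\<^esub> j i t) \<in> S"
    and mult_S: "(\<lambda>i\<in>I. j i s \<otimes>\<^bsub>D i\<^esub> j i t) \<in> S" if "s \<in> g ` S" "t \<in> g ` S" for s t
    by (rule SI, rule c_add[OF conv_j[OF that(1)] conv_j[OF that(2)]], assumption+)
      (rule SI, rule c_mult[OF conv_j[OF that(1)] conv_j[OF that(2)]], assumption+)
  have smult_S: "(\<lambda>i\<in>I. c \<odot>\<^bsub>D i\<^esub> j i s) \<in> S"
    and star_S: "(\<lambda>i\<in>I. star (D i) (j i s)) \<in> S" if "s \<in> g ` S" for s c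
    by (rule SI, rule c_scale[OF conv_j[OF that]], assumption+)
      (rule SI, rule c_star[OF conv_j[OF that]], assumption+)
  have zero_S: "(\<lambda>i\<in>I. \<zero>\<^bsub>D i\<^esub>) \<in> S"
    using cstar_rep.conv_const[OF rep, of _ "[]"] by (intro SI[of "\<lambda>n. []"]) (auto simp: conv_def)
  have gen_S: "(\<lambda>i\<in>I. \<phi> i a) \<in> S" for a
  proof (rule SI[of "\<lambda>n. [(1, [a])]"])
    fix i assume i: "i \<in> I"
    interpret cstar_rep "D i" "N i" "\<phi> i" by (rule rep[OF i])
    show "conv i (\<lambda>n. [(1, [a])]) (\<phi> i a)"
      using conv_const[of "[(1, [a])]"] by (simp add: conv_def)
  qed
  have j_add: "j i (s \<oplus>\<^bsub>C\<^esub> t) = j i s \<oplus>\<^bsub>D i\<^esub> j i t"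
    and j_mult: "j i (s \<otimes>\<^bsub>C\<^esub> t) = j i s \<otimes>\<^bsub>D i\<^esub> j i t"
    if "i \<in> I" "s \<in> carrier C" "t \<in> carrier C" for i s t
    using that add_S mult_S j_g by (simp_all add: C_def)
  have j_smult: "j i (c \<odot>\<^bsub>C\<^esub> s) = c \<odot>\<^bsub>D i\<^esub> j i s"
    and j_star: "j i (star C s) = star (D i) (j i s)" if "i \<in> I" "s \<in> carrier C" for i s c
    using that smult_S star_S j_g by (simp_all add: C_def)
  have j_zero: "j i \<zero>\<^bsub>C\<^esub> = \<zero>\<^bsub>D i\<^esub>" if "i \<in> I" for i
    using that zero_S j_g by (simp add: C_def)
  have j_in: "j i s \<in> carrier (D i)" if "i \<in> I" "s \<in> carrier C" for i s
    using that conv_j in_D carrier_C by blast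
  have j_inj: "s = t" if st: "s \<in> carrier C" "t \<in> carrier C" "\<And>i. i \<in> I \<Longrightarrow> j i s = j i t" for s t
  proof -
    obtain x y where xy: "x \<in> S" "y \<in> S" "s = g x" "t = g y"
      using st carrier_C by auto
    have "x i = y i" if "i \<in> I" for i
      using st(3)[OF that] j_g xy that by simp
    then have "x = y"
      using xy(1,2) by (intro extensionalityI[of x I y]) (auto simp: S_def)
    then show ?thesis using xy by simp
  qed
  have C: "star_algebra C"
  proof (rule star_algebra_jointly_injective[where I = I and D = D and j = j, OF sa])
    show "\<zero>\<^bsub>C\<^esub> \<in> carrier C" using zero_S by (simp add: C_def)
    show "x \<oplus>\<^bsub>C\<^esub> y \<in> carrier C" "x \<otimes>\<^bsub>C\<^esub> y \<in> carrier C" if "x \<in> carrier C" "y \<in> carrier C" for x y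
      using that add_S mult_S by (simp_all add: C_def)
    show "c \<odot>\<^bsub>C\<^esub> x \<in> carrier C" "star C x \<in> carrier C" if "x \<in> carrier C" for c x
      using that smult_S star_S by (simp_all add: C_def)
  qed (use j_add j_mult j_smult j_star j_zero j_in j_inj in blast)+
  interpret C: star_algebra C by (rule C)
  have j_hom: "j i \<in> star_hom C (D i)" if "i \<in> I" for i
    using that by (intro star_homI j_add j_mult j_smult j_star j_in)
  have j_diff: "j i (x \<ominus>\<^bsub>C\<^esub> y) = j i x \<ominus>\<^bsub>D i\<^esub> j i y"
    if "i \<in> I" "x \<in> carrier C" "y \<in> carrier C" for i x y
    using that alg_hom_diff[OF C.nonassoc_algebra_axioms na star_hom_alg_hom[OF j_hom]] by blast
  have le_nrm: "N i (j i x) \<le> nrm x" if "i \<in> I" for i x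
    unfolding nrm_def using fin that by (intro Max_ge) auto
  have nrm_le: "nrm x \<le> c" if "c \<ge> 0" "\<And>i. i \<in> I \<Longrightarrow> N i (j i x) \<le> c" for x c
    unfolding nrm_def using fin that by (subst Max_le_iff) auto
  have nrm_less: "nrm x < c" if "c > 0" "\<And>i. i \<in> I \<Longrightarrow> N i (j i x) < c" for x c
    unfolding nrm_def using fin that by (subst Max_less_iff) auto
  have nrm_nonneg: "nrm x \<ge> 0" for x
    unfolding nrm_def using fin by (intro Max_ge) auto
  have nrm_smult_le: "nrm (c \<odot>\<^bsub>C\<^esub> x) \<le> norm c * nrm x" if "x \<in> carrier C" for c x
    using that
    by (auto intro!: nrm_le mult_nonneg_nonneg nrm_nonneg mult_left_mono le_nrm
        simp: j_smult banach_algebra.norm_smult[OF ba] j_in)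
  have dense: "\<exists>s. (\<forall>i\<in>I. conv i s (j i x))" if "x \<in> carrier C" for x
    using that conv_j by (auto simp: C_def)
  have gen_in: "\<rho> a \<in> carrier C" for a
    using gen_S by (simp add: \<rho>_def C_def)
  have j_gen: "j i (\<rho> a) = \<phi> i a" if "i \<in> I" for i a
    using that gen_S j_g by (simp add: \<rho>_def)
  have j_ev: "j i (formal_eval C \<rho> w) = formal_eval (D i) (\<phi> i) w" if "i \<in> I" for i w
  proof -
    have "j i (formal_eval C \<rho> w) = formal_eval (D i) (j i \<circ> \<rho>) w"
      by (rule hom_eval[OF C.nonassoc_algebra_axioms na[OF that] star_hom_alg_hom[OF j_hom[OF that]]])
        (rule gen_in)
    also have "j i \<circ> \<rho> = \<phi> i"
      using j_gen[OF that] by auto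
    finally show ?thesis .
  qed
  interpret C: star_rep C \<rho>
  proof
    show "\<rho> a \<in> carrier C" for a by (rule gen_in)
    show "star C (\<rho> a) = \<rho> a" for a
      using gen_in star_rep.gen_star[OF sr]
      by (intro j_inj) (auto simp: C.star_closed j_star j_gen)
  qed
  have conv_C: "(\<lambda>n. nrm (x \<ominus>\<^bsub>C\<^esub> formal_eval C \<rho> (s n))) \<longlonglongrightarrow> 0"
    if x: "x \<in> carrier C" and s: "\<And>i. i \<in> I \<Longrightarrow> conv i s (j i x)" for x s
  proof (rule tendstoI)
    fix e :: real assume e: "e > 0"
    have "\<forall>\<^sub>F n in sequentially. N i (j i x \<ominus>\<^bsub>D i\<^esub> formal_eval (D i) (\<phi> i) (s n)) < e" if "i \<in> I" for i
      using s[OF that] e order_tendstoD(2) by (fastforce simp: conv_def formal_conv_def)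
    \<comment> \<open>Finiteness of \<open>I\<close> is what makes the coordinatewise estimates hold
      simultaneously.\<close>
    then have "\<forall>\<^sub>F n in sequentially. \<forall>i\<in>I. N i (j i x \<ominus>\<^bsub>D i\<^esub> formal_eval (D i) (\<phi> i) (s n)) < e"
      using fin by (simp add: eventually_ball_finite)
    then show "\<forall>\<^sub>F n in sequentially. dist (nrm (x \<ominus>\<^bsub>C\<^esub> formal_eval C \<rho> (s n))) 0 < e"
    proof eventually_elim
      case (elim n)
      then have "nrm (x \<ominus>\<^bsub>C\<^esub> formal_eval C \<rho> (s n)) < e"
        using x e by (intro nrm_less) (auto simp: j_diff j_ev)
      then show ?case
        using nrm_nonneg by simp
    qed
  qed
  have "banach_algebra C nrm"
  proof (rule banach_algebraI)
    show "nonassoc_algebra C" ..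
    fix x assume x: "x \<in> carrier C"
    show "0 \<le> nrm x" by (rule nrm_nonneg)
    show "nrm x = 0 \<longleftrightarrow> x = \<zero>\<^bsub>C\<^esub>"
    proof
      assume 0: "nrm x = 0"
      have "j i x = j i \<zero>\<^bsub>C\<^esub>" if "i \<in> I" for i
        using le_nrm[OF that, of x] 0 banach_algebra.norm_nonneg[OF ba[OF that] j_in[OF that x]]
          banach_algebra.norm_eq_0[OF ba[OF that] j_in[OF that x]] by (simp add: j_zero that)
      then show "x = \<zero>\<^bsub>C\<^esub>"
        using x by (intro j_inj) auto
    next
      assume "x = \<zero>\<^bsub>C\<^esub>"
      then have "nrm x \<le> 0"
        using banach_algebra.norm_zero[OF ba] by (intro nrm_le) (auto simp: j_zero)
      then show "nrm x = 0" using nrm_nonneg[of x] by simp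
    qed
    show "nrm (c \<odot>\<^bsub>C\<^esub> x) = norm c * nrm x" for c
    proof (cases "c = 0")
      case True
      then show ?thesis
        using nrm_smult_le[OF x, of c] nrm_nonneg[of "c \<odot>\<^bsub>C\<^esub> x"] by simp
    next
      case False
      \<comment> \<open>The inequality already known for all scalars is applied to
        \<open>inverse c\<close>, which turns it into the reverse one.\<close>
      have "nrm (inverse c \<odot>\<^bsub>C\<^esub> (c \<odot>\<^bsub>C\<^esub> x)) \<le> norm (inverse c) * nrm (c \<odot>\<^bsub>C\<^esub> x)"
        using x by (intro nrm_smult_le) simp
      then have "nrm x \<le> nrm (c \<odot>\<^bsub>C\<^esub> x) / norm c"
        using False x by (simp add: C.smult_smult norm_inverse divide_inverse mult.commute)
      then show ?thesis
        using nrm_smult_le[OF x, of c] False by (simp add: field_simps)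
    qed
  next
    fix x y assume xy: "x \<in> carrier C" "y \<in> carrier C"
    show "nrm (x \<oplus>\<^bsub>C\<^esub> y) \<le> nrm x + nrm y"
    proof (rule nrm_le)
      fix i assume i: "i \<in> I"
      show "N i (j i (x \<oplus>\<^bsub>C\<^esub> y)) \<le> nrm x + nrm y"
        using banach_algebra.norm_add[OF ba[OF i] j_in[OF i xy(1)] j_in[OF i xy(2)]]
          le_nrm[OF i, of x] le_nrm[OF i, of y] j_add[OF i xy] by simp
    qed (simp add: nrm_nonneg)
    show "nrm (x \<otimes>\<^bsub>C\<^esub> y) \<le> nrm x * nrm y"
    proof (rule nrm_le)
      fix i assume i: "i \<in> I"
      have "N i (j i x) * N i (j i y) \<le> nrm x * nrm y"
        using le_nrm[OF i] nrm_nonneg banach_algebra.norm_nonneg[OF ba[OF i] j_in[OF i]] xy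
        by (intro mult_mono) auto
      then show "N i (j i (x \<otimes>\<^bsub>C\<^esub> y)) \<le> nrm x * nrm y"
        using banach_algebra.norm_mult[OF ba[OF i] j_in[OF i xy(1)] j_in[OF i xy(2)]] j_mult[OF i xy] by simp
    qed (simp add: nrm_nonneg)
  next
    fix s :: "nat \<Rightarrow> 'a env_factor"
    assume s: "\<And>n. s n \<in> carrier C"
      and Cau: "\<And>e. e > 0 \<Longrightarrow> \<exists>k. \<forall>m\<ge>k. \<forall>n\<ge>k. nrm (s m \<ominus>\<^bsub>C\<^esub> s n) < e"
    \<comment> \<open>A limit must come with a sequence of formal polynomials in order to be encoded
      in \<open>C\<close>. So each \<open>s n\<close> is replaced by a polynomial within
      \<open>1 / (n + 1)\<close>; this single sequence converges in every \<open>D i\<close>, and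
      its limits form a family in \<open>S\<close>.\<close>
    have "\<exists>w. nrm (s n \<ominus>\<^bsub>C\<^esub> formal_eval C \<rho> w) < inverse (real (Suc n))" for n
    proof -
      obtain t where t: "\<forall>i\<in>I. conv i t (j i (s n))"
        using dense[OF s] by blast
      have "\<forall>\<^sub>F k in sequentially. nrm (s n \<ominus>\<^bsub>C\<^esub> formal_eval C \<rho> (t k)) < inverse (real (Suc n))"
        using conv_C[OF s] t by (intro order_tendstoD(2)) auto
      then show ?thesis
        by (meson eventually_sequentially order_refl)
    qed
    then obtain w where w: "\<And>n. nrm (s n \<ominus>\<^bsub>C\<^esub> formal_eval C \<rho> (w n)) < inverse (real (Suc n))"
      by metis
    have w0: "(\<lambda>n. nrm (s n \<ominus>\<^bsub>C\<^esub> formal_eval C \<rho> (w n))) \<longlonglongrightarrow> 0"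
      by (rule tendsto_sandwich[OF _ _ tendsto_const LIMSEQ_inverse_real_of_nat])
        (intro always_eventually allI nrm_nonneg less_imp_le[OF w])+
    have "\<exists>y. conv i w y" if i: "i \<in> I" for i
    proof -
      interpret Di: cstar_rep "D i" "N i" "\<phi> i" by (rule rep[OF i])
      note [simp] = j_in[OF i s]
      have le: "N i (j i (s m) \<ominus>\<^bsub>D i\<^esub> j i (s n)) \<le> nrm (s m \<ominus>\<^bsub>C\<^esub> s n)" for m n
        using le_nrm[OF i, of "s m \<ominus>\<^bsub>C\<^esub> s n"] s by (simp add: j_diff[OF i])
      have "\<exists>y\<in>carrier (D i). (\<lambda>n. N i (y \<ominus>\<^bsub>D i\<^esub> j i (s n))) \<longlonglongrightarrow> 0"
      proof (rule Di.Cauchy_converges)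
        fix e :: real assume "e > 0"
        then show "\<exists>k. \<forall>m\<ge>k. \<forall>n\<ge>k. N i (j i (s m) \<ominus>\<^bsub>D i\<^esub> j i (s n)) < e"
          using Cau le by (meson order.strict_trans1)
      qed simp
      then obtain y where y: "y \<in> carrier (D i)" "(\<lambda>n. N i (y \<ominus>\<^bsub>D i\<^esub> j i (s n))) \<longlonglongrightarrow> 0"
        by blast
      have "Di.conv w y"
      proof (rule Di.conv_bound[OF y(1)])
        show "N i (y \<ominus>\<^bsub>D i\<^esub> Di.ev (w n))
            \<le> N i (y \<ominus>\<^bsub>D i\<^esub> j i (s n)) + nrm (s n \<ominus>\<^bsub>C\<^esub> formal_eval C \<rho> (w n))" for n
          using Di.norm_diff_triangle[of y "j i (s n)" "Di.ev (w n)"] y(1) s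
            le_nrm[OF i, of "s n \<ominus>\<^bsub>C\<^esub> formal_eval C \<rho> (w n)"]
          by (simp add: j_diff[OF i] j_ev[OF i])
        show "(\<lambda>n. N i (y \<ominus>\<^bsub>D i\<^esub> j i (s n)) + nrm (s n \<ominus>\<^bsub>C\<^esub> formal_eval C \<rho> (w n))) \<longlonglongrightarrow> 0"
          using tendsto_add[OF y(2) w0] by simp
      qed
      then show ?thesis unfolding conv_def by blast
    qed
    then obtain y where y: "\<And>i. i \<in> I \<Longrightarrow> conv i w (y i)"
      by metis
    define x where "x = g (restrict y I)"
    have x: "x \<in> carrier C" "\<And>i. i \<in> I \<Longrightarrow> j i x = y i"
      using SI[OF y] j_g by (auto simp: x_def C_def)
    have xw: "(\<lambda>n. nrm (x \<ominus>\<^bsub>C\<^esub> formal_eval C \<rho> (w n))) \<longlonglongrightarrow> 0"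
      by (rule conv_C[OF x(1)]) (simp add: x(2) y)
    have le: "nrm (x \<ominus>\<^bsub>C\<^esub> s n) \<le> nrm (x \<ominus>\<^bsub>C\<^esub> formal_eval C \<rho> (w n)) + nrm (s n \<ominus>\<^bsub>C\<^esub> formal_eval C \<rho> (w n))" for n
    proof (rule nrm_le)
      fix i assume i: "i \<in> I"
      interpret Di: cstar_rep "D i" "N i" "\<phi> i" by (rule rep[OF i])
      have c: "j i x \<in> carrier (D i)" "j i (s n) \<in> carrier (D i)" "Di.ev (w n) \<in> carrier (D i)"
        using j_in[OF i] x(1) s by auto
      show "N i (j i (x \<ominus>\<^bsub>C\<^esub> s n))
          \<le> nrm (x \<ominus>\<^bsub>C\<^esub> formal_eval C \<rho> (w n)) + nrm (s n \<ominus>\<^bsub>C\<^esub> formal_eval C \<rho> (w n))"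
        using Di.norm_diff_triangle[OF c(1,3,2)] Di.norm_diff_commute[OF c(2,3)]
          le_nrm[OF i, of "x \<ominus>\<^bsub>C\<^esub> formal_eval C \<rho> (w n)"]
          le_nrm[OF i, of "s n \<ominus>\<^bsub>C\<^esub> formal_eval C \<rho> (w n)"] x(1) s
        by (simp add: j_diff[OF i] j_ev[OF i])
    qed (simp add: nrm_nonneg)
    have "(\<lambda>n. nrm (x \<ominus>\<^bsub>C\<^esub> s n)) \<longlonglongrightarrow> 0"
    proof (rule tendsto_sandwich[OF always_eventually always_eventually tendsto_const])
      show "(\<lambda>n. nrm (x \<ominus>\<^bsub>C\<^esub> formal_eval C \<rho> (w n)) + nrm (s n \<ominus>\<^bsub>C\<^esub> formal_eval C \<rho> (w n))) \<longlonglongrightarrow> 0"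
        using tendsto_add[OF xw w0] by simp
    qed (intro allI nrm_nonneg le)+
    then show "\<exists>x\<in>carrier C. (\<lambda>n. nrm (x \<ominus>\<^bsub>C\<^esub> s n)) \<longlonglongrightarrow> 0"
      using x(1) by blast
  qed
  moreover have "nrm (star C x \<otimes>\<^bsub>C\<^esub> x) = (nrm x)\<^sup>2" if x: "x \<in> carrier C" for x
  proof (rule antisym)
    have eq: "N i (j i (star C x \<otimes>\<^bsub>C\<^esub> x)) = (N i (j i x))\<^sup>2" if i: "i \<in> I" for i
      using x cstar_algebra.cstar_identity[OF cs[OF i] j_in[OF i x]]
      by (simp add: j_mult[OF i] j_star[OF i] C.star_closed)
    show "nrm (star C x \<otimes>\<^bsub>C\<^esub> x) \<le> (nrm x)\<^sup>2"
    proof (rule nrm_le)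
      fix i assume i: "i \<in> I"
      show "N i (j i (star C x \<otimes>\<^bsub>C\<^esub> x)) \<le> (nrm x)\<^sup>2"
        unfolding eq[OF i] using le_nrm[OF i] banach_algebra.norm_nonneg[OF ba[OF i] j_in[OF i x]]
        by (intro power_mono)
    qed simp
    \<comment> \<open>A maximum is bounded by bounding its members, so the reverse inequality is
      shown for \<open>nrm x\<close> with a square root on the right.\<close>
    have "nrm x \<le> sqrt (nrm (star C x \<otimes>\<^bsub>C\<^esub> x))"
    proof (rule nrm_le)
      fix i assume i: "i \<in> I"
      show "N i (j i x) \<le> sqrt (nrm (star C x \<otimes>\<^bsub>C\<^esub> x))"
        using le_nrm[OF i, of "star C x \<otimes>\<^bsub>C\<^esub> x"] unfolding eq[OF i] by (rule real_le_rsqrt)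
    qed (simp add: nrm_nonneg)
    then show "(nrm x)\<^sup>2 \<le> nrm (star C x \<otimes>\<^bsub>C\<^esub> x)"
      using power_mono[of "nrm x" _ 2] nrm_nonneg by fastforce
  qed
  ultimately have "cstar_algebra C nrm"
    by (intro cstar_algebraI C) auto
  then have "cstar_rep C nrm \<rho>"
    by (simp add: cstar_rep_def C.star_rep_axioms)
  moreover have "\<exists>s. formal_conv C nrm \<rho> s x" if x: "x \<in> carrier C" for x
    using dense[OF x] conv_C[OF x] x unfolding formal_conv_def by blast
  ultimately have "dense_rep C nrm \<rho>"
    by (simp add: dense_rep_def dense_rep_axioms_def)
  moreover have "nrm (formal_eval C \<rho> w) = Max (insert 0 ((\<lambda>i. N i (formal_eval (D i) (\<phi> i) w)) ` I))" for w
    unfolding nrm_def using j_ev by (simp cong: image_cong)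
  ultimately show ?thesis by blast
qed

section \<open>Projective limits of C*-algebras\<close>

text \<open>Supplies the radius in continuity estimates. The bound \<open>d \<le> 1\<close> allows
  the norm of a nearby point to be replaced by that of the base point plus 1, which is the origin of
  the summand 1 in the factors \<open>D\<close> used below.\<close>

lemma small_factor:
  assumes "D > (0::real)" "e > 0"
  obtains d where "d > 0" "d \<le> 1" "d * D < e"
proof
  have "min 1 (e / (2 * D)) * D \<le> e / (2 * D) * D"
    using assms by (intro mult_right_mono) auto
  also have "\<dots> < e"
    using assms by simp
  finally show "min 1 (e / (2 * D)) * D < e" .
qed (use assms in auto)

lemma topological_algebra_norm_topology:
  fixes M :: "('k::real_normed_field, 'a, 'm) module_scheme" (structure)
  assumes "banach_algebra M nrm"
  shows "topological_algebra M (norm_topology M nrm)"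
  unfolding topological_algebra_def
proof (intro conjI)
  interpret banach_algebra M nrm by fact
  let ?T = "norm_topology M nrm"
  have ball: "openin ?T {y \<in> carrier M. nrm (y \<ominus> x) < e}" "x \<in> {y \<in> carrier M. nrm (y \<ominus> x) < e}"
    if "x \<in> carrier M" "e > 0" for x e
    using that openin_norm_ball[OF that(1)] by auto
  show "continuous_map (prod_topology ?T ?T) ?T (\<lambda>(x, y). x \<oplus> y)"
    unfolding continuous_map_norm_topology
  proof (intro conjI ballI allI impI)
    fix z and e :: real assume "z \<in> topspace (prod_topology ?T ?T)" and e: "e > 0"
    then obtain x y where z: "z = (x, y)" "x \<in> carrier M" "y \<in> carrier M"
      by (cases z) auto
    define V where "V = {u \<in> carrier M. nrm (u \<ominus> x) < e / 2} \<times> {v \<in> carrier M. nrm (v \<ominus> y) < e / 2}"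
    have "openin (prod_topology ?T ?T) V" "z \<in> V"
      using ball[OF z(2), of "e / 2"] ball[OF z(3), of "e / 2"] e z(1)
      unfolding V_def by (auto simp only: openin_prod_Times_iff half_gt_zero_iff)
    moreover have "nrm ((u \<oplus> v) \<ominus> (x \<oplus> y)) < e" if "(u, v) \<in> V" for u v
    proof -
      have uv: "u \<in> carrier M" "v \<in> carrier M" "nrm (u \<ominus> x) < e / 2" "nrm (v \<ominus> y) < e / 2"
        using that by (auto simp: V_def)
      then show ?thesis
        using norm_diff_add[OF uv(1,2) z(2,3)] by linarith
    qed
    ultimately show "\<exists>V. openin (prod_topology ?T ?T) V \<and> z \<in> V \<and>
        (\<forall>y\<in>V. nrm ((case y of (x, y) \<Rightarrow> x \<oplus> y) \<ominus> (case z of (x, y) \<Rightarrow> x \<oplus> y)) < e)"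
      unfolding z(1) by (intro exI[of _ V]) auto
  qed auto
  show "continuous_map (prod_topology euclidean ?T) ?T (\<lambda>(c, x). c \<odot> x)"
    unfolding continuous_map_norm_topology
  proof (intro conjI ballI allI impI)
    fix z :: "'k \<times> 'a" and e :: real assume "z \<in> topspace (prod_topology euclidean ?T)" and e: "e > 0"
    then obtain c x where z: "z = (c, x)" "x \<in> carrier M"
      by (cases z) auto
    have den: "norm c + 1 + nrm x > 0"
      using norm_nonneg[OF z(2)] by (simp add: add_nonneg_pos add_pos_nonneg)
    then obtain d where d: "d > 0" "d \<le> 1" "d * (norm c + 1 + nrm x) < e"
      using small_factor[OF _ e] by blast
    define V where "V = ball c d \<times> {v \<in> carrier M. nrm (v \<ominus> x) < d}"
    have "openin (prod_topology euclidean ?T) V" "z \<in> V"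
      using ball[OF z(2) d(1)] z(1) d(1)
      unfolding V_def by (auto simp only: openin_prod_Times_iff open_openin[symmetric] open_ball) auto
    moreover have "nrm (k \<odot> v \<ominus> c \<odot> x) < e" if "(k, v) \<in> V" for k v
    proof -
      have kv: "v \<in> carrier M" "norm (k - c) < d" "nrm (v \<ominus> x) < d"
        using that by (auto simp: V_def dist_norm norm_minus_commute)
      have "norm k \<le> norm c + 1"
        using norm_triangle_ineq2[of k c] kv(2) d(2) by linarith
      then have "norm k * nrm (v \<ominus> x) + norm (k - c) * nrm x \<le> (norm c + 1) * d + d * nrm x"
        using kv norm_nonneg[of "v \<ominus> x"] norm_nonneg[OF z(2)] z(2) by (intro add_mono mult_mono) auto
      then show ?thesis
        using norm_diff_smult[OF kv(1) z(2), of k c] d(3) by (simp add: algebra_simps)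
    qed
    ultimately show "\<exists>V. openin (prod_topology euclidean ?T) V \<and> z \<in> V \<and>
        (\<forall>y\<in>V. nrm ((case y of (c, x) \<Rightarrow> c \<odot> x) \<ominus> (case z of (c, x) \<Rightarrow> c \<odot> x)) < e)"
      unfolding z(1) by (intro exI[of _ V]) auto
  qed auto
  show "continuous_map (prod_topology ?T ?T) ?T (\<lambda>(x, y). x \<otimes> y)"
    unfolding continuous_map_norm_topology
  proof (intro conjI ballI allI impI)
    fix z and e :: real assume "z \<in> topspace (prod_topology ?T ?T)" and e: "e > 0"
    then obtain x y where z: "z = (x, y)" "x \<in> carrier M" "y \<in> carrier M"
      by (cases z) auto
    have den: "nrm x + 1 + nrm y > 0"
      using norm_nonneg[OF z(2)] norm_nonneg[OF z(3)] by simp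
    then obtain d where d: "d > 0" "d \<le> 1" "d * (nrm x + 1 + nrm y) < e"
      using small_factor[OF _ e] by blast
    define V where "V = {u \<in> carrier M. nrm (u \<ominus> x) < d} \<times> {v \<in> carrier M. nrm (v \<ominus> y) < d}"
    have "openin (prod_topology ?T ?T) V" "z \<in> V"
      using ball[OF z(2) d(1)] ball[OF z(3) d(1)] z(1)
      unfolding V_def by (auto simp only: openin_prod_Times_iff)
    moreover have "nrm (u \<otimes> v \<ominus> x \<otimes> y) < e" if "(u, v) \<in> V" for u v
    proof -
      have uv: "u \<in> carrier M" "v \<in> carrier M" "nrm (u \<ominus> x) < d" "nrm (v \<ominus> y) < d"
        using that by (auto simp: V_def)
      have nv: "nrm v \<le> nrm y + 1"
        using norm_le_diff[OF uv(2) z(3)] uv(4) d(2) by linarith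
      have "nrm (u \<ominus> x) * nrm v + nrm x * nrm (v \<ominus> y) \<le> d * (nrm y + 1) + nrm x * d"
        using nv uv norm_nonneg[OF uv(2)] norm_nonneg[OF z(2)] d
        by (intro add_mono mult_mono mult_left_mono) auto
      then have "nrm (u \<ominus> x) * nrm v + nrm x * nrm (v \<ominus> y) < e"
        using d(3) by (simp add: algebra_simps)
      with norm_diff_mult[OF uv(1,2) z(2,3)] show ?thesis by linarith
    qed
    ultimately show "\<exists>V. openin (prod_topology ?T ?T) V \<and> z \<in> V \<and>
        (\<forall>y\<in>V. nrm ((case y of (x, y) \<Rightarrow> x \<otimes> y) \<ominus> (case z of (x, y) \<Rightarrow> x \<otimes> y)) < e)"
      unfolding z(1) by (intro exI[of _ V]) auto
  qed auto
  show "topspace ?T = carrier M" by simp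
qed

text \<open>Formulated with differences and without linearity, so that it covers the
  conjugate-linear star as well as *-homomorphisms.\<close>

lemma continuous_map_contractive:
  fixes M :: "('k::real_normed_field, 'c, 'm) module_scheme" and N :: "('k, 'd, 'n) module_scheme"
  assumes "banach_algebra M nrm" "banach_algebra N nrm'"
    and h: "\<And>x. x \<in> carrier M \<Longrightarrow> h x \<in> carrier N"
    and le: "\<And>x y. \<lbrakk>x \<in> carrier M; y \<in> carrier M\<rbrakk> \<Longrightarrow> nrm' (h x \<ominus>\<^bsub>N\<^esub> h y) \<le> nrm (x \<ominus>\<^bsub>M\<^esub> y)"
  shows "continuous_map (norm_topology M nrm) (norm_topology N nrm') h"
proof -
  interpret M: banach_algebra M nrm by fact
  interpret N: banach_algebra N nrm' by fact
  show ?thesis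
    unfolding N.continuous_map_norm_topology
  proof (intro conjI ballI allI impI)
    fix x and e :: real assume "x \<in> topspace (norm_topology M nrm)" "e > 0"
    then have x: "x \<in> carrier M" by simp
    show "\<exists>V. openin (norm_topology M nrm) V \<and> x \<in> V \<and> (\<forall>y\<in>V. nrm' (h y \<ominus>\<^bsub>N\<^esub> h x) < e)"
    proof (intro exI[of _ "{y \<in> carrier M. nrm (y \<ominus>\<^bsub>M\<^esub> x) < e}"] conjI ballI)
      show "openin (norm_topology M nrm) {y \<in> carrier M. nrm (y \<ominus>\<^bsub>M\<^esub> x) < e}"
        by (rule M.openin_norm_ball[OF x])
      show "x \<in> {y \<in> carrier M. nrm (y \<ominus>\<^bsub>M\<^esub> x) < e}"
        using x \<open>e > 0\<close> by simp
      fix y assume "y \<in> {y \<in> carrier M. nrm (y \<ominus>\<^bsub>M\<^esub> x) < e}"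
      then show "nrm' (h y \<ominus>\<^bsub>N\<^esub> h x) < e"
        using le[of y x] x by auto
    qed
  qed (use h in auto)
qed

lemma continuous_map_star_hom:
  fixes M :: "('c, 'm) star_alg_scheme" and N :: "('d, 'n) star_alg_scheme"
  assumes M: "cstar_algebra M nrm" and N: "cstar_algebra N nrm'" and h: "h \<in> star_hom M N"
  shows "continuous_map (norm_topology M nrm) (norm_topology N nrm') h"
proof -
  interpret M: cstar_algebra M nrm by fact
  interpret N: cstar_algebra N nrm' by fact
  show ?thesis
  proof (rule continuous_map_contractive)
    show "nrm' (h x \<ominus>\<^bsub>N\<^esub> h y) \<le> nrm (x \<ominus>\<^bsub>M\<^esub> y)" if "x \<in> carrier M" "y \<in> carrier M" for x y
      using star_hom_contractive[OF M N h, of "x \<ominus>\<^bsub>M\<^esub> y"] that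
        alg_hom_diff[OF M.nonassoc_algebra_axioms N.nonassoc_algebra_axioms star_hom_alg_hom[OF h] that]
      by simp
  qed (use star_homD(1)[OF h] M.banach_algebra_axioms N.banach_algebra_axioms in auto)
qed

lemma (in cstar_algebra) continuous_map_star:
  "continuous_map (norm_topology M nrm) (norm_topology M nrm) (star M)"
proof (rule continuous_map_contractive)
  show "nrm (star M x \<ominus> star M y) \<le> nrm (x \<ominus> y)" if "x \<in> carrier M" "y \<in> carrier M" for x y
  proof -
    have "star M x \<ominus> star M y = star M (x \<ominus> y)"
      using that by (simp add: diff_smult star_add star_smult star_closed)
    then show ?thesis
      using that by (simp add: norm_star)
  qed
qed (use star_closed banach_algebra_axioms in auto)

section \<open>Algebra and topology of a projective limit\<close>

lemma star_proj_lim_simps [simp]: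
  shows "carrier (star_proj_lim \<Lambda> r B f) = carrier (proj_lim \<Lambda> r B f)"
    and "x \<oplus>\<^bsub>star_proj_lim \<Lambda> r B f\<^esub> y = (\<lambda>\<alpha>\<in>\<Lambda>. x \<alpha> \<oplus>\<^bsub>B \<alpha>\<^esub> y \<alpha>)"
    and "x \<otimes>\<^bsub>star_proj_lim \<Lambda> r B f\<^esub> y = (\<lambda>\<alpha>\<in>\<Lambda>. x \<alpha> \<otimes>\<^bsub>B \<alpha>\<^esub> y \<alpha>)"
    and "c \<odot>\<^bsub>star_proj_lim \<Lambda> r B f\<^esub> x = (\<lambda>\<alpha>\<in>\<Lambda>. c \<odot>\<^bsub>B \<alpha>\<^esub> x \<alpha>)"
    and "\<zero>\<^bsub>star_proj_lim \<Lambda> r B f\<^esub> = (\<lambda>\<alpha>\<in>\<Lambda>. \<zero>\<^bsub>B \<alpha>\<^esub>)"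
    and "star (star_proj_lim \<Lambda> r B f) x = (\<lambda>\<alpha>\<in>\<Lambda>. star (B \<alpha>) (x \<alpha>))"
  by (simp_all add: star_proj_lim_def proj_lim_def module.defs star_alg.defs)

lemma carrier_proj_lim:
  "carrier (proj_lim \<Lambda> r B f) =
    {x \<in> \<Pi>\<^sub>E \<alpha>\<in>\<Lambda>. carrier (B \<alpha>). \<forall>\<alpha> \<beta>. (\<alpha>, \<beta>) \<in> r \<longrightarrow> f \<alpha> \<beta> (x \<beta>) = x \<alpha>}"
  by (simp add: proj_lim_def)

locale cstar_family =
  fixes \<Lambda> :: "'i set" and r :: "'i rel" and B :: "'i \<Rightarrow> 'b star_alg" and N :: "'i \<Rightarrow> 'b \<Rightarrow> real"
    and f :: "'i \<Rightarrow> 'i \<Rightarrow> 'b \<Rightarrow> 'b"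
  assumes cstar: "\<alpha> \<in> \<Lambda> \<Longrightarrow> cstar_algebra (B \<alpha>) (N \<alpha>)"
    and family: "projective_family star_hom \<Lambda> r B f"
begin

abbreviation "L \<equiv> star_proj_lim \<Lambda> r B f"
abbreviation "TL \<equiv> proj_lim_topology \<Lambda> r B N f"

lemma directed: "directed_set \<Lambda> r"
  using family by (simp add: projective_family_def)

lemma rel_in: "(\<alpha>, \<beta>) \<in> r \<Longrightarrow> \<alpha> \<in> \<Lambda> \<and> \<beta> \<in> \<Lambda>"
  using directed by (auto simp: directed_set_def preorder_on_def)

lemma connecting: "(\<alpha>, \<beta>) \<in> r \<Longrightarrow> f \<alpha> \<beta> \<in> star_hom (B \<beta>) (B \<alpha>)"
  using family by (simp add: projective_family_def)

lemma banach: "\<alpha> \<in> \<Lambda> \<Longrightarrow> banach_algebra (B \<alpha>) (N \<alpha>)"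
  using cstar by (auto simp: cstar_algebra_def)

lemma star_alg: "\<alpha> \<in> \<Lambda> \<Longrightarrow> star_algebra (B \<alpha>)"
  using cstar by (auto simp: cstar_algebra_def)

lemma nonassoc: "\<alpha> \<in> \<Lambda> \<Longrightarrow> nonassoc_algebra (B \<alpha>)"
  using star_alg by (auto simp: star_algebra_def)

lemma L_in: "\<lbrakk>x \<in> carrier L; \<alpha> \<in> \<Lambda>\<rbrakk> \<Longrightarrow> x \<alpha> \<in> carrier (B \<alpha>)"
  by (auto simp: carrier_proj_lim)

lemma L_ext: "x \<in> carrier L \<Longrightarrow> x \<in> extensional \<Lambda>"
  by (auto simp: carrier_proj_lim PiE_def)

lemma L_compatible: "\<lbrakk>x \<in> carrier L; (\<alpha>, \<beta>) \<in> r\<rbrakk> \<Longrightarrow> f \<alpha> \<beta> (x \<beta>) = x \<alpha>"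
  by (auto simp: carrier_proj_lim)

lemma L_I:
  assumes "\<And>\<alpha>. \<alpha> \<in> \<Lambda> \<Longrightarrow> x \<alpha> \<in> carrier (B \<alpha>)" "\<And>\<alpha> \<beta>. (\<alpha>, \<beta>) \<in> r \<Longrightarrow> f \<alpha> \<beta> (x \<beta>) = x \<alpha>"
  shows "restrict x \<Lambda> \<in> carrier L"
  using assms rel_in by (auto simp: carrier_proj_lim)

lemma L_eqI:
  assumes "x \<in> carrier L" "y \<in> carrier L" "\<And>\<alpha>. \<alpha> \<in> \<Lambda> \<Longrightarrow> x \<alpha> = y \<alpha>"
  shows "x = y"
  using L_ext[OF assms(1)] L_ext[OF assms(2)] assms(3) by (rule extensionalityI)

lemma L_closed:
  shows "\<zero>\<^bsub>L\<^esub> \<in> carrier L"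
    and "\<lbrakk>x \<in> carrier L; y \<in> carrier L\<rbrakk> \<Longrightarrow> x \<oplus>\<^bsub>L\<^esub> y \<in> carrier L"
    and "\<lbrakk>x \<in> carrier L; y \<in> carrier L\<rbrakk> \<Longrightarrow> x \<otimes>\<^bsub>L\<^esub> y \<in> carrier L"
    and "x \<in> carrier L \<Longrightarrow> c \<odot>\<^bsub>L\<^esub> x \<in> carrier L"
    and "x \<in> carrier L \<Longrightarrow> star L x \<in> carrier L"
proof -
  note hom = star_homD[OF connecting]
  have z: "\<zero>\<^bsub>B \<alpha>\<^esub> \<in> carrier (B \<alpha>)"
    and p: "\<lbrakk>u \<in> carrier (B \<alpha>); v \<in> carrier (B \<alpha>)\<rbrakk> \<Longrightarrow> u \<oplus>\<^bsub>B \<alpha>\<^esub> v \<in> carrier (B \<alpha>)"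
    and m: "\<lbrakk>u \<in> carrier (B \<alpha>); v \<in> carrier (B \<alpha>)\<rbrakk> \<Longrightarrow> u \<otimes>\<^bsub>B \<alpha>\<^esub> v \<in> carrier (B \<alpha>)"
    and s: "u \<in> carrier (B \<alpha>) \<Longrightarrow> c \<odot>\<^bsub>B \<alpha>\<^esub> u \<in> carrier (B \<alpha>)"
    if "\<alpha> \<in> \<Lambda>" for \<alpha> u v
  proof -
    interpret nonassoc_algebra "B \<alpha>" by (rule nonassoc[OF that])
    show "\<zero>\<^bsub>B \<alpha>\<^esub> \<in> carrier (B \<alpha>)"
      "\<lbrakk>u \<in> carrier (B \<alpha>); v \<in> carrier (B \<alpha>)\<rbrakk> \<Longrightarrow> u \<oplus>\<^bsub>B \<alpha>\<^esub> v \<in> carrier (B \<alpha>)"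
      "\<lbrakk>u \<in> carrier (B \<alpha>); v \<in> carrier (B \<alpha>)\<rbrakk> \<Longrightarrow> u \<otimes>\<^bsub>B \<alpha>\<^esub> v \<in> carrier (B \<alpha>)"
      "u \<in> carrier (B \<alpha>) \<Longrightarrow> c \<odot>\<^bsub>B \<alpha>\<^esub> u \<in> carrier (B \<alpha>)"
      by auto
  qed
  show "\<zero>\<^bsub>L\<^esub> \<in> carrier L"
    unfolding star_proj_lim_simps(5)
  proof (rule L_I[OF z])
    fix \<alpha> \<beta> assume \<alpha>\<beta>: "(\<alpha>, \<beta>) \<in> r"
    show "f \<alpha> \<beta> \<zero>\<^bsub>B \<beta>\<^esub> = \<zero>\<^bsub>B \<alpha>\<^esub>"
      using alg_hom_zero[OF nonassoc nonassoc star_hom_alg_hom[OF connecting[OF \<alpha>\<beta>]]] rel_in[OF \<alpha>\<beta>] by blast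
  qed
  show "x \<oplus>\<^bsub>L\<^esub> y \<in> carrier L" if "x \<in> carrier L" "y \<in> carrier L"
    unfolding star_proj_lim_simps(2)
    by (rule L_I) (use that p L_in L_compatible hom rel_in in auto)
  show "x \<otimes>\<^bsub>L\<^esub> y \<in> carrier L" if "x \<in> carrier L" "y \<in> carrier L"
    unfolding star_proj_lim_simps(3)
    by (rule L_I) (use that m L_in L_compatible hom rel_in in auto)
  show "c \<odot>\<^bsub>L\<^esub> x \<in> carrier L" if "x \<in> carrier L"
    unfolding star_proj_lim_simps(4)
    by (rule L_I) (use that s L_in L_compatible hom rel_in in auto)
  show "star L x \<in> carrier L" if "x \<in> carrier L"
    unfolding star_proj_lim_simps(6)
    by (rule L_I) (use that star_algebra.star_closed[OF star_alg] L_in L_compatible hom rel_in in auto)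
qed

text \<open>The coordinates are jointly injective because compatible families are extensional on the
  index set.\<close>

lemma star_algebra_L: "star_algebra L"
  by (rule star_algebra_jointly_injective[where I = \<Lambda> and D = B and j = "\<lambda>\<alpha> x. x \<alpha>"])
    (use star_alg L_in L_eqI L_closed in auto)

lemma projection_hom: "\<alpha> \<in> \<Lambda> \<Longrightarrow> (\<lambda>x. x \<alpha>) \<in> star_hom L (B \<alpha>)"
  by (rule star_homI) (use L_in in auto)

lemma topspace_TL [simp]: "topspace TL = carrier L"
proof -
  have "topspace (norm_topology (B \<alpha>) (N \<alpha>)) = carrier (B \<alpha>)" if "\<alpha> \<in> \<Lambda>" for \<alpha>
    by (rule banach_algebra.topspace_norm_topology[OF banach[OF that]])
  then show ?thesis
    by (auto simp: proj_lim_topology_def carrier_proj_lim cong: PiE_cong)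
qed

lemma continuous_map_projection: "\<alpha> \<in> \<Lambda> \<Longrightarrow> continuous_map TL (norm_topology (B \<alpha>) (N \<alpha>)) (\<lambda>x. x \<alpha>)"
  unfolding proj_lim_topology_def
  by (intro continuous_map_from_subtopology continuous_map_product_projection)

lemma continuous_map_TL:
  assumes "\<And>x. x \<in> topspace X \<Longrightarrow> g x \<in> carrier L"
    and "\<And>\<alpha>. \<alpha> \<in> \<Lambda> \<Longrightarrow> continuous_map X (norm_topology (B \<alpha>) (N \<alpha>)) (\<lambda>x. g x \<alpha>)"
  shows "continuous_map X TL g"
  unfolding proj_lim_topology_def continuous_map_in_subtopology continuous_map_componentwise
  using assms L_ext by auto

lemma Hausdorff_TL: "Hausdorff_space TL"
  unfolding proj_lim_topology_def
  using banach_algebra.Hausdorff_norm_topology[OF banach]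
  by (intro Hausdorff_space_subtopology) (simp add: Hausdorff_space_product_topology)

text \<open>Continuity into the limit is checked coordinatewise, and each coordinate of an operation
  factors through the corresponding projections of its arguments.\<close>

lemma topological_algebra_L: "topological_algebra L TL"
proof -
  have top: "topological_algebra (B \<alpha>) (norm_topology (B \<alpha>) (N \<alpha>))" if "\<alpha> \<in> \<Lambda>" for \<alpha>
    by (rule topological_algebra_norm_topology[OF banach[OF that]])
  have pair: "continuous_map (prod_topology TL TL)
      (prod_topology (norm_topology (B \<alpha>) (N \<alpha>)) (norm_topology (B \<alpha>) (N \<alpha>))) (\<lambda>z. (fst z \<alpha>, snd z \<alpha>))"
    if "\<alpha> \<in> \<Lambda>" for \<alpha>
    using continuous_map_compose[OF continuous_map_fst[of TL TL] continuous_map_projection[OF that]]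
      continuous_map_compose[OF continuous_map_snd[of TL TL] continuous_map_projection[OF that]]
    by (simp add: continuous_map_pairwise o_def)
  have spair: "continuous_map (prod_topology euclidean TL)
      (prod_topology euclidean (norm_topology (B \<alpha>) (N \<alpha>))) (\<lambda>z. (fst z, snd z \<alpha>))"
    if "\<alpha> \<in> \<Lambda>" for \<alpha>
    using continuous_map_fst[of euclidean TL]
      continuous_map_compose[OF continuous_map_snd[of euclidean TL] continuous_map_projection[OF that]]
    by (simp add: continuous_map_pairwise o_def)
  show ?thesis
    unfolding topological_algebra_def
  proof (intro conjI continuous_map_TL)
    fix \<alpha> assume \<alpha>: "\<alpha> \<in> \<Lambda>"
    show "continuous_map (prod_topology TL TL) (norm_topology (B \<alpha>) (N \<alpha>)) (\<lambda>z. (case z of (x, y) \<Rightarrow> x \<oplus>\<^bsub>L\<^esub> y) \<alpha>)"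
      using continuous_map_compose[OF pair[OF \<alpha>], of "norm_topology (B \<alpha>) (N \<alpha>)" "\<lambda>(x, y). x \<oplus>\<^bsub>B \<alpha>\<^esub> y"]
        top[OF \<alpha>] \<alpha> by (simp add: topological_algebra_def o_def case_prod_unfold)
    show "continuous_map (prod_topology TL TL) (norm_topology (B \<alpha>) (N \<alpha>)) (\<lambda>z. (case z of (x, y) \<Rightarrow> x \<otimes>\<^bsub>L\<^esub> y) \<alpha>)"
      using continuous_map_compose[OF pair[OF \<alpha>], of "norm_topology (B \<alpha>) (N \<alpha>)" "\<lambda>(x, y). x \<otimes>\<^bsub>B \<alpha>\<^esub> y"]
        top[OF \<alpha>] \<alpha> by (simp add: topological_algebra_def o_def case_prod_unfold)
    show "continuous_map (prod_topology euclidean TL) (norm_topology (B \<alpha>) (N \<alpha>)) (\<lambda>z. (case z of (c, x) \<Rightarrow> c \<odot>\<^bsub>L\<^esub> x) \<alpha>)"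
      using continuous_map_compose[OF spair[OF \<alpha>], of "norm_topology (B \<alpha>) (N \<alpha>)" "\<lambda>(c, x). c \<odot>\<^bsub>B \<alpha>\<^esub> x"]
        top[OF \<alpha>] \<alpha> by (simp add: topological_algebra_def o_def case_prod_unfold)
  qed (use L_closed(2-4) in \<open>auto simp del: star_proj_lim_simps(2-4)\<close>)
qed

lemma continuous_star_L: "continuous_map TL TL (star L)"
proof (rule continuous_map_TL)
  fix \<alpha> assume \<alpha>: "\<alpha> \<in> \<Lambda>"
  show "continuous_map TL (norm_topology (B \<alpha>) (N \<alpha>)) (\<lambda>x. star L x \<alpha>)"
    using continuous_map_compose[OF continuous_map_projection[OF \<alpha>] cstar_algebra.continuous_map_star[OF cstar[OF \<alpha>]]]
      \<alpha> by (simp add: o_def)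
qed (use L_closed(5) in simp)

lemma lc_star_algebra_L: "lc_star_algebra TYPE('i \<times> 'b) L TL"
  unfolding lc_star_algebra_def
  using star_algebra_L topological_algebra_L continuous_star_L cstar family
  by (intro conjI exI[of _ \<Lambda>] exI[of _ r] exI[of _ B] exI[of _ N] exI[of _ f] exI[of _ "\<lambda>x. x"])
    (auto intro!: star_homI homeomorphic_map_id[THEN iffD2, unfolded id_def])

end

section \<open>LC*-algebras and the determination of homomorphisms by generators\<close>

text \<open>The inverse \<open>k\<close> is exposed because \<open>universal\<close> builds its
  homomorphism into the limit and has to carry it back to the given algebra.\<close>

lemma lc_star_algebraE:
  fixes M :: "'a star_alg"
  assumes "lc_star_algebra TYPE('i \<times> 'b) M T"
  obtains \<Lambda> :: "'i set" and r and B :: "'i \<Rightarrow> 'b star_alg" and N f h k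
  where "cstar_family \<Lambda> r B N f" "h \<in> star_hom M (star_proj_lim \<Lambda> r B f)"
    "homeomorphic_maps T (proj_lim_topology \<Lambda> r B N f) h k"
    "star_algebra M" "topspace T = carrier M"
proof -
  obtain \<Lambda> :: "'i set" and r and B :: "'i \<Rightarrow> 'b star_alg" and N f h where
    "\<forall>\<alpha>\<in>\<Lambda>. cstar_algebra (B \<alpha>) (N \<alpha>)" "projective_family star_hom \<Lambda> r B f"
    "h \<in> star_hom M (star_proj_lim \<Lambda> r B f)" "homeomorphic_map T (proj_lim_topology \<Lambda> r B N f) h"
    "star_algebra M" "topological_algebra M T"
    using assms unfolding lc_star_algebra_def by blast
  moreover from this obtain k where "homeomorphic_maps T (proj_lim_topology \<Lambda> r B N f) h k"
    by (auto simp: homeomorphic_map_maps)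
  ultimately show ?thesis
    using that[of \<Lambda> r B N f h k] by (simp add: cstar_family_def topological_algebra_def)
qed

lemma lc_star_algebra_Hausdorff:
  assumes "lc_star_algebra TYPE('i \<times> 'b) M T"
  shows "Hausdorff_space T"
proof -
  obtain \<Lambda> :: "'i set" and r and B :: "'i \<Rightarrow> 'b star_alg" and N f h k
    where "cstar_family \<Lambda> r B N f" "homeomorphic_maps T (proj_lim_topology \<Lambda> r B N f) h k"
    using lc_star_algebraE[OF assms] by metis
  then show ?thesis
    using cstar_family.Hausdorff_TL homeomorphic_Hausdorff_space homeomorphic_space_def by blast
qed

text \<open>The set where \<open>f\<close> and \<open>g\<close> agree is a *-subalgebra, and it is
  closed because the target is Hausdorff; containing the generators, it contains their hull.\<close>

lemma cont_star_hom_eq_on_generators: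
  assumes M: "star_algebra M" "topspace T = carrier M" and N: "star_algebra N" "Hausdorff_space S"
    and f: "f \<in> cont_star_hom M T N S" and g: "g \<in> cont_star_hom M T N S"
    and gen: "generates_lc_star M T X" and eq: "\<And>x. x \<in> X \<Longrightarrow> f x = g x" and X: "X \<subseteq> carrier M"
    and x: "x \<in> carrier M"
  shows "f x = g x"
proof -
  interpret M: star_algebra M by fact
  interpret N: star_algebra N by fact
  have f': "f \<in> star_hom M N" "continuous_map T S f" and g': "g \<in> star_hom M N" "continuous_map T S g"
    using f g by (auto simp: cont_star_hom_def)
  define E where "E = {x \<in> carrier M. f x = g x}"
  have "closedin T E"
    using closedin_continuous_maps_eq[OF N(2) f'(2) g'(2)] M(2) by (simp add: E_def)
  moreover have "star_subalgebra M E"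
    unfolding star_subalgebra_def E_def
    using star_homD[OF f'(1)] star_homD[OF g'(1)]
      alg_hom_zero[OF M.nonassoc_algebra_axioms N.nonassoc_algebra_axioms star_hom_alg_hom[OF f'(1)]]
      alg_hom_zero[OF M.nonassoc_algebra_axioms N.nonassoc_algebra_axioms star_hom_alg_hom[OF g'(1)]]
    by (auto simp: M.star_closed)
  moreover have "X \<subseteq> E"
    using X eq by (auto simp: E_def)
  ultimately have "(\<lambda>S. star_subalgebra M S \<and> closedin T S) hull X \<subseteq> E"
    by (intro hull_minimal) auto
  then show ?thesis
    using gen x by (auto simp: generates_lc_star_def E_def)
qed


section \<open>Opposite algebras\<close>

text \<open>Star and vector space structure stay the same, so norms and topologies carry over and a
  *-homomorphism into the opposite is the same as an antihomomorphism that respects the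
  star.\<close>

definition opposite :: "'a star_alg \<Rightarrow> 'a star_alg" where
  "opposite M = M\<lparr>mult := \<lambda>x y. y \<otimes>\<^bsub>M\<^esub> x\<rparr>"

lemma opposite_simps [simp]:
  "carrier (opposite M) = carrier M" "x \<otimes>\<^bsub>opposite M\<^esub> y = y \<otimes>\<^bsub>M\<^esub> x"
  "x \<oplus>\<^bsub>opposite M\<^esub> y = x \<oplus>\<^bsub>M\<^esub> y" "c \<odot>\<^bsub>opposite M\<^esub> x = c \<odot>\<^bsub>M\<^esub> x"
  "\<zero>\<^bsub>opposite M\<^esub> = \<zero>\<^bsub>M\<^esub>" "\<one>\<^bsub>opposite M\<^esub> = \<one>\<^bsub>M\<^esub>" "star (opposite M) x = star M x"
  "add (opposite M) = add M"
  by (simp_all add: opposite_def)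

lemma opposite_diff [simp]: "x \<ominus>\<^bsub>opposite M\<^esub> y = x \<ominus>\<^bsub>M\<^esub> y"
  by (simp add: a_minus_def a_inv_def)

lemma norm_topology_opposite [simp]: "norm_topology (opposite M) nrm = norm_topology M nrm"
proof -
  have "norm_dist (opposite M) nrm = norm_dist M nrm"
    by (intro ext) (simp add: norm_dist_def)
  then show ?thesis by (simp add: norm_topology_def)
qed

lemma star_algebra_opposite:
  assumes "star_algebra M"
  shows "star_algebra (opposite M)"
proof -
  interpret star_algebra M by fact
  have "abelian_group (opposite M)"
    using M.abelian_group_axioms by (simp add: abelian_group_def abelian_monoid_def abelian_group_axioms_def)
  then have "Module.module scalars (opposite M)"
    by (intro moduleI cring_scalars) (auto simp: smult_plus smult_add smult_smult)
  then have "nonassoc_algebra (opposite M)"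
    by (intro nonassoc_algebra.intro nonassoc_algebra_axioms.intro)
      (auto simp: mult_add_left mult_add_right mult_smult_left mult_smult_right)
  then show ?thesis
    by (intro star_algebra.intro star_algebra_axioms.intro)
      (auto simp: mult_assoc star_closed star_star star_add star_smult star_mult)
qed

lemma cstar_algebra_opposite:
  assumes "cstar_algebra M nrm"
  shows "cstar_algebra (opposite M) nrm"
proof -
  interpret cstar_algebra M nrm by fact
  interpret op: star_algebra "opposite M" by (rule star_algebra_opposite) (rule star_algebra_axioms)
  show ?thesis
  proof (rule cstar_algebraI)
    show "banach_algebra (opposite M) nrm"
    proof (rule banach_algebraI)
      show "nonassoc_algebra (opposite M)" ..
      show "nrm (x \<otimes>\<^bsub>opposite M\<^esub> y) \<le> nrm x * nrm y"
        if "x \<in> carrier (opposite M)" "y \<in> carrier (opposite M)" for x y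
        using norm_mult[of y x] that by (simp add: mult.commute)
      show "\<exists>x\<in>carrier (opposite M). (\<lambda>n. nrm (x \<ominus>\<^bsub>opposite M\<^esub> s n)) \<longlonglongrightarrow> 0"
        if "\<And>n. s n \<in> carrier (opposite M)"
          "\<And>e. e > 0 \<Longrightarrow> \<exists>k. \<forall>m\<ge>k. \<forall>n\<ge>k. nrm (s m \<ominus>\<^bsub>opposite M\<^esub> s n) < e" for s
        using Cauchy_converges[of s] that by simp
    qed (auto simp: norm_nonneg norm_eq_0 norm_add norm_smult)
    \<comment> \<open>In the original product this concerns \<open>x \<otimes> star M x\<close>,
      hence the C*-identity at \<open>star M x\<close> combined with
      \<open>norm_star\<close>.\<close>
    show "nrm (star (opposite M) x \<otimes>\<^bsub>opposite M\<^esub> x) = (nrm x)\<^sup>2" if "x \<in> carrier (opposite M)" for x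
      using cstar_identity[of "star M x"] that by (simp add: star_closed star_star norm_star)
  qed (rule op.star_algebra_axioms)
qed

lemma star_hom_opposite: "star_hom (opposite M) (opposite N) = star_hom M N"
  by (auto simp: star_hom_def alg_hom_def)

text \<open>Only the factors are replaced by their opposites: index set, connecting maps, norms and
  the homeomorphism onto the limit remain.\<close>

lemma lc_star_algebra_opposite:
  assumes "lc_star_algebra TYPE('i \<times> 'b) M T"
  shows "lc_star_algebra TYPE('i \<times> 'b) (opposite M) T"
proof -
  obtain \<Lambda> :: "'i set" and r and B :: "'i \<Rightarrow> 'b star_alg" and N f h where
    B: "\<forall>\<alpha>\<in>\<Lambda>. cstar_algebra (B \<alpha>) (N \<alpha>)" and fam: "projective_family star_hom \<Lambda> r B f" and
    h: "h \<in> star_hom M (star_proj_lim \<Lambda> r B f)" "homeomorphic_map T (proj_lim_topology \<Lambda> r B N f) h"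
    and M: "star_algebra M" "topological_algebra M T" "continuous_map T T (star M)"
    using assms unfolding lc_star_algebra_def by blast
  let ?B = "\<lambda>\<alpha>. opposite (B \<alpha>)"
  have car: "carrier (proj_lim \<Lambda> r ?B f) = carrier (proj_lim \<Lambda> r B f)"
    by (simp add: carrier_proj_lim)
  have "h \<in> star_hom (opposite M) (star_proj_lim \<Lambda> r ?B f)"
    using h(1) by (simp add: star_hom_def alg_hom_def car)
  moreover have "proj_lim_topology \<Lambda> r ?B N f = proj_lim_topology \<Lambda> r B N f"
    by (simp add: proj_lim_topology_def car)
  moreover have "projective_family star_hom \<Lambda> r ?B f"
    using fam by (simp add: projective_family_def star_hom_opposite)
  moreover have "topological_algebra (opposite M) T"
  proof -
    have "continuous_map (prod_topology T T) (prod_topology T T) (\<lambda>z. (snd z, fst z))"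
      by (simp add: continuous_map_pairwise o_def continuous_map_fst continuous_map_snd)
    from continuous_map_compose[OF this, of T "\<lambda>(x, y). x \<otimes>\<^bsub>M\<^esub> y"] show ?thesis
      using M(2) by (simp add: topological_algebra_def o_def case_prod_unfold)
  qed
  moreover have "star (opposite M) = star M"
    by (simp add: opposite_def)
  ultimately show ?thesis
    unfolding lc_star_algebra_def
    using star_algebra_opposite[OF M(1)] M(3) h(2) B cstar_algebra_opposite
    by (intro conjI exI[of _ \<Lambda>] exI[of _ r] exI[of _ ?B] exI[of _ N] exI[of _ f] exI[of _ h]) auto
qed

section \<open>The universal enveloping algebra\<close>

text \<open>The laws are encoded as vanishing on the polynomials that express them: additivity, real
  homogeneity and the symmetrized product. Since formal polynomials use letters from the whole type,
  one clause sends the letters outside the carrier to 0; the last clause is continuity.\<close>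

definition jordan_seminorm :: "(real, 'a) module \<Rightarrow> 'a topology \<Rightarrow> 'a env_index \<Rightarrow> bool" where
  "jordan_seminorm A T p \<longleftrightarrow>
     (\<forall>a\<in>carrier A. \<forall>b\<in>carrier A. p [(1, [a \<oplus>\<^bsub>A\<^esub> b]), (- 1, [a]), (- 1, [b])] = 0) \<and>
     (\<forall>c. \<forall>a\<in>carrier A. p [(1, [c \<odot>\<^bsub>A\<^esub> a]), (- complex_of_real c, [a])] = 0) \<and>
     (\<forall>a\<in>carrier A. \<forall>b\<in>carrier A. p [(1, [a \<otimes>\<^bsub>A\<^esub> b]), (- (1/2), [a, b]), (- (1/2), [b, a])] = 0) \<and>
     (\<forall>a. a \<notin> carrier A \<longrightarrow> p [(1, [a])] = 0) \<and>
     (\<forall>a\<in>carrier A. \<forall>e>0. \<exists>V. openin T V \<and> a \<in> V \<and> (\<forall>b\<in>V. p [(1, [b]), (- 1, [a])] < e))"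

text \<open>Definiteness of the norm turns vanishing on a relation into an equation between
  generators. Hence the seminorm alone decides whether a representation comes from a continuous
  Jordan homomorphism.\<close>

lemma jordan_seminorm_iff:
  fixes M :: "'c star_alg" and \<phi> :: "'a \<Rightarrow> 'c"
  assumes "cstar_rep M nrm \<phi>" and T: "topspace T = carrier A"
  shows "jordan_seminorm A T (\<lambda>w. nrm (formal_eval M \<phi> w)) \<longleftrightarrow>
    (\<forall>a. a \<notin> carrier A \<longrightarrow> \<phi> a = \<zero>\<^bsub>M\<^esub>) \<and>
    \<phi> \<in> cont_jordan_hom A T (sa_part M) (sa_topology M (norm_topology M nrm))"
proof -
  interpret cstar_rep M nrm \<phi> by fact
  have diff2: "formal_eval M \<phi> [(1, u), (- c, v)] = word_eval M \<phi> u \<ominus>\<^bsub>M\<^esub> c \<odot>\<^bsub>M\<^esub> word_eval M \<phi> v" for u v c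
    by (simp add: diff_smult smult_smult)
  have diff3: "formal_eval M \<phi> [(1, u), (- c, v), (- c, w)] =
      word_eval M \<phi> u \<ominus>\<^bsub>M\<^esub> c \<odot>\<^bsub>M\<^esub> (word_eval M \<phi> v \<oplus>\<^bsub>M\<^esub> word_eval M \<phi> w)" for u v w c
    by (simp add: diff_smult smult_smult smult_add)
  have sa: "\<phi> a \<in> carrier (sa_part M)" for a
    by (simp add: sa_part_def gen_star)
  have add: "nrm (formal_eval M \<phi> [(1, [c]), (- 1, [a]), (- 1, [b])]) = 0 \<longleftrightarrow> \<phi> c = \<phi> a \<oplus>\<^bsub>sa_part M\<^esub> \<phi> b" for a b c
    unfolding diff3 by (simp add: norm_diff_eq_0 sa_part_def)
  have mult: "nrm (formal_eval M \<phi> [(1, [c]), (- (1/2), [a, b]), (- (1/2), [b, a])]) = 0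
      \<longleftrightarrow> \<phi> c = \<phi> a \<otimes>\<^bsub>sa_part M\<^esub> \<phi> b" for a b c
    unfolding diff3 by (simp add: norm_diff_eq_0 sa_part_def)
  have smult: "nrm (formal_eval M \<phi> [(1, [b]), (- complex_of_real c, [a])]) = 0
      \<longleftrightarrow> \<phi> b = c \<odot>\<^bsub>sa_part M\<^esub> \<phi> a" for a b c
    unfolding diff2 by (simp add: norm_diff_eq_0 sa_part_def)
  have zero: "nrm (formal_eval M \<phi> [(1, [a])]) = 0 \<longleftrightarrow> \<phi> a = \<zero>\<^bsub>M\<^esub>" for a
    by (simp add: norm_eq_0)
  have diff: "formal_eval M \<phi> [(1, [b]), (- 1, [a])] = \<phi> b \<ominus>\<^bsub>M\<^esub> \<phi> a" for a b
    unfolding diff2 by simp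
  have cont: "continuous_map T (sa_topology M (norm_topology M nrm)) \<phi> \<longleftrightarrow>
    (\<forall>a\<in>carrier A. \<forall>e>0. \<exists>V. openin T V \<and> a \<in> V \<and> (\<forall>b\<in>V. nrm (\<phi> b \<ominus>\<^bsub>M\<^esub> \<phi> a) < e))"
    unfolding sa_topology_def continuous_map_in_subtopology continuous_map_norm_topology T
    using sa by auto
  show ?thesis
    unfolding jordan_seminorm_def cont_jordan_hom_def alg_hom_def mem_Collect_eq add mult smult zero diff cont
    using sa by auto
qed

text \<open>The outer maximum with 0 makes the function literally the norm that
  \<open>generated_cstar_algebra\<close> yields for two algebras.\<close>

lemma jordan_seminorm_max:
  assumes "jordan_seminorm A T p" "jordan_seminorm A T q"
  shows "jordan_seminorm A T (\<lambda>w. max 0 (max (p w) (q w)))"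
  unfolding jordan_seminorm_def
proof (intro conjI ballI allI impI)
  fix a and e :: real assume a: "a \<in> carrier A" and e: "e > 0"
  obtain V where V: "openin T V" "a \<in> V" "\<forall>b\<in>V. p [(1, [b]), (- 1, [a])] < e"
    using assms(1) a e unfolding jordan_seminorm_def by meson
  obtain W where W: "openin T W" "a \<in> W" "\<forall>b\<in>W. q [(1, [b]), (- 1, [a])] < e"
    using assms(2) a e unfolding jordan_seminorm_def by meson
  show "\<exists>V. openin T V \<and> a \<in> V \<and>
      (\<forall>b\<in>V. max 0 (max (p [(1, [b]), (- 1, [a])]) (q [(1, [b]), (- 1, [a])])) < e)"
    using V W e by (intro exI[of _ "V \<inter> W"]) auto
qed (use assms in \<open>simp_all add: jordan_seminorm_def\<close>)

text \<open>The index is the seminorm and not the representation, so the indices form a set on a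
  fixed type.\<close>

definition env_seminorms :: "(real, 'a) module \<Rightarrow> 'a topology \<Rightarrow> 'a env_index set" where
  "env_seminorms A T = {p. jordan_seminorm A T p \<and>
     (\<exists>(C :: 'a env_factor star_alg) nrm \<phi>. dense_rep C nrm \<phi> \<and> (\<forall>w. nrm (formal_eval C \<phi> w) = p w))}"

definition env_rel :: "(real, 'a) module \<Rightarrow> 'a topology \<Rightarrow> 'a env_index rel" where
  "env_rel A T = {(p, q). p \<in> env_seminorms A T \<and> q \<in> env_seminorms A T \<and> (\<forall>w. p w \<le> q w)}"

text \<open>One choice for the whole triple, so that algebra, norm and generators belong together.
  By \<open>star_hom_extension\<close> in both directions, another choice would be isometrically
  isomorphic over the generators.\<close>

definition env_rep :: "'a env_index \<Rightarrow>
    'a env_factor star_alg \<times> ('a env_factor \<Rightarrow> real) \<times> ('a \<Rightarrow> 'a env_factor)" where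
  "env_rep p = (SOME R. dense_rep (fst R) (fst (snd R)) (snd (snd R)) \<and>
     (\<forall>w. fst (snd R) (formal_eval (fst R) (snd (snd R)) w) = p w))"

definition env_factor :: "'a env_index \<Rightarrow> 'a env_factor star_alg" where
  "env_factor p = fst (env_rep p)"

definition env_norm :: "'a env_index \<Rightarrow> 'a env_factor \<Rightarrow> real" where
  "env_norm p = fst (snd (env_rep p))"

definition env_gen :: "'a env_index \<Rightarrow> 'a \<Rightarrow> 'a env_factor" where
  "env_gen p = snd (snd (env_rep p))"

abbreviation env_eval :: "'a env_index \<Rightarrow> 'a formal \<Rightarrow> 'a env_factor" where
  "env_eval p \<equiv> formal_eval (env_factor p) (env_gen p)"

text \<open>The choice is harmless on the carrier: the polynomials are dense there, and
  *-homomorphisms are contractive.\<close>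

definition env_map :: "'a env_index \<Rightarrow> 'a env_index \<Rightarrow> 'a env_factor \<Rightarrow> 'a env_factor" where
  "env_map p q = (SOME g. g \<in> star_hom (env_factor q) (env_factor p) \<and> (\<forall>w. g (env_eval q w) = env_eval p w))"

lemma
  assumes "p \<in> env_seminorms A T"
  shows env_dense_rep: "dense_rep (env_factor p) (env_norm p) (env_gen p)"
    and env_norm_eval: "env_norm p (env_eval p w) = p w"
proof -
  obtain C :: "'a env_factor star_alg" and nrm and \<phi> :: "'a \<Rightarrow> 'a env_factor"
    where "dense_rep C nrm \<phi>" "\<forall>w. nrm (formal_eval C \<phi> w) = p w"
    using assms unfolding env_seminorms_def by blast
  then have "\<exists>R :: 'a env_factor star_alg \<times> ('a env_factor \<Rightarrow> real) \<times> ('a \<Rightarrow> 'a env_factor).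
      dense_rep (fst R) (fst (snd R)) (snd (snd R)) \<and>
      (\<forall>w. fst (snd R) (formal_eval (fst R) (snd (snd R)) w) = p w)"
    by (auto intro!: exI[of _ "(C, nrm, \<phi>)"])
  from someI_ex[OF this, folded env_rep_def]
  show "dense_rep (env_factor p) (env_norm p) (env_gen p)" "env_norm p (env_eval p w) = p w"
    by (simp_all add: env_factor_def env_norm_def env_gen_def)
qed

lemma env_cstar_rep: "p \<in> env_seminorms A T \<Longrightarrow> cstar_rep (env_factor p) (env_norm p) (env_gen p)"
  using env_dense_rep[of p A T] by (simp add: dense_rep_def)

lemma env_cstar_algebra: "p \<in> env_seminorms A T \<Longrightarrow> cstar_algebra (env_factor p) (env_norm p)"
  using env_cstar_rep[of p A T] by (simp add: cstar_rep_def)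

lemma env_map:
  assumes "(p, q) \<in> env_rel A T"
  shows "env_map p q \<in> star_hom (env_factor q) (env_factor p)"
    and "env_map p q (env_eval q w) = env_eval p w"
proof -
  have pq: "p \<in> env_seminorms A T" "q \<in> env_seminorms A T" "\<And>w. p w \<le> q w"
    using assms by (auto simp: env_rel_def)
  have "\<exists>g. g \<in> star_hom (env_factor q) (env_factor p) \<and> (\<forall>w. g (env_eval q w) = env_eval p w)"
    using star_hom_extension[OF env_dense_rep[OF pq(2)] env_cstar_rep[OF pq(1)]] pq(3)
    by (auto simp: env_norm_eval[OF pq(1)] env_norm_eval[OF pq(2)])
  from someI_ex[OF this, folded env_map_def]
  show "env_map p q \<in> star_hom (env_factor q) (env_factor p)" "env_map p q (env_eval q w) = env_eval p w"
    by auto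
qed

lemma env_eval_gen: "p \<in> env_seminorms A T \<Longrightarrow> env_eval p [(1, [a])] = env_gen p a"
proof -
  assume "p \<in> env_seminorms A T"
  then interpret cstar_rep "env_factor p" "env_norm p" "env_gen p" by (rule env_cstar_rep)
  show ?thesis by simp
qed

lemma env_map_gen:
  assumes "(p, q) \<in> env_rel A T"
  shows "env_map p q (env_gen q a) = env_gen p a"
  using env_map(2)[OF assms, of "[(1, [a])]"] assms env_eval_gen[of _ A T] by (auto simp: env_rel_def)

text \<open>The target type \<open>'c\<close> disappears here: a one-point family replaces
  \<open>M\<close> by the subalgebra generated by \<open>\<phi>\<close>, rebuilt on
  \<open>'a env_factor\<close> with the same seminorm.\<close>

lemma in_env_seminormsI:
  fixes M :: "'c star_alg" and \<phi> :: "'a \<Rightarrow> 'c"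
  assumes rep: "cstar_rep M nrm \<phi>" and jordan: "jordan_seminorm A T (\<lambda>w. nrm (formal_eval M \<phi> w))"
  shows "(\<lambda>w. nrm (formal_eval M \<phi> w)) \<in> env_seminorms A T"
proof -
  interpret cstar_rep M nrm \<phi> by fact
  obtain C :: "'a env_factor star_alg" and nrm' \<rho> where "dense_rep C nrm' \<rho>"
    "\<forall>w. nrm' (formal_eval C \<rho> w) = Max (insert 0 ((\<lambda>i. nrm (formal_eval M \<phi> w)) ` {()}))"
    using generated_cstar_algebra[of "{()}" "\<lambda>_. M" "\<lambda>_. nrm" "\<lambda>_. \<phi>"] rep by auto
  then show ?thesis
    using jordan norm_nonneg by (auto simp: env_seminorms_def)
qed


lemma star_hom_comp: "\<lbrakk>f \<in> star_hom M N; g \<in> star_hom N K\<rbrakk> \<Longrightarrow> g \<circ> f \<in> star_hom M K"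
  by (rule star_homI) (simp_all add: star_homD)

lemma star_hom_inverse:
  assumes M: "star_algebra M" and h: "h \<in> star_hom M N"
    and k: "\<And>y. y \<in> carrier N \<Longrightarrow> k y \<in> carrier M" "\<And>y. y \<in> carrier N \<Longrightarrow> h (k y) = y"
      "\<And>x. x \<in> carrier M \<Longrightarrow> k (h x) = x"
  shows "k \<in> star_hom N M"
proof -
  interpret star_algebra M by fact
  note hD = star_homD[OF h]
  show ?thesis
  proof (rule star_homI)
    fix x assume x: "x \<in> carrier N"
    show "k x \<in> carrier M" by (rule k(1)[OF x])
    show "k (c \<odot>\<^bsub>N\<^esub> x) = c \<odot>\<^bsub>M\<^esub> k x" for c
      using hD(3)[of "k x" c] k(3)[of "c \<odot>\<^bsub>M\<^esub> k x"] k(1,2)[OF x] by simp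
    show "k (star N x) = star M (k x)"
      using hD(5)[of "k x"] k(3)[of "star M (k x)"] k(1,2)[OF x] by (simp add: star_closed)
  next
    fix x y assume x: "x \<in> carrier N" and y: "y \<in> carrier N"
    show "k (x \<oplus>\<^bsub>N\<^esub> y) = k x \<oplus>\<^bsub>M\<^esub> k y"
      using hD(2)[of "k x" "k y"] k(3)[of "k x \<oplus>\<^bsub>M\<^esub> k y"] k(1,2)[OF x] k(1,2)[OF y] by simp
    show "k (x \<otimes>\<^bsub>N\<^esub> y) = k x \<otimes>\<^bsub>M\<^esub> k y"
      using hD(4)[of "k x" "k y"] k(3)[of "k x \<otimes>\<^bsub>M\<^esub> k y"] k(1,2)[OF x] k(1,2)[OF y] by simp
  qed
qed

section \<open>The limit over all seminorms and its universal property\<close>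

locale envelope =
  fixes A :: "(real, 'a) module" and T :: "'a topology"
  assumes alg: "nonassoc_algebra A" and T: "topspace T = carrier A"
begin

abbreviation "\<Lambda> \<equiv> env_seminorms A T"

lemma directed_env_rel: "directed_set \<Lambda> (env_rel A T)"
  unfolding directed_set_def
proof (intro conjI ballI)
  \<comment> \<open>The empty family generates the zero algebra, whose seminorm 0 shows that the
    index set is nonempty. Arbitrary values serve over an empty index set; the abbreviations fix the
    types.\<close>
  let ?D = "undefined :: unit \<Rightarrow> 'a env_factor star_alg"
  let ?N = "undefined :: unit \<Rightarrow> 'a env_factor \<Rightarrow> real"
  let ?\<phi> = "undefined :: unit \<Rightarrow> 'a \<Rightarrow> 'a env_factor"
  have "\<exists>(C :: 'a env_factor star_alg) nrm \<rho>. dense_rep C nrm \<rho> \<and>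
      (\<forall>w. nrm (formal_eval C \<rho> w) = Max (insert 0 ((\<lambda>i. ?N i (formal_eval (?D i) (?\<phi> i) w)) ` {})))"
    by (rule generated_cstar_algebra[of "{}" ?D ?N ?\<phi>]) auto
  moreover have "jordan_seminorm A T (\<lambda>_. 0)"
    using T openin_topspace[of T] by (auto simp: jordan_seminorm_def)
  ultimately have "(\<lambda>_. 0) \<in> \<Lambda>"
    by (auto simp: env_seminorms_def)
  then show "\<Lambda> \<noteq> {}" by blast
  show "preorder_on \<Lambda> (env_rel A T)"
    by (auto simp: preorder_on_def env_rel_def refl_on_def trans_def intro: order_trans)
  fix p q assume p: "p \<in> \<Lambda>" and q: "q \<in> \<Lambda>"
  \<comment> \<open>The two algebras are indexed by \<open>bool\<close>; the diagonally generated
    subalgebra of their product has the maximum of \<open>p\<close> and \<open>q\<close> as its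
    seminorm.\<close>
  let ?s = "\<lambda>b. if b then p else q"
  have "\<exists>(C :: 'a env_factor star_alg) nrm \<rho>. dense_rep C nrm \<rho> \<and>
      (\<forall>w. nrm (formal_eval C \<rho> w) = Max (insert 0 ((\<lambda>b. env_norm (?s b) (env_eval (?s b) w)) ` (UNIV :: bool set))))"
    by (rule generated_cstar_algebra[of "UNIV :: bool set" "\<lambda>b. env_factor (?s b)" "\<lambda>b. env_norm (?s b)"
          "\<lambda>b. env_gen (?s b)"]) (use env_cstar_rep[OF p] env_cstar_rep[OF q] in auto)
  moreover have "Max (insert 0 ((\<lambda>b. env_norm (?s b) (env_eval (?s b) w)) ` (UNIV :: bool set))) = max 0 (max (p w) (q w))" for w
    by (simp add: UNIV_bool env_norm_eval[OF p] env_norm_eval[OF q] max.commute max.left_commute)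
  moreover have "jordan_seminorm A T (\<lambda>w. max 0 (max (p w) (q w)))"
    using p q by (intro jordan_seminorm_max) (auto simp: env_seminorms_def)
  ultimately have "(\<lambda>w. max 0 (max (p w) (q w))) \<in> \<Lambda>"
    by (auto simp: env_seminorms_def)
  then show "\<exists>s\<in>\<Lambda>. (p, s) \<in> env_rel A T \<and> (q, s) \<in> env_rel A T"
    using p q by (intro bexI[of _ "\<lambda>w. max 0 (max (p w) (q w))"]) (auto simp: env_rel_def)
qed

text \<open>Both laws compare *-homomorphisms on a factor in which polynomials are dense, and on
  generators both sides agree by \<open>env_map_gen\<close>.\<close>

lemma projective_family_env: "projective_family star_hom \<Lambda> (env_rel A T) env_factor env_map"
  unfolding projective_family_def
proof (intro conjI ballI allI impI)
  show "directed_set \<Lambda> (env_rel A T)" by (rule directed_env_rel)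
  show "env_map p q \<in> star_hom (env_factor q) (env_factor p)" if "(p, q) \<in> env_rel A T" for p q
    by (rule env_map(1)[OF that])
  fix p x assume p: "p \<in> \<Lambda>" and x: "x \<in> carrier (env_factor p)"
  have pp: "(p, p) \<in> env_rel A T" using p by (simp add: env_rel_def)
  have "(\<lambda>x. x) \<in> star_hom (env_factor p) (env_factor p)"
    by (rule star_homI) auto
  from star_hom_eq_on_dense[OF env_dense_rep[OF p] env_cstar_algebra[OF p] env_map(1)[OF pp] this _ x]
  show "env_map p p x = x"
    using env_map_gen[OF pp] by simp
next
  fix p q s x assume pq: "(p, q) \<in> env_rel A T" and qs: "(q, s) \<in> env_rel A T"
    and x: "x \<in> carrier (env_factor s)"
  have ps: "(p, s) \<in> env_rel A T" and p: "p \<in> \<Lambda>" and s: "s \<in> \<Lambda>"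
    using pq qs by (auto simp: env_rel_def intro: order_trans)
  have "(env_map p q \<circ> env_map q s) x = env_map p s x"
    by (rule star_hom_eq_on_dense[OF env_dense_rep[OF s] env_cstar_algebra[OF p]
          star_hom_comp[OF env_map(1)[OF qs] env_map(1)[OF pq]] env_map(1)[OF ps] _ x])
      (simp add: env_map_gen[OF pq] env_map_gen[OF qs] env_map_gen[OF ps])
  then show "env_map p q (env_map q s x) = env_map p s x" by simp
qed

sublocale cstar_family \<Lambda> "env_rel A T" env_factor env_norm env_map
  by (rule cstar_family.intro[OF env_cstar_algebra projective_family_env])

definition \<psi> :: "'a \<Rightarrow> 'a env" where
  "\<psi> a = (\<lambda>p\<in>\<Lambda>. env_gen p a)"

lemma \<psi>_at: "p \<in> \<Lambda> \<Longrightarrow> \<psi> a p = env_gen p a"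
  by (simp add: \<psi>_def)

sublocale psi: star_rep L \<psi>
proof -
  interpret star_algebra L by (rule star_algebra_L)
  show "star_rep L \<psi>"
  proof
    show in_L: "\<psi> a \<in> carrier L" for a
      unfolding \<psi>_def
    proof (rule L_I)
      fix p assume "p \<in> \<Lambda>"
      then interpret cstar_rep "env_factor p" "env_norm p" "env_gen p" by (rule env_cstar_rep)
      show "env_gen p a \<in> carrier (env_factor p)" by simp
    qed (rule env_map_gen)
    show "star L (\<psi> a) = \<psi> a" for a
    proof (rule L_eqI[OF L_closed(5)[OF in_L] in_L])
      fix p assume p: "p \<in> \<Lambda>"
      then interpret cstar_rep "env_factor p" "env_norm p" "env_gen p" by (rule env_cstar_rep)
      show "star L (\<psi> a) p = \<psi> a p"
        using p by (simp add: \<psi>_at gen_star)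
    qed
  qed
qed

lemma eval_\<psi>:
  assumes "p \<in> \<Lambda>"
  shows "formal_eval L \<psi> w p = env_eval p w"
proof -
  have "formal_eval L \<psi> w p = formal_eval (env_factor p) ((\<lambda>x. x p) \<circ> \<psi>) w"
    by (rule hom_eval[OF psi.nonassoc_algebra_axioms nonassoc star_hom_alg_hom[OF projection_hom]])
      (simp_all add: assms psi.gen_in del: star_proj_lim_simps)
  also have "(\<lambda>x. x p) \<circ> \<psi> = env_gen p"
    using assms by (auto simp: \<psi>_at)
  finally show ?thesis .
qed

lemma env_gen_jordan_hom:
  assumes "p \<in> \<Lambda>"
  shows "env_gen p \<in> cont_jordan_hom A T (sa_part (env_factor p))
      (sa_topology (env_factor p) (norm_topology (env_factor p) (env_norm p)))"
    and "a \<notin> carrier A \<Longrightarrow> env_gen p a = \<zero>\<^bsub>env_factor p\<^esub>"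
proof -
  have "jordan_seminorm A T (\<lambda>w. env_norm p (env_eval p w))"
    using assms by (simp add: env_norm_eval[OF assms] env_seminorms_def)
  then show "env_gen p \<in> cont_jordan_hom A T (sa_part (env_factor p))
      (sa_topology (env_factor p) (norm_topology (env_factor p) (env_norm p)))"
    "a \<notin> carrier A \<Longrightarrow> env_gen p a = \<zero>\<^bsub>env_factor p\<^esub>"
    using jordan_seminorm_iff[OF env_cstar_rep[OF assms] T] by auto
qed

lemma \<psi>_jordan_hom: "\<psi> \<in> cont_jordan_hom A T (sa_part L) (sa_topology L TL)"
proof -
  interpret A: nonassoc_algebra A by (rule alg)
  have sa: "\<psi> a \<in> carrier (sa_part L)" for a
    using psi.gen_in psi.gen_star by (simp add: sa_part_def)
  have gen: "env_gen p \<in> alg_hom A (sa_part (env_factor p))" if "p \<in> \<Lambda>" for p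
    using env_gen_jordan_hom(1)[OF that] by (simp add: cont_jordan_hom_def)
  have "\<psi> \<in> alg_hom A (sa_part L)"
    unfolding alg_hom_def
    using sa alg_homD(2-4)[OF gen]
    by (auto simp: sa_part_def \<psi>_def intro!: restrict_ext)
  moreover have "continuous_map T TL \<psi>"
  proof (rule continuous_map_TL)
    fix p assume p: "p \<in> \<Lambda>"
    have "continuous_map T (norm_topology (env_factor p) (env_norm p)) (env_gen p)"
      using env_gen_jordan_hom(1)[OF p]
      by (simp add: cont_jordan_hom_def sa_topology_def continuous_map_in_subtopology)
    then show "continuous_map T (norm_topology (env_factor p) (env_norm p)) (\<lambda>a. \<psi> a p)"
      using p by (simp add: \<psi>_at)
  qed (rule psi.gen_in)
  ultimately show ?thesis
    using sa by (simp add: cont_jordan_hom_def sa_topology_def continuous_map_in_subtopology)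
qed

lemma finite_upper_bound:
  assumes "finite K" "K \<subseteq> \<Lambda>"
  shows "\<exists>q\<in>\<Lambda>. \<forall>p\<in>K. (p, q) \<in> env_rel A T"
  using assms
proof (induction K)
  case empty
  then show ?case using directed_env_rel by (auto simp: directed_set_def)
next
  case (insert p K)
  then obtain q where q: "q \<in> \<Lambda>" "\<forall>p\<in>K. (p, q) \<in> env_rel A T" by auto
  obtain s where s: "s \<in> \<Lambda>" "(p, s) \<in> env_rel A T" "(q, s) \<in> env_rel A T"
    using directed_env_rel insert.prems q(1) unfolding directed_set_def by blast
  have "(p', s) \<in> env_rel A T" if "p' \<in> K" for p'
    using q(2) s(3) that by (fastforce simp: env_rel_def intro: order_trans)
  with s show ?case by blast
qed

text \<open>A basic neighbourhood restricts a finite set \<open>K\<close> of coordinates. Some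
  \<open>q\<close> dominates all of them, a polynomial approximates \<open>x\<close> at
  \<open>q\<close>, and the contractive connecting maps pass the approximation down to each
  coordinate in \<open>K\<close>.\<close>

lemma eval_in_closure:
  assumes x: "x \<in> carrier L" and W: "openin TL W" "x \<in> W"
  shows "\<exists>w. formal_eval L \<psi> w \<in> W"
proof -
  let ?X = "\<lambda>p. norm_topology (env_factor p) (env_norm p)"
  obtain W' where W': "openin (product_topology ?X \<Lambda>) W'" "W = W' \<inter> carrier L"
    using W(1) by (auto simp: proj_lim_topology_def openin_subtopology)
  then obtain Q where Q: "finite {p \<in> \<Lambda>. Q p \<noteq> topspace (?X p)}" "\<And>p. p \<in> \<Lambda> \<Longrightarrow> openin (?X p) (Q p)"
    "x \<in> Pi\<^sub>E \<Lambda> Q" "Pi\<^sub>E \<Lambda> Q \<subseteq> W'"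
    using W(2) unfolding openin_product_topology_alt by (auto 0 3)
  define K where "K = {p \<in> \<Lambda>. Q p \<noteq> topspace (?X p)}"
  have "\<exists>e>0. \<forall>y\<in>carrier (env_factor p). env_norm p (y \<ominus>\<^bsub>env_factor p\<^esub> x p) < e \<longrightarrow> y \<in> Q p" if p: "p \<in> K" for p
    using p Q(2,3) by (intro banach_algebra.openin_norm_topologyD[OF banach]) (auto simp: K_def)
  then obtain e where e: "\<And>p. p \<in> K \<Longrightarrow> e p > 0"
    "\<And>p y. \<lbrakk>p \<in> K; y \<in> carrier (env_factor p); env_norm p (y \<ominus>\<^bsub>env_factor p\<^esub> x p) < e p\<rbrakk> \<Longrightarrow> y \<in> Q p"
    by metis
  \<comment> \<open>The inserted 1 keeps the minimum defined when no coordinate is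
    restricted.\<close>
  define d where "d = Min (insert 1 (e ` K))"
  have K: "finite K" "K \<subseteq> \<Lambda>" using Q(1) by (auto simp: K_def)
  have d: "d > 0" "\<And>p. p \<in> K \<Longrightarrow> d \<le> e p"
    using K e(1) by (auto simp: d_def)
  obtain q where q: "q \<in> \<Lambda>" "\<And>p. p \<in> K \<Longrightarrow> (p, q) \<in> env_rel A T"
    using finite_upper_bound[OF K] by blast
  interpret q: dense_rep "env_factor q" "env_norm q" "env_gen q" by (rule env_dense_rep[OF q(1)])
  note xq = L_in[OF x q(1)]
  obtain s where s: "q.conv s (x q)"
    using q.dense[OF xq] by blast
  have "\<forall>\<^sub>F n in sequentially. env_norm q (x q \<ominus>\<^bsub>env_factor q\<^esub> env_eval q (s n)) < d"
    using order_tendstoD(2)[OF q.conv_tendsto[OF s] d(1)] .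
  then obtain w where w: "env_norm q (x q \<ominus>\<^bsub>env_factor q\<^esub> env_eval q w) < d"
    by (meson eventually_sequentially order_refl)
  define y where "y = formal_eval L \<psi> w"
  have y: "y \<in> carrier L" unfolding y_def by (rule psi.eval_in)
  have "y p \<in> Q p" if p: "p \<in> \<Lambda>" for p
  proof (cases "p \<in> K")
    case True
    interpret p: cstar_algebra "env_factor p" "env_norm p" by (rule env_cstar_algebra[OF p])
    note pq = q(2)[OF True]
    note yq = L_in[OF y q(1)]
    have "env_norm p (y p \<ominus>\<^bsub>env_factor p\<^esub> x p) = env_norm p (env_map p q (y q \<ominus>\<^bsub>env_factor q\<^esub> x q))"
      unfolding alg_hom_diff[OF q.nonassoc_algebra_axioms p.nonassoc_algebra_axioms star_hom_alg_hom[OF env_map(1)[OF pq]] yq xq]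
      using L_compatible[OF y pq] L_compatible[OF x pq] by simp
    also have "\<dots> \<le> env_norm q (y q \<ominus>\<^bsub>env_factor q\<^esub> x q)"
      by (rule star_hom_contractive[OF q.cstar_algebra_axioms p.cstar_algebra_axioms env_map(1)[OF pq] q.diff_in[OF yq xq]])
    also have "\<dots> < e p"
      using w d(2)[OF True] q.norm_diff_commute[OF xq yq] by (simp add: y_def eval_\<psi>[OF q(1)])
    finally show ?thesis
      using e(2)[OF True L_in[OF y p]] by simp
  next
    case False
    then show ?thesis
      using p L_in[OF y p] banach_algebra.topspace_norm_topology[OF banach[OF p]] by (auto simp: K_def)
  qed
  then have "y \<in> Pi\<^sub>E \<Lambda> Q"
    using L_ext[OF y] by (auto simp: PiE_iff)
  then show ?thesis
    using y Q(4) W'(2) by (auto simp: y_def)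
qed

lemma generates: "generates_lc_star L TL (\<psi> ` carrier A)"
  unfolding generates_lc_star_def
proof (rule antisym)
  have "star_subalgebra L (carrier L)"
    unfolding star_subalgebra_def using L_closed by (simp del: star_proj_lim_simps)
  moreover have "closedin TL (carrier L)"
    using closedin_topspace[of TL] by (simp only: topspace_TL)
  moreover have "\<psi> ` carrier A \<subseteq> carrier L"
    using psi.gen_in by blast
  ultimately show "(\<lambda>S. star_subalgebra L S \<and> closedin TL S) hull (\<psi> ` carrier A) \<subseteq> carrier L"
    by (intro hull_minimal) auto
  show "carrier L \<subseteq> (\<lambda>S. star_subalgebra L S \<and> closedin TL S) hull (\<psi> ` carrier A)"
    unfolding hull_def
  proof (intro Inter_greatest)
    fix S assume "S \<in> {S. (star_subalgebra L S \<and> closedin TL S) \<and> \<psi> ` carrier A \<subseteq> S}"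
    then have sub: "star_subalgebra L S" and cl: "closedin TL S" and gen: "\<psi> ` carrier A \<subseteq> S"
      by auto
    have zero: "\<zero>\<^bsub>L\<^esub> \<in> S" and add: "\<And>x y. \<lbrakk>x \<in> S; y \<in> S\<rbrakk> \<Longrightarrow> x \<oplus>\<^bsub>L\<^esub> y \<in> S"
      and mult: "\<And>x y. \<lbrakk>x \<in> S; y \<in> S\<rbrakk> \<Longrightarrow> x \<otimes>\<^bsub>L\<^esub> y \<in> S" and smult: "\<And>c x. x \<in> S \<Longrightarrow> c \<odot>\<^bsub>L\<^esub> x \<in> S"
      using sub unfolding star_subalgebra_def by blast+
    \<comment> \<open>A formal polynomial may contain letters outside the carrier of
      \<open>A\<close>, whose images are not among the given generators; they evaluate to 0, which
      lies in every *-subalgebra.\<close>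
    have \<psi>: "\<psi> a \<in> S" for a
    proof (cases "a \<in> carrier A")
      case False
      then have "\<psi> a = \<zero>\<^bsub>L\<^esub>"
        using env_gen_jordan_hom(2) by (auto simp: \<psi>_def intro!: restrict_ext)
      then show ?thesis using zero by simp
    qed (use gen in blast)
    have word: "word_eval L \<psi> u \<in> S" for u
    proof (induction u rule: induct_list012)
      case (3 a b u)
      then show ?case unfolding word_eval.simps(3) by (intro mult \<psi>)
    qed (simp_all only: word_eval.simps zero \<psi>)
    have eval: "formal_eval L \<psi> w \<in> S" for w
    proof (induction w)
      case (Cons m w)
      then show ?case unfolding formal_eval.simps(2) by (intro add smult word)
    qed (simp only: formal_eval.simps zero)
    show "carrier L \<subseteq> S"
    proof
      fix x assume x: "x \<in> carrier L"
      have "\<exists>y. y \<in> S \<and> y \<in> W" if "x \<in> W" "openin TL W" for W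
        using eval_in_closure[OF x that(2,1)] eval by blast
      then have "x \<in> TL closure_of S"
        using x unfolding in_closure_of topspace_TL by blast
      then show "x \<in> S"
        using cl closure_of_closedin by blast
    qed
  qed
qed

text \<open>After presenting \<open>C\<close> as a limit, \<open>\<phi>\<close> induces a seminorm
  \<open>p i\<close> at each index \<open>i\<close>. Coordinate \<open>i\<close> of the required map
  reads its argument at the single coordinate \<open>p i\<close>; contractivity makes
  \<open>p\<close> monotone, so compatible families go to compatible families.\<close>

lemma universal:
  fixes C :: "'c star_alg"
  assumes lc: "lc_star_algebra TYPE('i \<times> 'b) C TC"
    and \<phi>: "\<phi> \<in> cont_jordan_hom A T (sa_part C) (sa_topology C TC)"
  shows "\<exists>\<phi>' \<in> cont_star_hom L TL C TC. \<forall>a\<in>carrier A. \<phi> a = \<phi>' (\<psi> a)"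
proof -
  interpret A: nonassoc_algebra A by (rule alg)
  obtain \<Lambda>' :: "'i set" and r' and B' :: "'i \<Rightarrow> 'b star_alg" and N' f' h k
    where fam: "cstar_family \<Lambda>' r' B' N' f'" and h: "h \<in> star_hom C (star_proj_lim \<Lambda>' r' B' f')"
    and hk: "homeomorphic_maps TC (proj_lim_topology \<Lambda>' r' B' N' f') h k"
    and C: "star_algebra C" "topspace TC = carrier C"
    using lc_star_algebraE[OF lc] by metis
  interpret F: cstar_family \<Lambda>' r' B' N' f' by (rule fam)
  interpret C: star_algebra C by (rule C)
  note hD = star_homD[OF h]
  have cont_h: "continuous_map TC F.TL h" and cont_k: "continuous_map F.TL TC k"
    and kh: "\<And>x. x \<in> carrier C \<Longrightarrow> k (h x) = x" and hk: "\<And>y. y \<in> carrier F.L \<Longrightarrow> h (k y) = y"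
    using hk C(2) by (simp_all add: homeomorphic_maps_def)
  have k_in: "k y \<in> carrier C" if "y \<in> carrier F.L" for y
    using continuous_map_image_subset_topspace[OF cont_k] that C(2) by auto
  have \<phi>_hom: "\<phi> \<in> alg_hom A (sa_part C)" and \<phi>_cont: "continuous_map T TC \<phi>"
    using \<phi> by (auto simp: cont_jordan_hom_def sa_topology_def continuous_map_in_subtopology)
  \<comment> \<open>A Jordan homomorphism is unconstrained off its carrier, whereas the seminorms in
    the index set require the value 0 there.\<close>
  define \<phi>0 where "\<phi>0 a = (if a \<in> carrier A then \<phi> a else \<zero>\<^bsub>C\<^esub>)" for a
  have \<phi>0_in: "\<phi>0 a \<in> carrier C" and \<phi>0_star: "star C (\<phi>0 a) = \<phi>0 a" for a
    using alg_homD(1)[OF \<phi>_hom, of a] by (auto simp: \<phi>0_def sa_part_def)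
  define \<rho> where "\<rho> i a = h (\<phi>0 a) i" for i a
  have h_zero: "h \<zero>\<^bsub>C\<^esub> = \<zero>\<^bsub>F.L\<^esub>"
    using F.star_algebra_L
    by (intro alg_hom_zero C.nonassoc_algebra_axioms star_hom_alg_hom h) (simp add: star_algebra_def)
  have rep: "cstar_rep (B' i) (N' i) (\<rho> i)" if i: "i \<in> \<Lambda>'" for i
  proof -
    interpret Bi: cstar_algebra "B' i" "N' i" by (rule F.cstar[OF i])
    show ?thesis
    proof
      show "\<rho> i a \<in> carrier (B' i)" for a
        unfolding \<rho>_def by (rule F.L_in[OF hD(1)[OF \<phi>0_in] i])
      show "star (B' i) (\<rho> i a) = \<rho> i a" for a
      proof -
        have "star (B' i) (\<rho> i a) = star F.L (h (\<phi>0 a)) i"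
          using i by (simp add: \<rho>_def)
        also have "star F.L (h (\<phi>0 a)) = h (\<phi>0 a)"
          unfolding hD(5)[OF \<phi>0_in, symmetric] \<phi>0_star ..
        finally show ?thesis by (simp add: \<rho>_def)
      qed
    qed
  qed
  define p where "p i = (\<lambda>w. N' i (formal_eval (B' i) (\<rho> i) w))" for i
  have p: "p i \<in> \<Lambda>" if i: "i \<in> \<Lambda>'" for i
    unfolding p_def
  proof (rule in_env_seminormsI[OF rep[OF i]])
    interpret Bi: cstar_rep "B' i" "N' i" "\<rho> i" by (rule rep[OF i])
    have "\<rho> i a = \<zero>\<^bsub>B' i\<^esub>" if "a \<notin> carrier A" for a
      using that i by (simp add: \<rho>_def \<phi>0_def h_zero)
    moreover have "\<rho> i \<in> alg_hom A (sa_part (B' i))"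
    proof -
      have \<phi>D: "\<phi> a \<in> carrier C" "\<phi> (a \<oplus>\<^bsub>A\<^esub> b) = \<phi> a \<oplus>\<^bsub>C\<^esub> \<phi> b" "\<phi> (c \<odot>\<^bsub>A\<^esub> a) = complex_of_real c \<odot>\<^bsub>C\<^esub> \<phi> a"
        "\<phi> (a \<otimes>\<^bsub>A\<^esub> b) = (1/2) \<odot>\<^bsub>C\<^esub> ((\<phi> a \<otimes>\<^bsub>C\<^esub> \<phi> b) \<oplus>\<^bsub>C\<^esub> (\<phi> b \<otimes>\<^bsub>C\<^esub> \<phi> a))"
        if "a \<in> carrier A" "b \<in> carrier A" for a b c
        using alg_homD[OF \<phi>_hom, of a] alg_homD[OF \<phi>_hom, of b] that by (simp_all add: sa_part_def)
      have "\<rho> i (a \<oplus>\<^bsub>A\<^esub> b) = \<rho> i a \<oplus>\<^bsub>B' i\<^esub> \<rho> i b"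
        "\<rho> i (c \<odot>\<^bsub>A\<^esub> a) = complex_of_real c \<odot>\<^bsub>B' i\<^esub> \<rho> i a"
        "\<rho> i (a \<otimes>\<^bsub>A\<^esub> b) = (1/2) \<odot>\<^bsub>B' i\<^esub> ((\<rho> i a \<otimes>\<^bsub>B' i\<^esub> \<rho> i b) \<oplus>\<^bsub>B' i\<^esub> (\<rho> i b \<otimes>\<^bsub>B' i\<^esub> \<rho> i a))"
        if "a \<in> carrier A" "b \<in> carrier A" for a b c
        using that i by (simp_all add: \<rho>_def \<phi>0_def \<phi>D hD)
      then show ?thesis
        by (auto simp: alg_hom_def sa_part_def Bi.gen_star)
    qed
    moreover have "continuous_map T (norm_topology (B' i) (N' i)) (\<rho> i)"
    proof -
      have "continuous_map T (norm_topology (B' i) (N' i)) ((\<lambda>x. x i) \<circ> (h \<circ> \<phi>))"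
        by (intro continuous_map_compose[OF continuous_map_compose[OF \<phi>_cont cont_h]] F.continuous_map_projection i)
      then show ?thesis
        by (rule continuous_map_eq) (simp add: \<rho>_def \<phi>0_def T)
    qed
    ultimately show "jordan_seminorm A T (\<lambda>w. N' i (formal_eval (B' i) (\<rho> i) w))"
      unfolding jordan_seminorm_iff[OF rep[OF i] T]
      by (auto simp: cont_jordan_hom_def sa_topology_def continuous_map_in_subtopology sa_part_def Bi.gen_star)
  qed
  \<comment> \<open>The norm of a polynomial in \<open>env_factor (p i)\<close> is by construction
    its norm in \<open>B' i\<close>, so the extension lemma applies with equality.\<close>
  have "\<exists>g. g \<in> star_hom (env_factor (p i)) (B' i) \<and> (\<forall>w. g (env_eval (p i) w) = formal_eval (B' i) (\<rho> i) w)"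
    if i: "i \<in> \<Lambda>'" for i
  proof -
    have "\<exists>g \<in> star_hom (env_factor (p i)) (B' i). (\<forall>x\<in>carrier (env_factor (p i)). N' i (g x) \<le> env_norm (p i) x) \<and>
        (\<forall>w. g (env_eval (p i) w) = formal_eval (B' i) (\<rho> i) w)"
    proof (rule star_hom_extension[OF env_dense_rep[OF p[OF i]] rep[OF i]])
      show "N' i (formal_eval (B' i) (\<rho> i) w) \<le> env_norm (p i) (env_eval (p i) w)" for w
        unfolding env_norm_eval[OF p[OF i]] by (simp add: p_def)
    qed
    then show ?thesis
      by blast
  qed
  then obtain g where g: "\<And>i. i \<in> \<Lambda>' \<Longrightarrow> g i \<in> star_hom (env_factor (p i)) (B' i)"
    and g_eval: "\<And>i w. i \<in> \<Lambda>' \<Longrightarrow> g i (env_eval (p i) w) = formal_eval (B' i) (\<rho> i) w"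
    by metis
  have g_gen: "g i (env_gen (p i) a) = \<rho> i a" if i: "i \<in> \<Lambda>'" for i a
  proof -
    interpret cstar_rep "B' i" "N' i" "\<rho> i" by (rule rep[OF i])
    show ?thesis
      using g_eval[OF i, of "[(1, [a])]"] env_eval_gen[OF p[OF i]] by simp
  qed
  have connecting_\<rho>: "f' i j (\<rho> j a) = \<rho> i a" if "(i, j) \<in> r'" for i j a
    unfolding \<rho>_def by (rule F.L_compatible[OF hD(1)[OF \<phi>0_in] that])
  \<comment> \<open>The connecting map sends polynomials at \<open>j\<close> to the same polynomials
    at \<open>i\<close> and is contractive, which gives the pointwise inequality of the
    seminorms.\<close>
  have p_rel: "(p i, p j) \<in> env_rel A T" if ij: "(i, j) \<in> r'" for i j
  proof -
    have i: "i \<in> \<Lambda>'" and j: "j \<in> \<Lambda>'" using F.rel_in[OF ij] by auto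
    interpret Bj: cstar_rep "B' j" "N' j" "\<rho> j" by (rule rep[OF j])
    have "f' i j (formal_eval (B' j) (\<rho> j) w) = formal_eval (B' i) (f' i j \<circ> \<rho> j) w" for w
      by (rule hom_eval[OF F.nonassoc[OF j] F.nonassoc[OF i] star_hom_alg_hom[OF F.connecting[OF ij]]]) simp
    moreover have "f' i j \<circ> \<rho> j = \<rho> i"
      using connecting_\<rho>[OF ij] by auto
    ultimately have "p i w \<le> p j w" for w
      using star_hom_contractive[OF F.cstar[OF j] F.cstar[OF i] F.connecting[OF ij] Bj.eval_in, of w]
      by (simp add: p_def)
    then show ?thesis
      using p i j by (simp add: env_rel_def)
  qed
  \<comment> \<open>Both ways around the square send the generator of \<open>a\<close> to
    \<open>\<rho> i a\<close>, so they coincide by density.\<close>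
  have compat: "f' i j (g j y) = g i (env_map (p i) (p j) y)"
    if ij: "(i, j) \<in> r'" and y: "y \<in> carrier (env_factor (p j))" for i j y
  proof -
    have i: "i \<in> \<Lambda>'" and j: "j \<in> \<Lambda>'" using F.rel_in[OF ij] by auto
    have "(f' i j \<circ> g j) y = (g i \<circ> env_map (p i) (p j)) y"
      by (rule star_hom_eq_on_dense[OF env_dense_rep[OF p[OF j]] F.cstar[OF i]
            star_hom_comp[OF g[OF j] F.connecting[OF ij]] star_hom_comp[OF env_map(1)[OF p_rel[OF ij]] g[OF i]] _ y])
        (simp add: g_gen[OF i] g_gen[OF j] connecting_\<rho>[OF ij] env_map_gen[OF p_rel[OF ij]])
    then show ?thesis by simp
  qed
  define G where "G x = (\<lambda>i\<in>\<Lambda>'. g i (x (p i)))" for x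
  have G_in: "G x \<in> carrier F.L" if x: "x \<in> carrier L" for x
    unfolding G_def
  proof (rule F.L_I)
    show "g i (x (p i)) \<in> carrier (B' i)" if "i \<in> \<Lambda>'" for i
      by (rule star_homD(1)[OF g[OF that] L_in[OF x p[OF that]]])
    fix i j assume ij: "(i, j) \<in> r'"
    then have j: "j \<in> \<Lambda>'" using F.rel_in by auto
    show "f' i j (g j (x (p j))) = g i (x (p i))"
      unfolding compat[OF ij L_in[OF x p[OF j]]] L_compatible[OF x p_rel[OF ij]] ..
  qed
  have "G \<in> star_hom L F.L"
    by (rule star_homI[OF G_in])
      (use star_homD(2-5)[OF g] L_in p in \<open>auto simp: G_def intro!: restrict_ext\<close>)
  moreover have k_hom: "k \<in> star_hom F.L C"
    by (rule star_hom_inverse[OF C(1) h]) (rule k_in hk kh, assumption)+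
  moreover have "continuous_map TL F.TL G"
  proof (rule F.continuous_map_TL)
    show "G x \<in> carrier F.L" if "x \<in> topspace TL" for x
      using that G_in by (simp only: topspace_TL)
    fix i assume i: "i \<in> \<Lambda>'"
    have "continuous_map TL (norm_topology (B' i) (N' i)) (g i \<circ> (\<lambda>x. x (p i)))"
      by (rule continuous_map_compose[OF continuous_map_projection[OF p[OF i]]
            continuous_map_star_hom[OF env_cstar_algebra[OF p[OF i]] F.cstar[OF i] g[OF i]]])
    then show "continuous_map TL (norm_topology (B' i) (N' i)) (\<lambda>x. G x i)"
      using i by (simp add: G_def o_def)
  qed
  \<comment> \<open>\<open>G\<close> maps between the two limits; \<open>k\<close> carries the
    result back to \<open>C\<close>, and it is a homomorphism as the inverse of one.\<close>
  ultimately have "k \<circ> G \<in> cont_star_hom L TL C TC"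
    unfolding cont_star_hom_def using star_hom_comp continuous_map_compose cont_k by blast
  moreover have "\<phi> a = (k \<circ> G) (\<psi> a)" if a: "a \<in> carrier A" for a
  proof -
    have "G (\<psi> a) = h (\<phi>0 a)"
    proof (rule F.L_eqI[OF G_in[OF psi.gen_in] hD(1)[OF \<phi>0_in]])
      fix i assume i: "i \<in> \<Lambda>'"
      then show "G (\<psi> a) i = h (\<phi>0 a) i"
        by (simp add: G_def \<psi>_at[OF p] g_gen) (simp add: \<rho>_def)
    qed
    then show ?thesis
      using kh[OF \<phi>0_in[of a]] a by (simp add: \<phi>0_def)
  qed
  ultimately show ?thesis by blast
qed

text \<open>Reversing the product leaves the Jordan product of \<open>L\<close> unchanged, so
  \<open>\<psi>\<close> is also a continuous Jordan homomorphism into the opposite, to which the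
  universal property applies.\<close>

lemma antiautomorphism: "has_order2_antiautomorphism A L TL \<psi>"
proof -
  have "\<psi> \<in> alg_hom A (sa_part (opposite L))"
  proof -
    have "x \<otimes>\<^bsub>sa_part (opposite L)\<^esub> y = x \<otimes>\<^bsub>sa_part L\<^esub> y" if "x \<in> carrier L" "y \<in> carrier L" for x y
      using that by (simp add: sa_part_def psi.M.a_comm psi.mult_closed del: star_proj_lim_simps)
    then show ?thesis
      using \<psi>_jordan_hom psi.gen_in
      by (simp add: cont_jordan_hom_def alg_hom_def sa_part_def del: star_proj_lim_simps)
  qed
  then have "\<psi> \<in> cont_jordan_hom A T (sa_part (opposite L)) (sa_topology (opposite L) TL)"
    using \<psi>_jordan_hom by (simp add: cont_jordan_hom_def sa_topology_def sa_part_def del: star_proj_lim_simps)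
  from universal[OF lc_star_algebra_opposite[OF lc_star_algebra_L] this]
  obtain \<Phi> where \<Phi>: "\<Phi> \<in> star_hom L (opposite L)" "continuous_map TL TL \<Phi>"
    and \<Phi>_\<psi>: "\<And>a. a \<in> carrier A \<Longrightarrow> \<Phi> (\<psi> a) = \<psi> a"
    unfolding cont_star_hom_def by force
  note \<Phi>D = star_homD[OF \<Phi>(1), unfolded opposite_simps]
  \<comment> \<open>Two reversals cancel, so the square is a continuous *-homomorphism fixing the
    generators, hence the identity. Order 2 and bijectivity both follow.\<close>
  have "\<Phi> \<circ> \<Phi> \<in> star_hom L L"
    by (rule star_homI) (simp_all add: \<Phi>D del: star_proj_lim_simps)
  then have "\<Phi> \<circ> \<Phi> \<in> cont_star_hom L TL L TL"
    using continuous_map_compose[OF \<Phi>(2) \<Phi>(2)] by (simp add: cont_star_hom_def)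
  moreover have "(\<lambda>x. x) \<in> cont_star_hom L TL L TL"
    by (simp add: cont_star_hom_def star_hom_def alg_hom_def del: star_proj_lim_simps)
  ultimately have "(\<Phi> \<circ> \<Phi>) x = x" if "x \<in> carrier L" for x
    by (rule cont_star_hom_eq_on_generators[OF star_algebra_L topspace_TL star_algebra_L Hausdorff_TL _ _ generates _ _ that])
      (use \<Phi>_\<psi> psi.gen_in in auto)
  then have \<Phi>\<Phi>: "\<Phi> (\<Phi> x) = x" if "x \<in> carrier L" for x
    using that by simp
  have "bij_betw \<Phi> (carrier L) (carrier L)"
    by (rule bij_betwI[of _ _ _ \<Phi>]) (use \<Phi>D(1) \<Phi>\<Phi> in auto)
  then have "star_antiautomorphism L \<Phi>"
    using \<Phi>D by (simp add: star_antiautomorphism_def del: star_proj_lim_simps)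
  then show ?thesis
    unfolding has_order2_antiautomorphism_def using \<Phi>(2) \<Phi>\<Phi> \<Phi>_\<psi> by blast
qed

text \<open>The target types are variables while \<open>L\<close>, \<open>TL\<close> and
  \<open>\<psi>\<close> do not involve them, so a single envelope is universal for every choice of
  these types.\<close>

lemma enveloping_L: "enveloping TYPE(('i \<times> 'b) \<times> 'c) A T L TL \<psi>"
  unfolding enveloping_def universal_property_def
  using \<psi>_jordan_hom generates antiautomorphism universal by blast

end

section \<open>Uniqueness and the conclusion\<close>

lemma cont_star_hom_comp:
  "\<lbrakk>f \<in> cont_star_hom M T N S; g \<in> cont_star_hom N S K R\<rbrakk> \<Longrightarrow> g \<circ> f \<in> cont_star_hom M T K R"
  unfolding cont_star_hom_def using star_hom_comp continuous_map_compose by blast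

lemma universal_propertyD:
  fixes C :: "'c star_alg"
  assumes "universal_property TYPE(('i \<times> 'b) \<times> 'c) A T U TU \<psi>" "lc_star_algebra TYPE('i \<times> 'b) C TC"
    "\<phi> \<in> cont_jordan_hom A T (sa_part C) (sa_topology C TC)"
  shows "\<exists>\<phi>' \<in> cont_star_hom U TU C TC. \<forall>a\<in>carrier A. \<phi> a = \<phi>' (\<psi> a)"
  using assms unfolding universal_property_def by simp

text \<open>The type arguments cross: each algebra is universal for targets on the type of the
  other. This gives continuous homomorphisms both ways, and their composites fix the generators, so
  they are identities.\<close>

lemma envelopes_isomorphic:
  fixes U :: "'u star_alg" and U' :: "'v star_alg"
  assumes U: "lc_star_algebra TYPE('i \<times> 'b) U TU" "enveloping TYPE(('j \<times> 'd) \<times> 'v) A T U TU \<psi>"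
    and U': "lc_star_algebra TYPE('j \<times> 'd) U' TU'" "enveloping TYPE(('i \<times> 'b) \<times> 'u) A T U' TU' \<psi>'"
  shows "\<exists>\<theta> \<in> topological_star_iso U TU U' TU'. \<forall>a\<in>carrier A. \<theta> (\<psi> a) = \<psi>' a"
proof -
  have \<psi>: "\<psi> \<in> cont_jordan_hom A T (sa_part U) (sa_topology U TU)"
    and \<psi>': "\<psi>' \<in> cont_jordan_hom A T (sa_part U') (sa_topology U' TU')"
    and gen: "generates_lc_star U TU (\<psi> ` carrier A)" and gen': "generates_lc_star U' TU' (\<psi>' ` carrier A)"
    using U(2) U'(2) by (auto simp: enveloping_def)
  have alg: "star_algebra U" "star_algebra U'" "topspace TU = carrier U" "topspace TU' = carrier U'"
    using U(1) U'(1) by (auto simp: lc_star_algebra_def topological_algebra_def)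
  note haus = lc_star_algebra_Hausdorff[OF U(1)] lc_star_algebra_Hausdorff[OF U'(1)]
  have in_U: "\<psi> ` carrier A \<subseteq> carrier U" "\<psi>' ` carrier A \<subseteq> carrier U'"
    using \<psi> \<psi>' by (auto simp: cont_jordan_hom_def alg_hom_def sa_part_def)
  have "universal_property TYPE(('j \<times> 'd) \<times> 'v) A T U TU \<psi>"
    "universal_property TYPE(('i \<times> 'b) \<times> 'u) A T U' TU' \<psi>'"
    using U(2) U'(2) by (simp_all add: enveloping_def)
  note up = universal_propertyD[OF this(1) U'(1) \<psi>'] universal_propertyD[OF this(2) U(1) \<psi>]
  obtain \<theta> where \<theta>: "\<theta> \<in> cont_star_hom U TU U' TU'" "\<And>a. a \<in> carrier A \<Longrightarrow> \<psi>' a = \<theta> (\<psi> a)"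
    using up(1) by blast
  obtain \<theta>' where \<theta>': "\<theta>' \<in> cont_star_hom U' TU' U TU" "\<And>a. a \<in> carrier A \<Longrightarrow> \<psi> a = \<theta>' (\<psi>' a)"
    using up(2) by blast
  have id: "(\<lambda>x. x) \<in> cont_star_hom M S M S" for M :: "'w star_alg" and S
    by (simp add: cont_star_hom_def star_hom_def alg_hom_def)
  have "(\<theta>' \<circ> \<theta>) x = x" if "x \<in> carrier U" for x
    by (rule cont_star_hom_eq_on_generators[OF alg(1,3,1) haus(1) cont_star_hom_comp[OF \<theta>(1) \<theta>'(1)] id gen _ in_U(1) that])
      (auto simp flip: \<theta>(2) \<theta>'(2))
  then have inv: "\<theta>' (\<theta> x) = x" if "x \<in> carrier U" for x
    using that by simp
  have "(\<theta> \<circ> \<theta>') x = x" if "x \<in> carrier U'" for x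
    by (rule cont_star_hom_eq_on_generators[OF alg(2,4,2) haus(2) cont_star_hom_comp[OF \<theta>'(1) \<theta>(1)] id gen' _ in_U(2) that])
      (auto simp flip: \<theta>(2) \<theta>'(2))
  then have inv': "\<theta> (\<theta>' x) = x" if "x \<in> carrier U'" for x
    using that by simp
  have "homeomorphic_maps TU TU' \<theta> \<theta>'"
    using \<theta>(1) \<theta>'(1) inv inv' alg(3,4) by (simp add: homeomorphic_maps_def cont_star_hom_def)
  moreover have "bij_betw \<theta> (carrier U) (carrier U')"
    using \<theta>(1) \<theta>'(1) inv inv'
    by (intro bij_betwI[of _ _ _ \<theta>']) (auto simp: cont_star_hom_def dest: star_homD(1))
  ultimately have "\<theta> \<in> topological_star_iso U TU U' TU'"
    using \<theta>(1) by (auto simp: topological_star_iso_def cont_star_hom_def homeomorphic_map_maps)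
  then show ?thesis
    using \<theta>(2) by auto
qed

theorem theorem3:
  fixes A :: "(real, 'a) module" and T :: "'a topology"
  assumes "ljb_algebra TYPE('i \<times> 'b) A T"
  shows "\<exists>(U :: 'a env star_alg) TU \<psi>.
    lc_star_algebra TYPE('a env_index \<times> 'a env_factor) U TU \<and>
    enveloping TYPE(('a env_index \<times> 'a env_factor) \<times> 'a env) A T U TU \<psi> \<and>
    enveloping TYPE(('j \<times> 'd) \<times> 'c) A T U TU \<psi> \<and>
    (\<forall>(U' :: 'c star_alg) TU' \<psi>'.
       lc_star_algebra TYPE('j \<times> 'd) U' TU' \<longrightarrow>
       enveloping TYPE(('a env_index \<times> 'a env_factor) \<times> 'a env) A T U' TU' \<psi>' \<longrightarrow>
       (\<exists>\<theta> \<in> topological_star_iso U TU U' TU'. \<forall>a\<in>carrier A. \<theta> (\<psi> a) = \<psi>' a))"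
proof -
  interpret envelope A T
    using assms
    by (simp add: envelope_def ljb_algebra_def jordan_algebra_def topological_algebra_def)
  show ?thesis
    by (intro exI[of _ L] exI[of _ TL] exI[of _ \<psi>] conjI allI impI lc_star_algebra_L enveloping_L)
      \<comment> \<open>Here the targets of \<open>enveloping_L\<close> lie on \<open>'c\<close>, so
        that the rival \<open>U'\<close> is one of them; the assumed universality of
        \<open>U'\<close> for targets on \<open>'a env\<close> supplies the map back.\<close>
      (rule envelopes_isomorphic[OF lc_star_algebra_L enveloping_L])
qed

end
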